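(* Let $\Gamma$ be a torsionless grading monoid and let $R=\bigoplus_{\alpha\in\Gamma}R_\alpha$ be a $\Gamma$-graded integral domain such that the extension $R_0\subset R$ is inert. Then $Cl(R)=HCl(R)$ if and only if $R$ is almost normal.
   Context: All rings are integral domains. A torsionless grading monoid is a commutative cancellative monoid $\Gamma$, written additively, whose quotient group $\langle\Gamma\rangle$ is torsion-free. A $\Gamma$-graded domain is an integral domain $R=\bigoplus_{\alpha\in\Gamma}R_\alpha$ with $R_\alpha R_\beta\subset R_{\alpha+\beta}$. Let $S$ be the set of nonzero homogeneous elements of $R$; $R_S$ is $\langle\Gamma\rangle$-graded with $(R_S)_\alpha=\{a/b : a\in R_\beta,\ 0\ne b\in R_\gamma,\ \alpha=\beta-\gamma\}$. Almost normal: every homogeneous element of $R_S$ of nonzero degree which is integral over $R$ lies in $R$. Inert: an extension $A\subset B$ of integral domains is inert if whenever $x,y\in B$ and $0\neq xy\in A$, then $x=ru$ and $y=su^{-1}$ for some $r,s\in A$ and some unit $u$ of $B$. Ideals: for nonzero fractional ideals $I,J$ of a domain $A$ with quotient field $K$, $(I:J)=\{x\in K: xJ\subset I\}$, $I^{-1}=(A:I)$, $I_v=(I^{-1})^{-1}$, and $I_t=\bigcup\{J_v : J\subset I \text{ a nonzero finitely generated fractional ideal}\}$. $I$ is a $t$-ideal if $I_t=I$. A $t$-ideal is $t$-invertible if it is invertible in the monoid of fractional $t$-ideals under $(I,J)\mapsto (IJ)_t$ (equivalently $(II^{-1})_t=A$). Class groups: $Cl(A)$ is the group of $t$-invertible fractional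 $t$-ideals of $A$ under $t$-multiplication modulo the subgroup of nonzero principal fractional ideals. A fractional ideal $I$ of the graded domain $R$ is homogeneous if there is $s\in S$ such that $sI$ is a homogeneous (integral) ideal of $R$. $HCl(R)$ is the group of homogeneous $t$-invertible fractional $t$-ideals of $R$ modulo its subgroup of principal fractional ideals; it is regarded as a subgroup of $Cl(R)$, so $Cl(R)=HCl(R)$ means that every class in $Cl(R)$ contains a homogeneous $t$-invertible fractional $t$-ideal. *)

theory Defs
  imports
    "HOL-Computational_Algebra.Polynomial_Factorial"
    "HOL-Algebra.Coset"
begin

section \<open>The quotient group of a commutative monoid\<close>

text \<open>
  The library class \<open>cancel_comm_monoid_add\<close> also axiomatizes a (truncated) subtraction, which an
  arbitrary cancellative commutative monoid need not carry.  Therefore the base class is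
  \<^class>\<open>comm_monoid_add\<close> and cancellation is stated separately.
\<close>

definition quot_rel :: "'g::comm_monoid_add \<times> 'g \<Rightarrow> 'g \<times> 'g \<Rightarrow> bool" where
  "quot_rel p q \<longleftrightarrow> (\<exists>k. fst p + snd q + k = fst q + snd p + k)"

lemma equivp_quot_rel: "equivp (quot_rel :: 'g::comm_monoid_add \<times> 'g \<Rightarrow> _)"
proof (rule equivpI)
  show "reflp (quot_rel :: 'g \<times> 'g \<Rightarrow> _)"
    by (auto simp: reflp_def quot_rel_def)
  show "symp (quot_rel :: 'g \<times> 'g \<Rightarrow> _)"
    unfolding symp_def quot_rel_def by metis
  show "transp (quot_rel :: 'g \<times> 'g \<Rightarrow> _)"
  proof (rule transpI)
    fix p q r :: "'g \<times> 'g"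
    assume "quot_rel p q" "quot_rel q r"
    then obtain k l where k: "fst p + snd q + k = fst q + snd p + k"
      and l: "fst q + snd r + l = fst r + snd q + l"
      by (auto simp: quot_rel_def)
    have "fst p + snd r + (snd q + k + l) = (fst p + snd q + k) + (snd r + l)"
      by (simp add: ac_simps)
    also have "\<dots> = (fst q + snd r + l) + (snd p + k)"
      unfolding k by (simp add: ac_simps)
    also have "\<dots> = fst r + snd p + (snd q + k + l)"
      unfolding l by (simp add: ac_simps)
    finally show "quot_rel p r"
      unfolding quot_rel_def by blast
  qed
qed

quotient_type (overloaded) 'g quot_group = "'g::comm_monoid_add \<times> 'g" / quot_rel
  by (rule equivp_quot_rel)

instantiation quot_group :: (comm_monoid_add) ab_group_add
begin

lift_definition zero_quot_group :: "'a quot_group" is "(0, 0)" .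

lift_definition plus_quot_group :: "'a quot_group \<Rightarrow> 'a quot_group \<Rightarrow> 'a quot_group"
  is "\<lambda>p q. (fst p + fst q, snd p + snd q)"
proof -
  fix p p' q q' :: "'a \<times> 'a"
  assume "quot_rel p p'" "quot_rel q q'"
  then obtain k l where k: "fst p + snd p' + k = fst p' + snd p + k"
    and l: "fst q + snd q' + l = fst q' + snd q + l"
    by (auto simp: quot_rel_def)
  have "(fst p + fst q) + (snd p' + snd q') + (k + l)
      = (fst p + snd p' + k) + (fst q + snd q' + l)"
    by (simp add: ac_simps)
  also have "\<dots> = (fst p' + fst q') + (snd p + snd q) + (k + l)"
    unfolding k l by (simp add: ac_simps)
  finally show "quot_rel (fst p + fst q, snd p + snd q) (fst p' + fst q', snd p' + snd q')"
    unfolding quot_rel_def fst_conv snd_conv by blast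
qed

lift_definition uminus_quot_group :: "'a quot_group \<Rightarrow> 'a quot_group"
  is "\<lambda>p. (snd p, fst p)"
  unfolding quot_rel_def fst_conv snd_conv by (metis add.commute)

definition minus_quot_group :: "'a quot_group \<Rightarrow> 'a quot_group \<Rightarrow> 'a quot_group" where
  "minus_quot_group x y = x + - y"

instance
proof
  fix a b c :: "'a quot_group"
  show "a + b + c = a + (b + c)"
    by transfer (auto simp: quot_rel_def ac_simps)
  show "a + b = b + a"
    by transfer (auto simp: quot_rel_def ac_simps)
  show "0 + a = a"
    by transfer (auto simp: quot_rel_def ac_simps)
  show "- a + a = 0"
    by transfer (auto simp: quot_rel_def ac_simps)
  show "a - b = a + - b"
    by (rule minus_quot_group_def)
qed

end

lift_definition to_quot_group :: "'g::comm_monoid_add \<Rightarrow> 'g quot_group" is "\<lambda>a. (a, 0)" .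

definition torsion_free :: "'h::ab_group_add itself \<Rightarrow> bool" where
  "torsion_free _ \<longleftrightarrow> (\<forall>n>0. \<forall>x::'h. (\<Sum>i<(n::nat). x) = 0 \<longrightarrow> x = 0)"

definition torsionless_grading_monoid :: "'g::comm_monoid_add itself \<Rightarrow> bool" where
  "torsionless_grading_monoid _ \<longleftrightarrow>
     (\<forall>a b c::'g. a + b = a + c \<longrightarrow> b = c) \<and> torsion_free TYPE('g quot_group)"


section \<open>Graded domains\<close>

text \<open>
  A grading of the domain \<^typ>\<open>'a\<close> is the family \<open>D\<close> of its graded pieces;
  \<open>decomposes D x f\<close> says that \<open>f\<close> is the family of homogeneous components of \<open>x\<close>.
\<close>

definition decomposes :: "('g \<Rightarrow> 'a::idom set) \<Rightarrow> 'a \<Rightarrow> ('g \<Rightarrow> 'a) \<Rightarrow> bool" where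
  "decomposes D x f \<longleftrightarrow>
     (\<forall>\<alpha>. f \<alpha> \<in> D \<alpha>) \<and> finite {\<alpha>. f \<alpha> \<noteq> 0} \<and> x = (\<Sum>\<alpha> | f \<alpha> \<noteq> 0. f \<alpha>)"

definition graded_domain :: "('g::comm_monoid_add \<Rightarrow> 'a::idom set) \<Rightarrow> bool" where
  "graded_domain D \<longleftrightarrow>
     (\<forall>\<alpha>. 0 \<in> D \<alpha> \<and> (\<forall>x\<in>D \<alpha>. \<forall>y\<in>D \<alpha>. x - y \<in> D \<alpha>)) \<and>
     (\<forall>\<alpha> \<beta>. \<forall>x\<in>D \<alpha>. \<forall>y\<in>D \<beta>. x * y \<in> D (\<alpha> + \<beta>)) \<and>
     (\<forall>x. \<exists>!f. decomposes D x f)"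

definition nonzero_homogeneous :: "('g \<Rightarrow> 'a::idom set) \<Rightarrow> 'a set" where
  "nonzero_homogeneous D = {s. s \<noteq> 0 \<and> (\<exists>\<alpha>. s \<in> D \<alpha>)}"

text \<open>The piece \<open>(R\<^sub>S)\<^sub>\<alpha>\<close> of the homogeneous quotient ring, as a subset of the quotient field.\<close>

definition RS_piece ::
    "('g::comm_monoid_add \<Rightarrow> 'a::idom set) \<Rightarrow> 'g quot_group \<Rightarrow> 'a fract set" where
  "RS_piece D \<alpha> = {to_fract a / to_fract b | a b \<beta> \<gamma>.
     a \<in> D \<beta> \<and> b \<in> D \<gamma> \<and> b \<noteq> 0 \<and> \<alpha> = to_quot_group \<beta> - to_quot_group \<gamma>}"

definition integral_elem :: "'a::idom fract \<Rightarrow> bool" where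
  "integral_elem x \<longleftrightarrow> (\<exists>p::'a poly. lead_coeff p = 1 \<and> poly (map_poly to_fract p) x = 0)"

definition almost_normal :: "('g::comm_monoid_add \<Rightarrow> 'a::idom set) \<Rightarrow> bool" where
  "almost_normal D \<longleftrightarrow>
     (\<forall>\<alpha>. \<alpha> \<noteq> 0 \<longrightarrow> (\<forall>x\<in>RS_piece D \<alpha>. integral_elem x \<longrightarrow> x \<in> range to_fract))"

text \<open>Inertness of the extension from a subring \<open>A\<close> to the whole domain \<^typ>\<open>'b\<close>; \<open>w\<close> is the inverse of \<open>u\<close>.\<close>

definition inert :: "'b::idom set \<Rightarrow> bool" where
  "inert A \<longleftrightarrow> (\<forall>x y. x * y \<noteq> 0 \<and> x * y \<in> A \<longrightarrow>
     (\<exists>r\<in>A. \<exists>s\<in>A. \<exists>u w. u * w = 1 \<and> x = r * u \<and> y = s * w))"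


section \<open>Fractional ideals and the t-operation\<close>

definition fract_scale :: "'a::idom \<Rightarrow> 'a fract \<Rightarrow> 'a fract" where
  "fract_scale a x = to_fract a * x"

interpretation fract_module: module fract_scale
  by standard (simp_all add: fract_scale_def algebra_simps)

interpretation ring_module: module "(*) :: 'a::comm_ring_1 \<Rightarrow> 'a \<Rightarrow> 'a"
  by standard (simp_all add: algebra_simps)

definition fractional_ideal :: "'a::idom fract set \<Rightarrow> bool" where
  "fractional_ideal I \<longleftrightarrow> fract_module.subspace I \<and> I \<noteq> {0} \<and>
     (\<exists>d. d \<noteq> 0 \<and> (\<forall>x\<in>I. fract_scale d x \<in> range to_fract))"

definition ideal_quotient :: "'a::idom fract set \<Rightarrow> 'a fract set \<Rightarrow> 'a fract set" where
  "ideal_quotient I J = {x. \<forall>y\<in>J. x * y \<in> I}"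

definition ideal_inverse :: "'a::idom fract set \<Rightarrow> 'a fract set" where
  "ideal_inverse I = ideal_quotient (range to_fract) I"

definition v_closure :: "'a::idom fract set \<Rightarrow> 'a fract set" where
  "v_closure I = ideal_inverse (ideal_inverse I)"

definition t_closure :: "'a::idom fract set \<Rightarrow> 'a fract set" where
  "t_closure I = \<Union>{v_closure J | J. J \<subseteq> I \<and> fractional_ideal J \<and>
     (\<exists>B. finite B \<and> J = fract_module.span B)}"

definition ideal_product :: "'a::idom fract set \<Rightarrow> 'a fract set \<Rightarrow> 'a fract set" where
  "ideal_product I J = fract_module.span {x * y | x y. x \<in> I \<and> y \<in> J}"

definition t_ideal_monoid :: "'a::idom fract set monoid" where
  "t_ideal_monoid =
     \<lparr>carrier = {I. fractional_ideal I \<and> t_closure I = I},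
      monoid.mult = (\<lambda>I J. t_closure (ideal_product I J)),
      one = range to_fract\<rparr>"


section \<open>Class groups\<close>

definition principal_ideals :: "'a::idom fract set set" where
  "principal_ideals = {fract_module.span {x} | x. x \<noteq> 0}"

definition t_invertible_group :: "'a::idom fract set monoid" where
  "t_invertible_group = units_of t_ideal_monoid"

definition class_group :: "'a::idom fract set set monoid" where
  "class_group = t_invertible_group Mod principal_ideals"

definition homogeneous_ideal :: "('g \<Rightarrow> 'a::idom set) \<Rightarrow> 'a set \<Rightarrow> bool" where
  "homogeneous_ideal D J \<longleftrightarrow> ring_module.subspace J \<and>
     (\<forall>x\<in>J. \<forall>f. decomposes D x f \<longrightarrow> (\<forall>\<alpha>. f \<alpha> \<in> J))"

definition homogeneous_fractional :: "('g \<Rightarrow> 'a::idom set) \<Rightarrow> 'a fract set \<Rightarrow> bool" where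
  "homogeneous_fractional D I \<longleftrightarrow> fractional_ideal I \<and>
     (\<exists>s\<in>nonzero_homogeneous D. \<exists>J. homogeneous_ideal D J \<and> fract_scale s ` I = to_fract ` J)"

definition homogeneous_t_invertible_group ::
    "('g \<Rightarrow> 'a::idom set) \<Rightarrow> 'a fract set monoid" where
  "homogeneous_t_invertible_group D = t_invertible_group
     \<lparr>carrier := {I \<in> carrier t_invertible_group. homogeneous_fractional D I}\<rparr>"

definition homogeneous_class_group :: "('g \<Rightarrow> 'a::idom set) \<Rightarrow> 'a fract set set monoid" where
  "homogeneous_class_group D = homogeneous_t_invertible_group D
     Mod {P \<in> principal_ideals. homogeneous_fractional D P}"

text \<open>
  The canonical map from the homogeneous class group to the class group sends the class of \<open>I\<close>
  modulo homogeneous principal ideals to its class modulo all principal ideals; the image of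
  this map is the homogeneous class group regarded as a subgroup of the class group.
\<close>

definition HCl_to_Cl :: "'a::idom fract set set \<Rightarrow> 'a fract set set" where
  "HCl_to_Cl C = principal_ideals <#>\<^bsub>t_invertible_group\<^esub> C"

end

theory Submission
  imports Defs
begin

text \<open>
  Let \<open>K\<close> be the quotient field of \<open>R\<close> and \<open>T \<subseteq> K\<close> the localization of \<open>R\<close> at its nonzero homogeneous
  elements.  The ring \<open>T\<close> is graded by a torsion-free group, and its nonzero homogeneous elements are
  units, so that it resembles a ring of Laurent polynomials over a field.  Two facts carry the proof.

  The first is Gauss' lemma (\<open>gauss_integral\<close>): if \<open>f g \<in> R\<close> for \<open>f, g \<in> T\<close>, every product of a component
  of \<open>f\<close> and a component of \<open>g\<close> is integral over \<open>R\<close>.  Indeed, let \<open>V\<close> be a valuation ring that contains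
  \<open>R\<close>, and order the degrees.  Among the components of \<open>f\<close>, and of \<open>g\<close>, of least value choose those of
  greatest degree.  Their product dominates all other terms in one component of \<open>f g\<close>, so it
  lies in \<open>V\<close>, and so do all other products, whose values are at least as large.  An element that is not integral
  over \<open>R\<close> is avoided by some valuation ring (\<open>valuation_ring_avoiding\<close>).

  The second is that any two elements of \<open>T\<close> have a least common multiple (\<open>lcm_subring_T\<close>).  The
  components of two elements lie in a finitely generated group of homogeneous units, which is free
  modulo degree \<open>0\<close>.  Over such a group \<open>T\<close> becomes an iterated ring of Laurent polynomials over a field; the
  adjunction of a transcendental element preserves least common multiples, again by Gauss' lemma.  The
  ring \<open>T\<close> itself is a free module over this subring, with a basis of homogeneous units.

  Now let \<open>R\<close> be almost normal.  A t-invertible t-ideal has the form \<open>I = {x. x B' \<subseteq> R}\<close> with a finite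
  set \<open>B'\<close>.  If \<open>d\<close> is a greatest common divisor of \<open>B'\<close> in \<open>T\<close>, the multiple \<open>d I = {y. y C \<subseteq> R}\<close> with
  \<open>C = B' / d\<close> is contained in \<open>T\<close>, and so is \<open>C\<close>.  For \<open>y \<in> d I\<close> and \<open>c \<in> C\<close> the products of
  components of \<open>y\<close> and \<open>c\<close> are integral over \<open>R\<close>, hence those of nonzero degree lie in \<open>R\<close>.  Inertness settles degree
  \<open>0\<close>: either \<open>R\<close> has a homogeneous unit of nonzero degree, by which \<open>y\<close> may be multiplied, or the
  degrees of \<open>R\<close> are nonnegative for some order, and then a nonzero product of degree \<open>0\<close> is the lowest
  component of \<open>y c\<close> (\<open>component_products\<close>).  Consequently \<open>d I\<close> is homogeneous.

  Conversely, let \<open>z\<close> be homogeneous of degree \<open>\<alpha> \<noteq> 0\<close> and a root of a monic polynomial with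
  homogeneous coefficients \<open>r\<^sub>i\<close> in \<open>R\<close>.  Write this polynomial as
  \<open>(X - z) (c\<^sub>0 X\<^bsup>n-1\<^esup> + \<dots> + c\<^bsub>n-1\<^esub>)\<close> and set \<open>X = 1\<close>.  With \<open>f = 1 - z\<close> and \<open>g = c\<^sub>0 + \<dots> + c\<^bsub>n-1\<^esub>\<close> this
  shows that \<open>f g = 1 + r\<^sub>0 + \<dots> + r\<^bsub>n-1\<^esub>\<close>.  In an order with \<open>\<alpha> > 0\<close> the lowest component of \<open>f g\<close> is \<open>1\<close>, and this
  implies that the ideal of all \<open>x\<close> with \<open>x g \<in> R\<close> and \<open>x a \<in> R\<close>, for a homogeneous common denominator
  \<open>a\<close> of \<open>f\<close> and \<open>g\<close>, is t-invertible.  If it is a multiple \<open>h L\<close> of a homogeneous ideal, \<open>h\<close> is a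
  unit of \<open>T\<close>, hence homogeneous.  So the ideal contains with \<open>f\<close> also the component \<open>1\<close> of \<open>f\<close>.
  Therefore \<open>g \<in> R\<close>, and the component \<open>c\<^sub>1 = z + r\<^bsub>n-1\<^esub>\<close> of \<open>g\<close> lies in \<open>R\<close>, and \<open>z\<close> does too.
\<close>

section \<open>Orderings of torsion-free abelian groups\<close>

text \<open>
  The order is a predicate instead of a type class because the proofs choose it according to the
  elements in question.
\<close>

definition translation_order :: "('i::comm_monoid_add \<Rightarrow> 'i \<Rightarrow> bool) \<Rightarrow> bool" where
  "translation_order lt \<longleftrightarrow>
     (\<forall>a. \<not> lt a a) \<and> (\<forall>a b c. lt a b \<longrightarrow> lt b c \<longrightarrow> lt a c) \<and>
     (\<forall>a b. a \<noteq> b \<longrightarrow> lt a b \<or> lt b a) \<and> (\<forall>a b c. lt a b \<longrightarrow> lt (a + c) (b + c))"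

lemma translation_order_converse:
  "translation_order lt \<Longrightarrow> translation_order (\<lambda>a b. lt b a)"
  unfolding translation_order_def by (intro conjI allI impI) simp_all

lemma translation_order_asym:
  assumes "translation_order lt" "lt a b" shows "\<not> lt b a"
proof -
  have "\<forall>a b c. lt a b \<longrightarrow> lt b c \<longrightarrow> lt a c" "\<forall>a. \<not> lt a a"
    using assms(1) by (simp_all add: translation_order_def)
  with assms(2) show ?thesis by blast
qed

lemma translation_order_max:
  assumes "translation_order lt" "finite A" "A \<noteq> {}"
  obtains m where "m \<in> A" "\<And>x. x \<in> A \<Longrightarrow> x \<noteq> m \<Longrightarrow> lt x m"
proof -
  have "\<exists>m\<in>A. \<forall>x\<in>A. x \<noteq> m \<longrightarrow> \<not> lt m x"
    using assms by (intro Finite_Set.bex_max_element)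
      (auto simp: translation_order_def asymp_on_def transp_on_def)
  then obtain m where "m \<in> A" "\<forall>x\<in>A. x \<noteq> m \<longrightarrow> \<not> lt m x" by (rule bexE)
  moreover have "lt a b \<or> lt b a" if "a \<noteq> b" for a b
    using assms(1) that by (simp add: translation_order_def)
  ultimately show ?thesis using that[of m] by blast
qed

lemma translation_order_add_le:
  assumes "translation_order lt" "a = a' \<or> lt a a'" "b = b' \<or> lt b b'"
    "a + b = a' + b'"
  shows "a = a' \<and> b = b'"
proof -
  have irr: "\<not> lt c c" and trans: "lt c d \<Longrightarrow> lt d e \<Longrightarrow> lt c e"
    and mono: "lt c d \<Longrightarrow> lt (c + e) (d + e)" for c d e
    using assms(1) unfolding translation_order_def by blast+
  have 1: "a + b = a' + b \<or> lt (a + b) (a' + b)" using assms(2) mono by blast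
  have 2: "a' + b = a' + b' \<or> lt (a' + b) (a' + b')"
    using assms(3) mono[of b b' a'] by (auto simp: add.commute)
  have "\<not> lt (a + b) (a' + b)" using 2 irr trans assms(4) by metis
  then have a: "a = a'" using assms(2) mono by blast
  have "\<not> lt b b'" using mono[of b b' a] assms(4) irr a by (auto simp: add.commute)
  with a assms(3) show ?thesis by blast
qed

definition pointed_cone :: "'h::ab_group_add set \<Rightarrow> bool" where
  "pointed_cone Q \<longleftrightarrow> 0 \<in> Q \<and> (\<forall>x\<in>Q. \<forall>y\<in>Q. x + y \<in> Q) \<and> (\<forall>x\<in>Q. - x \<in> Q \<longrightarrow> x = 0)"

lemma pointed_cone_multiple:
  "pointed_cone Q \<Longrightarrow> x \<in> Q \<Longrightarrow> (\<Sum>i<(n::nat). x) \<in> Q"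
  by (induction n) (auto simp: pointed_cone_def)

lemma sum_const_add:
  "(\<Sum>i<(m + n::nat). x) = (\<Sum>i<m. x) + (\<Sum>i<n. x::'h::ab_group_add)"
  by (induction n) (simp_all add: add.assoc)

lemma sum_const_mult:
  "(\<Sum>i<(m * n::nat). x) = (\<Sum>i<m. \<Sum>j<n. x::'h::ab_group_add)"
  by (induction m) (simp_all add: sum_const_add add.commute)

text \<open>
  If neither \<open>x\<close> nor \<open>- x\<close> belongs to a maximal cone \<open>Q\<close>, then the cone generated by \<open>Q\<close> and \<open>x\<close> is not pointed,
  so a positive multiple of \<open>- x\<close> belongs to \<open>Q\<close>; torsion-freeness allows to divide.
\<close>

lemma maximal_cone_total:
  fixes Q :: "'h::ab_group_add set"
  assumes tf: "torsion_free TYPE('h)" and Q: "pointed_cone Q"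
    and max: "\<And>Q'. pointed_cone Q' \<Longrightarrow> Q \<subseteq> Q' \<Longrightarrow> Q' = Q"
  shows "x \<in> Q \<or> - x \<in> Q"
proof -
  have tfD: "x = 0" if "n > 0" "(\<Sum>i<n. x) = 0" for n :: nat and x :: 'h
    using tf that unfolding torsion_free_def by blast
  have Qs: "a + b \<in> Q" if "a \<in> Q" "b \<in> Q" for a b
    using Q that unfolding pointed_cone_def by blast
  have Q0: "0 \<in> Q" and Qp: "\<And>a. a \<in> Q \<Longrightarrow> - a \<in> Q \<Longrightarrow> a = 0"
    using Q unfolding pointed_cone_def by auto
  \<comment> \<open>A maximal cone is closed under division by positive integers.\<close>
  define Q1 where "Q1 = {y. \<exists>n>0. (\<Sum>i<(n::nat). y) \<in> Q}"
  have "Q1 = Q"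
  proof (rule max)
    show "Q \<subseteq> Q1"
      unfolding Q1_def by (force intro: exI[of _ "1::nat"])
    have "a + b \<in> Q1" if "a \<in> Q1" "b \<in> Q1" for a b
    proof -
      from that obtain m n :: nat where mn: "m > 0" "n > 0" "(\<Sum>i<m. a) \<in> Q" "(\<Sum>i<n. b) \<in> Q"
        unfolding Q1_def by auto
      have "(\<Sum>i<m * n. a + b) = (\<Sum>j<n. \<Sum>i<m. a) + (\<Sum>i<m. \<Sum>j<n. b)"
        unfolding sum.distrib sum_const_mult by (subst (1) sum.swap) simp
      also have "\<dots> \<in> Q"
        by (intro Qs pointed_cone_multiple Q mn)
      finally show ?thesis
        unfolding Q1_def using mn by (auto intro!: exI[of _ "m * n"])
    qed
    moreover have "a = 0" if "a \<in> Q1" "- a \<in> Q1" for a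
    proof -
      from that obtain m n :: nat where mn: "m > 0" "n > 0" "(\<Sum>i<m. a) \<in> Q" "(\<Sum>i<n. - a) \<in> Q"
        unfolding Q1_def by auto
      have "(\<Sum>i<m * n. a) = (\<Sum>j<n. \<Sum>i<m. a)"
        unfolding sum_const_mult by (rule sum.swap)
      then have 1: "(\<Sum>i<m * n. a) \<in> Q" using pointed_cone_multiple[OF Q mn(3)] by simp
      have "- (\<Sum>i<m * n. a) = (\<Sum>i<m. \<Sum>j<n. - a)"
        unfolding sum_const_mult[symmetric] by (simp only: sum_negf)
      then have 2: "- (\<Sum>i<m * n. a) \<in> Q" using pointed_cone_multiple[OF Q mn(4)] by simp
      from Qp[OF 1 2] show "a = 0" using tfD[of "m * n" a] mn by simp
    qed
    moreover have "0 \<in> Q1" using \<open>Q \<subseteq> Q1\<close> Q0 by blast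
    ultimately show "pointed_cone Q1" unfolding pointed_cone_def by blast
  qed
  show ?thesis
  proof (rule ccontr)
    assume "\<not> (x \<in> Q \<or> - x \<in> Q)"
    then have x: "x \<notin> Q" "- x \<notin> Q" by auto
    define Q2 where "Q2 = {q + (\<Sum>i<(n::nat). x) | q n. q \<in> Q}"
    have "pointed_cone Q2"
      unfolding pointed_cone_def
    proof (intro conjI ballI impI)
      show "0 \<in> Q2" unfolding Q2_def using Q0 by (auto intro!: exI[of _ 0] exI[of _ "0::nat"])
    next
      fix a b assume "a \<in> Q2" "b \<in> Q2"
      then obtain q r m n where "a = q + (\<Sum>i<(m::nat). x)" "b = r + (\<Sum>i<(n::nat). x)" "q \<in> Q" "r \<in> Q"
        unfolding Q2_def by auto
      then have "a + b = (q + r) + (\<Sum>i<m + n. x)" "q + r \<in> Q"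
        by (auto simp: sum_const_add Qs algebra_simps)
      then show "a + b \<in> Q2" unfolding Q2_def by blast
    next
      fix a assume "a \<in> Q2" "- a \<in> Q2"
      then obtain q r m n where a: "a = q + (\<Sum>i<(m::nat). x)" "- a = r + (\<Sum>i<(n::nat). x)"
        and qr: "q \<in> Q" "r \<in> Q"
        unfolding Q2_def by auto
      have "(q + (\<Sum>i<m. x)) + (r + (\<Sum>i<n. x)) = a + - a" using a by simp
      then have 0: "(q + r) + (\<Sum>i<m + n. x) = 0" by (simp add: sum_const_add algebra_simps)
      then have "(\<Sum>i<m + n. x) = - (q + r)" by (metis add_eq_0_iff)
      then have "(\<Sum>i<m + n. - x) = q + r" by (simp only: sum_negf minus_minus)
      then have "(\<Sum>i<m + n. - x) \<in> Q" using Qs[OF qr] by simp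
      then have "- x \<in> Q" if "m + n > 0"
        using \<open>Q1 = Q\<close> that unfolding Q1_def by blast
      with x(2) have "m + n = 0" by blast
      then have "q = - r" "a = q" using 0 a by (auto simp: add_eq_0_iff)
      then show "a = 0" using Qp[of q] qr by auto
    qed
    moreover have "Q \<subseteq> Q2" unfolding Q2_def by (auto intro!: exI[of _ "0::nat"])
    ultimately have "Q2 = Q" by (rule max)
    moreover have "x \<in> Q2" unfolding Q2_def using Q0 by (force intro!: exI[of _ 0] exI[of _ "1::nat"])
    ultimately show False using x by simp
  qed
qed

text \<open>
  The cone \<open>{0}\<close> provides some order; for a domain without homogeneous units of nonzero degree, the
  cone of its degrees provides an order in which all of them are nonnegative.
\<close>

lemma pointed_cone_extends_to_order:
  fixes Q :: "'h::ab_group_add set"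
  assumes tf: "torsion_free TYPE('h)" and Q: "pointed_cone Q"
  obtains lt where "translation_order lt" "\<And>x::'h. x \<in> Q \<Longrightarrow> x \<noteq> 0 \<Longrightarrow> lt 0 x"
proof -
  define \<P> where "\<P> = {P. pointed_cone P \<and> Q \<subseteq> P}"
  have "\<exists>M\<in>\<P>. \<forall>X\<in>\<P>. M \<subseteq> X \<longrightarrow> X = M"
  proof (rule subset_Zorn_nonempty)
    show "\<P> \<noteq> {}" using Q unfolding \<P>_def by blast
    fix C assume "C \<noteq> {}" and chain: "subset.chain \<P> C"
    then have C: "\<And>P. P \<in> C \<Longrightarrow> pointed_cone P \<and> Q \<subseteq> P"
      and tot: "\<And>P P'. P \<in> C \<Longrightarrow> P' \<in> C \<Longrightarrow> P \<subseteq> P' \<or> P' \<subseteq> P"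
      unfolding subset_chain_def \<P>_def by blast+
    have "\<Union> C \<in> \<P> \<longleftrightarrow> pointed_cone (\<Union> C)"
      using \<open>C \<noteq> {}\<close> C unfolding \<P>_def by blast
    moreover have "pointed_cone (\<Union> C)"
      unfolding pointed_cone_def
    proof (intro conjI ballI impI)
      show "0 \<in> \<Union> C" using \<open>C \<noteq> {}\<close> C unfolding pointed_cone_def by blast
    next
      fix a b assume "a \<in> \<Union> C" "b \<in> \<Union> C"
      then obtain P where "P \<in> C" "a \<in> P" "b \<in> P" using tot by blast
      then show "a + b \<in> \<Union> C" using C[of P] unfolding pointed_cone_def by blast
    next
      fix a assume "a \<in> \<Union> C" "- a \<in> \<Union> C"
      then obtain P where "P \<in> C" "a \<in> P" "- a \<in> P" using tot by blast
      then show "a = 0" using C[of P] unfolding pointed_cone_def by blast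
    qed
    ultimately show "\<Union> C \<in> \<P>" by blast
  qed
  then obtain M where "M \<in> \<P>" and max: "\<forall>X\<in>\<P>. M \<subseteq> X \<longrightarrow> X = M" by (rule bexE)
  then have M: "pointed_cone M" "Q \<subseteq> M" by (simp_all add: \<P>_def)
  have tot: "x \<in> M \<or> - x \<in> M" for x
    by (rule maximal_cone_total[OF tf M(1)]) (use max M(2) in \<open>auto simp: \<P>_def\<close>)
  define lt where "lt a b \<longleftrightarrow> b - a \<in> M \<and> a \<noteq> b" for a b
  have add: "\<And>x y. x \<in> M \<Longrightarrow> y \<in> M \<Longrightarrow> x + y \<in> M" and point: "\<And>x. x \<in> M \<Longrightarrow> - x \<in> M \<Longrightarrow> x = 0"
    using M(1) unfolding pointed_cone_def by auto
  have "translation_order lt"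
    unfolding translation_order_def
  proof (intro conjI allI impI)
    show "\<not> lt a a" for a by (simp add: lt_def)
    show "lt a c" if "lt a b" "lt b c" for a b c
      using that add[of "b - a" "c - b"] point[of "b - a"] by (auto simp: lt_def)
    show "lt a b \<or> lt b a" if "a \<noteq> b" for a b
      using that tot[of "a - b"] by (auto simp: lt_def)
    show "lt (a + c) (b + c)" if "lt a b" for a b c
      using that by (auto simp: lt_def)
  qed
  moreover have "lt 0 x" if "x \<in> Q" "x \<noteq> 0" for x
    using that M(2) by (auto simp: lt_def)
  ultimately show ?thesis using that by blast
qed

section \<open>Integral elements and valuation rings\<close>

text \<open>
  Subrings are subsets of a fixed field, because the proofs have to compare many of them and to
  choose some by Zorn's lemma or by induction.
\<close>

definition field_subring :: "'k::field set \<Rightarrow> bool" where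
  "field_subring A \<longleftrightarrow> 1 \<in> A \<and> (\<forall>x\<in>A. \<forall>y\<in>A. x - y \<in> A \<and> x * y \<in> A)"

definition integral_over :: "'k::field set \<Rightarrow> 'k \<Rightarrow> bool" where
  "integral_over A z \<longleftrightarrow> (\<exists>p. lead_coeff p = 1 \<and> (\<forall>i. coeff p i \<in> A) \<and> poly p z = 0)"

definition polys_over :: "'k::field set \<Rightarrow> 'k poly set" where
  "polys_over A = {p. \<forall>i. coeff p i \<in> A}"

context
  fixes A :: "'k::field set"
  assumes A: "field_subring A"
begin

lemma field_subring_1: "1 \<in> A" and field_subring_diff: "x \<in> A \<Longrightarrow> y \<in> A \<Longrightarrow> x - y \<in> A"
  and field_subring_mult: "x \<in> A \<Longrightarrow> y \<in> A \<Longrightarrow> x * y \<in> A"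
  using A by (auto simp: field_subring_def)

lemma field_subring_0: "0 \<in> A"
  using field_subring_diff[OF field_subring_1 field_subring_1] by simp

lemma field_subring_minus: "x \<in> A \<Longrightarrow> - x \<in> A"
  using field_subring_diff[OF field_subring_0, of x] by simp

lemma field_subring_add: "x \<in> A \<Longrightarrow> y \<in> A \<Longrightarrow> x + y \<in> A"
  using field_subring_diff[of x "- y"] field_subring_minus by simp

lemma field_subring_sum: "(\<And>i. i \<in> S \<Longrightarrow> f i \<in> A) \<Longrightarrow> sum f S \<in> A"
  by (induction S rule: infinite_finite_induct) (auto simp: field_subring_0 field_subring_add)

lemma field_subring_power: "x \<in> A \<Longrightarrow> x ^ n \<in> A"
  by (induction n) (auto simp: field_subring_1 field_subring_mult)

lemmas field_subring_simps = field_subring_1 field_subring_0 field_subring_diff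
  field_subring_mult field_subring_minus field_subring_add field_subring_sum field_subring_power

lemma polys_over_const: "a \<in> A \<Longrightarrow> [:a:] \<in> polys_over A"
  by (auto simp: polys_over_def coeff_pCons field_subring_simps split: nat.split)

lemma polys_over_X: "[:0, 1:] \<in> polys_over A"
  by (auto simp: polys_over_def coeff_pCons field_subring_simps split: nat.split)

lemma polys_over_diff: "p \<in> polys_over A \<Longrightarrow> q \<in> polys_over A \<Longrightarrow> p - q \<in> polys_over A"
  by (auto simp: polys_over_def field_subring_simps)

lemma polys_over_add: "p \<in> polys_over A \<Longrightarrow> q \<in> polys_over A \<Longrightarrow> p + q \<in> polys_over A"
  by (auto simp: polys_over_def field_subring_simps)

lemma polys_over_mult: "p \<in> polys_over A \<Longrightarrow> q \<in> polys_over A \<Longrightarrow> p * q \<in> polys_over A"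
  by (auto simp: polys_over_def coeff_mult intro!: field_subring_simps)

lemma polys_over_smult: "a \<in> A \<Longrightarrow> p \<in> polys_over A \<Longrightarrow> smult a p \<in> polys_over A"
  by (auto simp: polys_over_def field_subring_simps)

lemma polys_over_monom: "a \<in> A \<Longrightarrow> monom a n \<in> polys_over A"
  by (auto simp: polys_over_def field_subring_simps)

lemma polys_over_sum: "(\<And>i. i \<in> S \<Longrightarrow> f i \<in> polys_over A) \<Longrightarrow> sum f S \<in> polys_over A"
  by (auto simp: polys_over_def coeff_sum intro!: field_subring_simps)

lemma polys_over_0: "0 \<in> polys_over A"
  by (auto simp: polys_over_def field_subring_simps)

lemma polys_over_eval: "x \<in> A \<Longrightarrow> p \<in> polys_over A \<Longrightarrow> poly p x \<in> A"
  by (auto simp: polys_over_def poly_altdef intro!: field_subring_simps)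

lemma field_subring_adjoin: "field_subring ((\<lambda>p. poly p y) ` polys_over A)"
  unfolding field_subring_def
proof (intro conjI ballI)
  show "1 \<in> (\<lambda>p. poly p y) ` polys_over A"
    by (rule image_eqI[of _ _ "[:1:]"]) (auto intro: polys_over_const field_subring_1)
  fix a b assume "a \<in> (\<lambda>p. poly p y) ` polys_over A" "b \<in> (\<lambda>p. poly p y) ` polys_over A"
  then obtain p q where *: "a = poly p y" "b = poly q y" "p \<in> polys_over A" "q \<in> polys_over A"
    by blast
  show "a - b \<in> (\<lambda>p. poly p y) ` polys_over A"
    by (rule image_eqI[of _ _ "p - q"]) (use * in \<open>auto intro: polys_over_diff\<close>)
  show "a * b \<in> (\<lambda>p. poly p y) ` polys_over A"
    by (rule image_eqI[of _ _ "p * q"]) (use * in \<open>auto intro: polys_over_mult\<close>)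
qed

lemma subset_adjoin: "A \<subseteq> (\<lambda>p. poly p y) ` polys_over A"
proof
  fix a assume "a \<in> A"
  then show "a \<in> (\<lambda>p. poly p y) ` polys_over A"
    by (intro image_eqI[of _ _ "[:a:]"]) (auto intro: polys_over_const)
qed

lemma mem_adjoin: "y \<in> (\<lambda>p. poly p y) ` polys_over A"
  by (rule image_eqI[of _ _ "[:0,1:]"]) (auto intro: polys_over_X)

end

lemma integral_overI:
  fixes A :: "'k::field set"
  assumes A: "field_subring A" and a: "\<And>i. i < n \<Longrightarrow> a i \<in> A" and z: "z ^ n = (\<Sum>i<n. a i * z ^ i)"
  shows "integral_over A z"
proof -
  define q where "q = (\<Sum>i<n. monom (a i) i)"
  define p where "p = monom 1 n - q"
  have deg: "coeff q i = 0" if "i \<ge> n" for i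
    using that by (auto simp: q_def coeff_sum intro!: sum.neutral)
  have "coeff p n = 1" by (simp add: p_def deg)
  moreover have "degree p \<le> n" by (rule degree_le) (auto simp: p_def deg)
  ultimately have "degree p = n" by (metis le_antisym le_degree zero_neq_one)
  with \<open>coeff p n = 1\<close> have "lead_coeff p = 1" by simp
  moreover have "p \<in> polys_over A"
    unfolding p_def q_def using a
    by (intro polys_over_diff polys_over_sum polys_over_monom field_subring_1 A) auto
  moreover have "poly p z = 0"
    using z by (simp add: p_def q_def poly_sum poly_monom)
  ultimately show ?thesis unfolding integral_over_def polys_over_def by blast
qed

text \<open>
  Multiplying \<open>z = p (1 / z)\<close> by a power of \<open>z\<close> gives an integral equation.  Hence, if \<open>z\<close> is not integral,
  \<open>A[1 / z]\<close> is a ring from which Zorn's lemma can start to find a maximal ring without \<open>z\<close>.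
\<close>

lemma integral_over_if_in_adjoin_inverse:
  fixes A :: "'k::field set"
  assumes A: "field_subring A" and "z \<noteq> 0" and z: "z \<in> (\<lambda>p. poly p (inverse z)) ` polys_over A"
  shows "integral_over A z"
proof -
  obtain p where p: "p \<in> polys_over A" "z = poly p (inverse z)" using z by blast
  define n where "n = degree p"
  have "z ^ Suc n = z * z ^ n" by simp
  also have "\<dots> = poly p (inverse z) * z ^ n" by (simp only: p(2)[symmetric])
  also have "\<dots> = (\<Sum>i\<le>n. coeff p i * (inverse z ^ i * z ^ n))"
    unfolding poly_altdef n_def[symmetric] sum_distrib_right mult.assoc by (rule refl)
  also have "\<dots> = (\<Sum>i\<le>n. coeff p i * z ^ (n - i))"
    using \<open>z \<noteq> 0\<close> by (intro sum.cong refl) (simp add: power_diff field_simps)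
  also have "\<dots> = (\<Sum>i\<le>n. coeff p (n - i) * z ^ i)"
    by (rule sum.reindex_bij_witness[of _ "\<lambda>i. n - i" "\<lambda>i. n - i"]) auto
  finally have "z ^ Suc n = (\<Sum>i<Suc n. coeff p (n - i) * z ^ i)"
    by (simp only: lessThan_Suc_atMost)
  then show ?thesis by (rule integral_overI[OF A, rotated]) (use p(1) in \<open>auto simp: polys_over_def\<close>)
qed

text \<open>
  If \<open>y\<close> and \<open>1 / y\<close> are missing, \<open>z\<close> is by maximality a polynomial over \<open>V\<close> in each of them.  As \<open>1 / z\<close>
  is in the Jacobson radical, the relation of smaller degree can be solved for a power that
  lowers the degree of the other one.  So two relations of least degrees are contradictory.
\<close>

lemma maximal_subring_valuation:
  fixes V :: "'k::field set"
  assumes V: "field_subring V" and "z \<noteq> 0" "z \<notin> V" and iz: "inverse z \<in> V"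
    and max: "\<And>W. field_subring W \<Longrightarrow> V \<subseteq> W \<Longrightarrow> z \<notin> W \<Longrightarrow> W = V"
  shows "y \<in> V \<or> inverse y \<in> V"
proof -
  note V_simps = field_subring_simps[OF V]
  have adj: "z \<in> (\<lambda>p. poly p w) ` polys_over V" if "w \<notin> V" for w
    using max[OF field_subring_adjoin[OF V] subset_adjoin[OF V], of w] mem_adjoin[OF V, of w] that
    by blast
  \<comment> \<open>The non-unit \<open>inverse z\<close> lies in every maximal ideal, because otherwise a localization of
    \<open>V\<close> would be a larger subring without \<open>z\<close>.\<close>
  have unit: "1 - a * inverse z \<noteq> 0 \<and> inverse (1 - a * inverse z) \<in> V" if a: "a \<in> V" for a
  proof -
    define u where "u = 1 - a * inverse z"
    have "u \<noteq> 0"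
    proof
      assume "u = 0"
      then have "a = z" using \<open>z \<noteq> 0\<close> by (simp add: u_def field_simps)
      with a \<open>z \<notin> V\<close> show False by simp
    qed
    moreover have "inverse u \<in> V"
    proof (rule ccontr)
      assume "inverse u \<notin> V"
      then obtain p where p: "p \<in> polys_over V" "z = poly p (inverse u)" using adj by blast
      define n where "n = degree p"
      have uV: "u \<in> V" using a iz by (auto simp: u_def intro!: V_simps)
      have "z * u ^ n = (\<Sum>i\<le>n. coeff p i * (inverse u ^ i * u ^ n))"
        unfolding poly_altdef n_def[symmetric] sum_distrib_right mult.assoc 
        by (subst p(2)) (simp only: poly_altdef n_def[symmetric] sum_distrib_right mult.assoc)
      also have "\<dots> = (\<Sum>i\<le>n. coeff p i * u ^ (n - i))"
        using \<open>u \<noteq> 0\<close> by (intro sum.cong refl) (simp add: power_diff field_simps)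
      also have "\<dots> \<in> V" using p uV by (auto simp: polys_over_def intro!: V_simps)
      finally have zu: "z * u ^ n \<in> V" .
      have "\<exists>c\<in>V. u ^ n = 1 - c * inverse z" for n
      proof (induction n)
        case 0
        show ?case by (rule bexI[of _ 0]) (auto intro: V_simps)
      next
        case (Suc n)
        then obtain c where c: "c \<in> V" "u ^ n = 1 - c * inverse z" by blast
        have "u ^ Suc n = 1 - (a + c - a * c * inverse z) * inverse z"
        proof -
          have "(1 - a * i) * (1 - c * i) = 1 - (a + c - a * c * i) * i" for i by algebra
          then show ?thesis by (simp only: power_Suc c(2)) (simp only: u_def)
        qed
        moreover have "a + c - a * c * inverse z \<in> V" using a c iz by (intro V_simps)
        ultimately show ?case by blast
      qed
      then obtain c where c: "c \<in> V" "u ^ n = 1 - c * inverse z" by blast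
      then have "z = z * u ^ n + c" using \<open>z \<noteq> 0\<close> by (simp add: field_simps)
      also have "\<dots> \<in> V" by (rule field_subring_add[OF V zu c(1)])
      finally show False using \<open>z \<notin> V\<close> by simp
    qed
    ultimately show ?thesis by (simp add: u_def)
  qed
  define rep where "rep y n \<longleftrightarrow> (\<exists>p\<in>polys_over V. degree p \<le> n \<and> poly p y = z)" for y n
  \<comment> \<open>The relation of smaller degree allows to lower the degree of the other one.\<close>
  have lower: "\<exists>k<n. rep y k" if y: "y \<noteq> 0" and n: "rep y n" and m: "rep (inverse y) m" and "m \<le> n" for y m n
  proof -
    from n obtain p where p: "p \<in> polys_over V" "degree p \<le> n" "poly p y = z" unfolding rep_def by blast
    from m obtain q where q: "q \<in> polys_over V" "degree q \<le> m" "poly q (inverse y) = z" unfolding rep_def by blast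
    have pV: "coeff p i \<in> V" and qV: "coeff q i \<in> V" for i using p q by (auto simp: polys_over_def)
    define v where "v = 1 - coeff q 0 * inverse z"
    have v: "v \<noteq> 0" "inverse v \<in> V" using unit[OF qV[of 0]] by (auto simp: v_def)
    have "n > 0"
    proof (rule ccontr)
      assume "\<not> n > 0"
      then have "degree p = 0" using p by simp
      then have "z = coeff p 0" using p(3) by (simp add: poly_altdef)
      then show False using pV \<open>z \<notin> V\<close> by simp
    qed
    have "z = (\<Sum>j\<le>m. coeff q j * inverse y ^ j)"
      unfolding q(3)[symmetric] poly_altdef using q(2)
      by (intro sum.mono_neutral_left) (auto simp: coeff_eq_0)
    also have "\<dots> = coeff q 0 + (\<Sum>j\<in>{1..m}. coeff q j * inverse y ^ j)"
      by (simp add: atMost_atLeast0 sum.atLeast_Suc_atMost)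
    finally have zs: "z = coeff q 0 + (\<Sum>j\<in>{1..m}. coeff q j * inverse y ^ j)" .
    have "z * v = z - coeff q 0"
      unfolding v_def right_diff_distrib using \<open>z \<noteq> 0\<close> by simp
    also have "\<dots> = (\<Sum>j\<in>{1..m}. coeff q j * inverse y ^ j)"
      by (subst zs) (rule add_diff_cancel_left')
    finally have zv: "z * v = (\<Sum>j\<in>{1..m}. coeff q j * inverse y ^ j)" .
    have "z * y ^ n = inverse v * ((z * v) * y ^ n)" using v by simp
    also have "\<dots> = inverse v * (\<Sum>j\<in>{1..m}. coeff q j * y ^ (n - j))"
    proof -
      have "inverse y ^ j * y ^ n = y ^ (n - j)" if "j \<in> {1..m}" for j
        using that \<open>m \<le> n\<close> y by (simp add: power_diff field_simps)
      then have "coeff q j * inverse y ^ j * y ^ n = coeff q j * y ^ (n - j)" if "j \<in> {1..m}" for j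
        using that by (simp only: mult.assoc)
      then have "(\<Sum>j\<in>{1..m}. coeff q j * inverse y ^ j * y ^ n) = (\<Sum>j\<in>{1..m}. coeff q j * y ^ (n - j))"
        by (rule sum.cong[OF refl])
      then show ?thesis unfolding zv sum_distrib_right by (rule arg_cong)
    qed
    finally have zy: "z * y ^ n = inverse v * (\<Sum>j\<in>{1..m}. coeff q j * y ^ (n - j))" .
    define c where "c = coeff p n * inverse z * inverse v"
    define r where "r = (\<Sum>j\<in>{1..m}. monom (coeff q j) (n - j))"
    define p' where "p' = p - monom (coeff p n) n + smult c r"
    have "coeff r i = 0" if "i \<ge> n" for i
      unfolding r_def using that \<open>n > 0\<close> by (auto simp: coeff_sum intro!: sum.neutral)
    then have "coeff p' i = 0" if "i \<ge> n" for i
      using that p(2) by (auto simp: p'_def coeff_eq_0)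
    then have "degree p' \<le> n - 1" by (intro degree_le) auto
    moreover have "p' \<in> polys_over V"
      unfolding p'_def r_def c_def using p(1) pV qV v iz
      by (intro polys_over_add polys_over_diff polys_over_smult polys_over_sum polys_over_monom V V_simps) auto
    moreover have "poly p' y = z"
    proof -
      have "poly r y = (\<Sum>j\<in>{1..m}. coeff q j * y ^ (n - j))" by (simp add: r_def poly_sum poly_monom)
      then have "c * poly r y = coeff p n * inverse z * (z * y ^ n)" by (simp add: zy c_def)
      also have "\<dots> = coeff p n * y ^ n" using \<open>z \<noteq> 0\<close> by simp
      finally show ?thesis by (simp add: p'_def poly_monom p(3))
    qed
    ultimately have "rep y (n - 1)" unfolding rep_def by blast
    with \<open>n > 0\<close> show ?thesis by (intro exI[of _ "n - 1"]) simp
  qed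
  show ?thesis
  proof (rule ccontr)
    assume "\<not> ?thesis"
    then have y: "y \<notin> V" "inverse y \<notin> V" by auto
    then have "y \<noteq> 0" using V_simps(2) by auto
    have ex: "\<exists>n. rep w n" if "w \<notin> V" for w
      using adj[OF that] unfolding rep_def by blast
    define n where "n = (LEAST n. rep y n)"
    define m where "m = (LEAST n. rep (inverse y) n)"
    have n: "rep y n" "\<And>k. k < n \<Longrightarrow> \<not> rep y k"
      unfolding n_def using ex[OF y(1)] by (auto intro: LeastI_ex dest: not_less_Least)
    have m: "rep (inverse y) m" "\<And>k. k < m \<Longrightarrow> \<not> rep (inverse y) k"
      unfolding m_def using ex[OF y(2)] by (auto intro: LeastI_ex dest: not_less_Least)
    show False
    proof (cases "m \<le> n")
      case True
      from lower[OF \<open>y \<noteq> 0\<close> n(1) m(1) True] n(2) show False by blast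
    next
      case False
      then have "n \<le> m" by simp
      from lower[of "inverse y" m n] \<open>y \<noteq> 0\<close> n(1) m this show False by auto
    qed
  qed
qed

text \<open>
  The integral closure is the intersection of the valuation rings above \<open>A\<close>.
\<close>

lemma valuation_ring_avoiding:
  fixes A :: "'k::field set"
  assumes A: "field_subring A" and z: "\<not> integral_over A z"
  obtains V where "field_subring V" "A \<subseteq> V" "z \<notin> V" "\<And>y. y \<in> V \<or> inverse y \<in> V"
proof -
  have "z \<noteq> 0"
  proof
    assume "z = 0"
    then have "integral_over A z" by (intro integral_overI[OF A, of 1 "\<lambda>_. 0"]) (auto simp: field_subring_0[OF A])
    with z show False by simp
  qed
  define B where "B = (\<lambda>p. poly p (inverse z)) ` polys_over A"
  have B: "field_subring B" "A \<subseteq> B" "inverse z \<in> B" "z \<notin> B"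
    unfolding B_def using field_subring_adjoin[OF A] subset_adjoin[OF A] mem_adjoin[OF A]
      integral_over_if_in_adjoin_inverse[OF A \<open>z \<noteq> 0\<close>] z by auto
  define \<V> where "\<V> = {V. field_subring V \<and> B \<subseteq> V \<and> z \<notin> V}"
  have "\<exists>M\<in>\<V>. \<forall>X\<in>\<V>. M \<subseteq> X \<longrightarrow> X = M"
  proof (rule subset_Zorn_nonempty)
    show "\<V> \<noteq> {}" using B unfolding \<V>_def by blast
    fix C assume "C \<noteq> {}" and chain: "subset.chain \<V> C"
    then have C: "\<And>P. P \<in> C \<Longrightarrow> field_subring P \<and> B \<subseteq> P \<and> z \<notin> P"
      and tot: "\<And>P P'. P \<in> C \<Longrightarrow> P' \<in> C \<Longrightarrow> P \<subseteq> P' \<or> P' \<subseteq> P"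
      unfolding subset_chain_def \<V>_def by blast+
    have "field_subring (\<Union> C)"
      unfolding field_subring_def
    proof (intro conjI ballI)
      show "1 \<in> \<Union> C" using \<open>C \<noteq> {}\<close> C unfolding field_subring_def by blast
      fix a b assume "a \<in> \<Union> C" "b \<in> \<Union> C"
      then obtain P where P: "P \<in> C" "a \<in> P" "b \<in> P" using tot by blast
      then show "a - b \<in> \<Union> C" "a * b \<in> \<Union> C" using C[of P] unfolding field_subring_def by blast+
    qed
    then show "\<Union> C \<in> \<V>" using \<open>C \<noteq> {}\<close> C unfolding \<V>_def by blast
  qed
  then obtain V where "V \<in> \<V>" and max: "\<forall>X\<in>\<V>. V \<subseteq> X \<longrightarrow> X = V" by (rule bexE)
  then have V: "field_subring V" "B \<subseteq> V" "z \<notin> V" by (simp_all add: \<V>_def)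
  show ?thesis
  proof (rule that)
    show "field_subring V" "z \<notin> V" by fact+
    show "A \<subseteq> V" using B V by blast
    show "y \<in> V \<or> inverse y \<in> V" for y
      by (rule maximal_subring_valuation[OF V(1) \<open>z \<noteq> 0\<close> V(3)])
        (use B V max in \<open>auto simp: \<V>_def\<close>)
  qed
qed

lemma valuation_ring_least:
  fixes V :: "'k::field set"
  assumes V: "field_subring V" "\<And>y. y \<in> V \<or> inverse y \<in> V"
    and "finite X" "X \<noteq> {}" "\<And>x. x \<in> X \<Longrightarrow> f x \<noteq> 0"
  shows "\<exists>m\<in>X. \<forall>x\<in>X. f x / f m \<in> V"
  using assms(3-5)
proof (induction X rule: finite_ne_induct)
  case (singleton x)
  then show ?case using field_subring_1[OF V(1)] by simp
next
  case (insert y X)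
  then obtain m where m: "m \<in> X" "\<And>x. x \<in> X \<Longrightarrow> f x / f m \<in> V" by auto
  have nz: "f y \<noteq> 0" "f m \<noteq> 0" using insert m by auto
  show ?case
  proof (cases "f y / f m \<in> V")
    case True
    then show ?thesis using m by blast
  next
    case False
    then have "inverse (f y / f m) \<in> V" using V(2) by blast
    then have my: "f m / f y \<in> V" by simp
    have "f x / f y \<in> V" if "x \<in> X" for x
    proof -
      have "f x / f y = (f x / f m) * (f m / f y)" using nz by simp
      then show ?thesis using field_subring_mult[OF V(1) m(2)[OF that] my] by (simp only:)
    qed
    then show ?thesis using nz field_subring_1[OF V(1)] by auto
  qed
qed

lemma valuation_ring_nonunits_add:
  fixes V :: "'k::field set"
  assumes V: "field_subring V" "\<And>y. y \<in> V \<or> inverse y \<in> V"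
    and x: "x \<in> V" "x = 0 \<or> inverse x \<notin> V" and y: "y \<in> V" "y = 0 \<or> inverse y \<notin> V"
  shows "x + y \<in> V \<and> (x + y = 0 \<or> inverse (x + y) \<notin> V)"
proof -
  have *: "inverse (x + y) \<notin> V" if "x + y \<noteq> 0" "x / y \<in> V" "y \<noteq> 0" "inverse y \<notin> V" for x y
  proof
    assume "inverse (x + y) \<in> V"
    then have "(1 + x / y) * inverse (x + y) \<in> V"
      using that by (intro field_subring_mult field_subring_add field_subring_1 V)
    moreover have "(1 + x / y) * inverse (x + y) = inverse y"
      using that by (simp add: field_simps)
    ultimately show False using that by simp
  qed
  have "x + y \<noteq> 0 \<Longrightarrow> inverse (x + y) \<notin> V"
  proof (cases "x = 0 \<or> y = 0")
    case True
    then show "x + y \<noteq> 0 \<Longrightarrow> inverse (x + y) \<notin> V" using x y by auto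
  next
    case False
    assume nz: "x + y \<noteq> 0"
    from V(2)[of "x / y"] have "x / y \<in> V \<or> y / x \<in> V" by simp
    then show "inverse (x + y) \<notin> V"
      using *[of x y] *[of y x] False nz x y by (auto simp: add.commute)
  qed
  then show ?thesis using field_subring_add[OF V(1) x(1) y(1)] by blast
qed

text \<open>
  The index \<open>m\<close> is the greatest one among those where the value of \<open>f\<close> is least; the value of \<open>x\<close> is at
  most that of \<open>y\<close> if \<open>y / x \<in> V\<close>.
\<close>

lemma valuation_ring_dominant_index:
  fixes V :: "'k::field set" and f :: "'i::comm_monoid_add \<Rightarrow> 'k"
  assumes V: "field_subring V" "\<And>y. y \<in> V \<or> inverse y \<in> V" and lt: "translation_order lt"
    and "finite F" "c \<in> F" "f c \<noteq> 0"
  obtains m where "m \<in> F" "f m \<noteq> 0" "\<And>a. a \<in> F \<Longrightarrow> f a / f m \<in> V"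
    "\<And>a. a \<in> F \<Longrightarrow> lt m a \<Longrightarrow> f a \<noteq> 0 \<Longrightarrow> f m / f a \<notin> V"
proof -
  define F0 where "F0 = {a \<in> F. f a \<noteq> 0}"
  have F0: "finite F0" "F0 \<noteq> {}" using assms by (auto simp: F0_def)
  have "\<exists>k\<in>F0. \<forall>a\<in>F0. f a / f k \<in> V"
    by (rule valuation_ring_least[OF V F0]) (simp add: F0_def)
  then obtain k where k: "k \<in> F0" "\<And>a. a \<in> F0 \<Longrightarrow> f a / f k \<in> V" by blast
  define F1 where "F1 = {a \<in> F0. f k / f a \<in> V}"
  have "k \<in> F1" using k field_subring_1[OF V(1)] by (auto simp: F1_def F0_def)
  moreover have "finite F1" using F0 by (auto simp: F1_def)
  ultimately obtain m where m: "m \<in> F1" "\<And>x. x \<in> F1 \<Longrightarrow> x \<noteq> m \<Longrightarrow> lt x m"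
    using translation_order_max[OF lt, of F1] by blast
  have nz: "f m \<noteq> 0" "f k \<noteq> 0" using m k by (auto simp: F1_def F0_def)
  show ?thesis
  proof (rule that[of m])
    show "m \<in> F" "f m \<noteq> 0" using m by (auto simp: F1_def F0_def)
    show "f a / f m \<in> V" if "a \<in> F" for a
    proof (cases "f a = 0")
      case True
      then show ?thesis using field_subring_0[OF V(1)] by simp
    next
      case False
      then have "f a / f k \<in> V" using k that by (auto simp: F0_def)
      moreover have "f k / f m \<in> V" using m by (auto simp: F1_def)
      ultimately have "f a / f k * (f k / f m) \<in> V" by (rule field_subring_mult[OF V(1)])
      then show ?thesis using nz by simp
    qed
    show "f m / f a \<notin> V" if a: "a \<in> F" "lt m a" "f a \<noteq> 0" for a
    proof
      assume *: "f m / f a \<in> V"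
      have "f k / f m \<in> V" using m by (auto simp: F1_def)
      then have "f k / f m * (f m / f a) \<in> V" using * by (rule field_subring_mult[OF V(1)])
      then have "a \<in> F1" using nz a by (simp add: F1_def F0_def)
      moreover have "\<not> lt a m" "a \<noteq> m"
        using lt a(2) unfolding translation_order_def by blast+
      ultimately show False using m(2) by blast
    qed
  qed
qed

text \<open>
  For a valuation ring \<open>V\<close> and the indices \<open>m\<close>, \<open>n\<close> of the previous lemma, the summand \<open>f m * g n\<close> equals
  its component of the product up to a unit of \<open>V\<close>, because all other summands have larger value.
  It therefore lies in \<open>V\<close>, and so do all other products \<open>f a * g b\<close>.
\<close>

lemma gauss_integral:
  fixes A :: "'k::field set" and f g :: "'i::comm_monoid_add \<Rightarrow> 'k"
  assumes lt: "translation_order (lt :: 'i \<Rightarrow> 'i \<Rightarrow> bool)" and A: "field_subring A"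
    and fin: "finite F" "finite G"
    and conv: "\<And>d. (\<Sum>(a, b)\<in>{p \<in> F \<times> G. fst p + snd p = d}. f a * g b) \<in> A"
    and ab: "a \<in> F" "b \<in> G"
  shows "integral_over A (f a * g b)"
proof (rule ccontr)
  assume "\<not> ?thesis"
  then obtain V where V: "field_subring V" "A \<subseteq> V" "f a * g b \<notin> V" "\<And>y. y \<in> V \<or> inverse y \<in> V"
    using valuation_ring_avoiding[OF A] by blast
  have "f a \<noteq> 0" "g b \<noteq> 0" using V(3) field_subring_0[OF V(1)] by auto
  obtain m where m: "m \<in> F" "f m \<noteq> 0" "\<And>a. a \<in> F \<Longrightarrow> f a / f m \<in> V"
    "\<And>a. a \<in> F \<Longrightarrow> lt m a \<Longrightarrow> f a \<noteq> 0 \<Longrightarrow> f m / f a \<notin> V"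
    using valuation_ring_dominant_index[where f = f, OF V(1) V(4) lt fin(1) ab(1) \<open>f a \<noteq> 0\<close>] by blast
  obtain n where n: "n \<in> G" "g n \<noteq> 0" "\<And>b. b \<in> G \<Longrightarrow> g b / g n \<in> V"
    "\<And>b. b \<in> G \<Longrightarrow> lt n b \<Longrightarrow> g b \<noteq> 0 \<Longrightarrow> g n / g b \<notin> V"
    using valuation_ring_dominant_index[where f = g, OF V(1) V(4) lt fin(2) ab(2) \<open>g b \<noteq> 0\<close>] by blast
  define N where "N = {u \<in> V. u = 0 \<or> inverse u \<notin> V}"
  have N_add: "x + y \<in> N" if "x \<in> N" "y \<in> N" for x y
    using that valuation_ring_nonunits_add[OF V(1) V(4), of x y] by (auto simp: N_def)
  have N_sum: "sum h S \<in> N" if "\<And>i. i \<in> S \<Longrightarrow> h i \<in> N" for h and S :: "('i \<times> 'i) set"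
    using that
    by (induction S rule: infinite_finite_induct) (auto simp: N_add, auto simp: N_def field_subring_0[OF V(1)])
  define t where "t = f m * g n"
  have "t \<noteq> 0" using m n by (simp add: t_def)
  define S where "S = {p \<in> F \<times> G. fst p + snd p = m + n}"
  have S: "finite S" "(m, n) \<in> S"
    using fin m n by (auto simp: S_def intro: finite_subset[of _ "F \<times> G"])
  define s where "s = (\<Sum>(a, b)\<in>S - {(m, n)}. f a * g b / t)"
  have "(\<Sum>(a, b)\<in>S. f a * g b / t) = 1 + s"
    using \<open>t \<noteq> 0\<close> S by (simp add: s_def sum.remove[of S "(m, n)"] t_def)
  moreover have "(\<Sum>(a, b)\<in>S. f a * g b / t) = (\<Sum>(a, b)\<in>S. f a * g b) / t"
    by (simp add: sum_divide_distrib case_prod_unfold)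
  moreover have "(\<Sum>(a, b)\<in>S. f a * g b) \<in> V" using conv[of "m + n"] V(2) by (auto simp: S_def)
  ultimately have h: "t * (1 + s) \<in> V" using \<open>t \<noteq> 0\<close> by (simp add: field_simps)
  \<comment> \<open>By the choice of \<open>m\<close> and \<open>n\<close>, all other terms of this coefficient have a strictly larger value.\<close>
  have "s \<in> N" unfolding s_def
  proof (rule N_sum)
    fix i assume "i \<in> S - {(m, n)}"
    then obtain a b where i: "i = (a, b)" "(a, b) \<in> S" and ne: "\<not> (a = m \<and> b = n)"
      by (cases i) auto
    then have ab: "a \<in> F" "b \<in> G" "a + b = m + n" by (auto simp: S_def)
    have V1: "f a / f m \<in> V" and V2: "g b / g n \<in> V" using ab m n by auto
    have eq: "f a * g b / t = (f a / f m) * (g b / g n)" by (simp add: t_def)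
    have "f a * g b / t \<in> N"
    proof (cases "f a = 0 \<or> g b = 0")
      case True
      then have "f a * g b / t = 0" by (metis divide_eq_0_iff mult_eq_0_iff)
      moreover have "0 \<in> N" using field_subring_0[OF V(1)] by (simp add: N_def)
      ultimately show ?thesis by (simp only:)
    next
      case False
      have "inverse (f a * g b / t) \<notin> V"
      proof
        assume *: "inverse (f a * g b / t) \<in> V"
        have cancel: "inverse p = inverse (p * q) * q" "inverse q = inverse (p * q) * p"
          if "p \<noteq> 0" "q \<noteq> 0" for p q :: 'k
          using that by simp_all
        have "f a / f m \<noteq> 0" "g b / g n \<noteq> 0" using False m n by auto
        from cancel[OF this] have "f m / f a = inverse (f a * g b / t) * (g b / g n)"
          "g n / g b = inverse (f a * g b / t) * (f a / f m)"
          unfolding eq inverse_divide by blast+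
        then have "f m / f a \<in> V" "g n / g b \<in> V"
          using field_subring_mult[OF V(1) * V2] field_subring_mult[OF V(1) * V1] by simp_all
        then have "\<not> lt m a" "\<not> lt n b" using m(4) n(4) ab False by blast+
        then have "a = m \<or> lt a m" "b = n \<or> lt b n"
          using lt unfolding translation_order_def by blast+
        then show False
          using translation_order_add_le[OF lt _ _ ab(3)] ne by blast
      qed
      then show ?thesis using field_subring_mult[OF V(1) V1 V2] by (simp add: N_def eq)
    qed
    then show "(case i of (a, b) \<Rightarrow> f a * g b / t) \<in> N" by (simp only: i prod.case)
  qed
  have "1 + s \<in> V" using \<open>s \<in> N\<close> by (auto simp: N_def intro: field_subring_simps[OF V(1)])
  have "1 \<notin> N" by (simp add: N_def field_subring_1[OF V(1)])
  moreover have "- s \<in> N" using \<open>s \<in> N\<close> field_subring_minus[OF V(1), of "inverse (- s)"]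
    by (auto simp: N_def intro: field_subring_simps[OF V(1)])
  ultimately have "1 + s \<notin> N" using N_add[of "1 + s" "- s"] by auto
  then have u: "1 + s \<noteq> 0" "inverse (1 + s) \<in> V" using \<open>1 + s \<in> V\<close> by (auto simp: N_def)
  have "t * (1 + s) * inverse (1 + s) \<in> V" using field_subring_mult[OF V(1) h u(2)] .
  then have "t \<in> V" unfolding mult.assoc right_inverse[OF u(1)] by simp
  then have "t * ((f a / f m) * (g b / g n)) \<in> V"
    using m n ab by (intro field_subring_mult V(1)) auto
  then show False using V(3) m(2) n(2) by (simp add: t_def)
qed

section \<open>Domains with least common multiples\<close>

text \<open>
  The condition means \<open>p A \<inter> q A = m A\<close>: membership of \<open>y\<close> in \<open>p A\<close> is written \<open>y / p \<in> A\<close>, which makes sense for all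
  \<open>y\<close> in the field and is invariant under scaling.
\<close>

definition lcm_subring :: "'k::field set \<Rightarrow> bool" where
  "lcm_subring A \<longleftrightarrow> (\<forall>p\<in>A. \<forall>q\<in>A. p \<noteq> 0 \<longrightarrow> q \<noteq> 0 \<longrightarrow>
     (\<exists>m\<in>A. m \<noteq> 0 \<and> (\<forall>y. y / p \<in> A \<and> y / q \<in> A \<longleftrightarrow> y / m \<in> A)))"

definition fractions :: "'k::field set \<Rightarrow> 'k set" where
  "fractions A = {a / b | a b. a \<in> A \<and> b \<in> A \<and> b \<noteq> 0}"

lemma subset_fractions:
  assumes "field_subring A" shows "A \<subseteq> fractions A"
  unfolding fractions_def using field_subring_1[OF assms] by (force intro: exI[of _ 1])

lemma field_subring_fractions:
  assumes A: "field_subring A" shows "field_subring (fractions A)"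
  unfolding field_subring_def
proof (intro conjI ballI)
  show "1 \<in> fractions A" using subset_fractions[OF A] field_subring_1[OF A] by blast
  fix x y assume "x \<in> fractions A" "y \<in> fractions A"
  then obtain a b c d where *: "x = a / b" "y = c / d" "a \<in> A" "b \<in> A" "c \<in> A" "d \<in> A" "b \<noteq> 0" "d \<noteq> 0"
    unfolding fractions_def by blast
  have "x - y = (a * d - c * b) / (b * d)" "x * y = (a * c) / (b * d)"
    using * by (simp_all add: diff_frac_eq)
  moreover have "a * d - c * b \<in> A" "b * d \<in> A" "a * c \<in> A" "b * d \<noteq> 0"
    using * field_subring_mult[OF A] field_subring_diff[OF A] by simp_all
  ultimately show "x - y \<in> fractions A" "x * y \<in> fractions A"
    unfolding fractions_def by blast+
qed

lemma divide_fractions: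
  assumes A: "field_subring A" and "x \<in> fractions A" "y \<in> fractions A"
  shows "x / y \<in> fractions A"
proof (cases "y = 0")
  case True
  then show ?thesis using field_subring_0[OF field_subring_fractions[OF A]] by simp
next
  case False
  from assms obtain a b c d where *: "x = a / b" "y = c / d" "a \<in> A" "b \<in> A" "c \<in> A" "d \<in> A" "b \<noteq> 0" "d \<noteq> 0"
    unfolding fractions_def by blast
  have "x / y = (a * d) / (b * c)" using * by simp
  moreover have "a * d \<in> A" "b * c \<in> A" "b * c \<noteq> 0"
    using * False field_subring_mult[OF A] by auto
  ultimately show ?thesis unfolding fractions_def by blast
qed

lemma lcm_subring_fractions:
  assumes A: "field_subring A" and L: "lcm_subring A"
    and pq: "p \<in> fractions A" "p \<noteq> 0" "q \<in> fractions A" "q \<noteq> 0"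
  shows "\<exists>m\<in>fractions A. m \<noteq> 0 \<and> (\<forall>y. y / p \<in> A \<and> y / q \<in> A \<longleftrightarrow> y / m \<in> A)"
proof -
  obtain a b c d where *: "p = a / b" "q = c / d" "a \<in> A" "b \<in> A" "c \<in> A" "d \<in> A" "b \<noteq> 0" "d \<noteq> 0"
    using pq unfolding fractions_def by blast
  have mA: "a * d \<in> A" "c * b \<in> A" "b * d \<in> A" "a * d \<noteq> 0" "c * b \<noteq> 0" "b * d \<noteq> 0"
    using * pq field_subring_mult[OF A] by auto
  then obtain m where m: "m \<in> A" "m \<noteq> 0"
    "\<And>y. y / (a * d) \<in> A \<and> y / (c * b) \<in> A \<longleftrightarrow> y / m \<in> A"
    using L unfolding lcm_subring_def by blast
  show ?thesis
  proof (intro bexI conjI allI)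
    show "m / (b * d) \<in> fractions A" unfolding fractions_def using m mA by blast
    show "m / (b * d) \<noteq> 0" using m mA by simp
    fix y
    have "y / p = y * (b * d) / (a * d)" "y / q = y * (b * d) / (c * b)"
      "y / (m / (b * d)) = y * (b * d) / m"
      using \<open>b \<noteq> 0\<close> \<open>d \<noteq> 0\<close> unfolding *(1,2) by simp_all
    then show "y / p \<in> A \<and> y / q \<in> A \<longleftrightarrow> y / (m / (b * d)) \<in> A"
      using m(3)[of "y * (b * d)"] by (simp only:)
  qed
qed

lemma lcm_subring_finite:
  assumes A: "field_subring A" and L: "lcm_subring A" and "finite X" "X \<noteq> {}"
    and "\<And>x. x \<in> X \<Longrightarrow> x \<in> fractions A" "0 \<notin> X"
  shows "\<exists>m\<in>fractions A. m \<noteq> 0 \<and> (\<forall>y. (\<forall>x\<in>X. y / x \<in> A) \<longleftrightarrow> y / m \<in> A)"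
  using assms(3-6)
proof (induction X rule: finite_ne_induct)
  case (singleton x)
  then show ?case by (intro bexI[of _ x]) auto
next
  case (insert x X)
  have "\<exists>m\<in>fractions A. m \<noteq> 0 \<and> (\<forall>y. (\<forall>x\<in>X. y / x \<in> A) \<longleftrightarrow> y / m \<in> A)"
    by (rule insert.IH) (use insert.prems in auto)
  then obtain m where m: "m \<in> fractions A" "m \<noteq> 0" "\<And>y. (\<forall>x\<in>X. y / x \<in> A) \<longleftrightarrow> y / m \<in> A" by blast
  have x: "x \<in> fractions A" "x \<noteq> 0" using insert.prems by auto
  obtain n where "n \<in> fractions A" "n \<noteq> 0" "\<And>y. y / x \<in> A \<and> y / m \<in> A \<longleftrightarrow> y / n \<in> A"
    using lcm_subring_fractions[OF A L x m(1,2)] by blast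
  then show ?case using m(3) by (intro bexI[of _ n]) auto
qed

text \<open>
  The fractional ideal \<open>(1, z)\<close> has the principal inverse \<open>l A\<close>, so its \<open>n\<close>-th power has inverse
  \<open>l\<^sup>n A\<close>; an integral equation makes two consecutive powers equal, and \<open>l\<close> becomes a unit.
\<close>

lemma lcm_subring_integrally_closed:
  assumes A: "field_subring A" and L: "lcm_subring A" and z: "z \<in> fractions A" "integral_over A z"
  shows "z \<in> A"
proof (cases "z = 0")
  case True
  then show ?thesis using field_subring_0[OF A] by simp
next
  case False
  have 1: "1 \<in> fractions A" using subset_fractions[OF A] field_subring_1[OF A] by blast
  have "inverse z \<in> fractions A" "inverse z \<noteq> 0"
    using divide_fractions[OF A 1 z(1)] False by (simp_all add: divide_inverse)
  from lcm_subring_fractions[OF A L 1 _ this] obtain l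
    where "l \<noteq> 0" and l': "\<And>y. y / 1 \<in> A \<and> y / inverse z \<in> A \<longleftrightarrow> y / l \<in> A" by auto
  have l: "y \<in> A \<and> y * z \<in> A \<longleftrightarrow> y / l \<in> A" for y
    using l'[of y] by (simp add: divide_inverse)
  have pow: "(\<forall>i\<le>n. y * z ^ i \<in> A) \<longleftrightarrow> y / l ^ n \<in> A" for n y
  proof (induction n arbitrary: y)
    case 0
    show ?case by simp
  next
    case (Suc n)
    have "(\<forall>i\<le>Suc n. y * z ^ i \<in> A) \<longleftrightarrow> (\<forall>i\<le>n. y * z ^ i \<in> A \<and> y * z ^ Suc i \<in> A)"
      by (metis Suc_le_mono le_SucE le_Suc_eq)
    also have "\<dots> \<longleftrightarrow> (\<forall>i\<le>n. (y / l) * z ^ i \<in> A)"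
      unfolding times_divide_eq_left l[symmetric] power_Suc2 mult.assoc by (rule refl)
    also have "\<dots> \<longleftrightarrow> y / l ^ Suc n \<in> A"
      using Suc.IH[of "y / l"] by simp
    finally show ?case .
  qed
  obtain p where p: "lead_coeff p = 1" "\<And>i. coeff p i \<in> A" "poly p z = 0"
    using z(2) unfolding integral_over_def by blast
  have "degree p \<noteq> 0"
  proof
    assume "degree p = 0"
    then have "poly p z = 1" using p(1) by (simp add: poly_altdef)
    with p(3) show False by simp
  qed
  then obtain n where n: "degree p = Suc n" by (cases "degree p") auto
  have y: "l ^ n * z ^ i \<in> A" if "i \<le> n" for i
    using pow[of n "l ^ n"] that \<open>l \<noteq> 0\<close> field_subring_1[OF A] by simp
  have "0 = (\<Sum>i\<le>n. coeff p i * z ^ i) + z ^ Suc n"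
    using p(1,3) by (simp add: poly_altdef n)
  then have "z ^ Suc n = - (\<Sum>i\<le>n. coeff p i * z ^ i)" by (metis add_eq_0_iff)
  then have "l ^ n * z ^ Suc n = - (\<Sum>i\<le>n. coeff p i * (l ^ n * z ^ i))"
    by (simp only: mult_minus_right sum_distrib_left mult.left_commute)
  also have "\<dots> \<in> A"
  proof (intro field_subring_minus[OF A] field_subring_sum[OF A])
    show "coeff p i * (l ^ n * z ^ i) \<in> A" if "i \<in> {..n}" for i
      using field_subring_mult[OF A p(2) y] that by simp
  qed
  finally have "l ^ n * z ^ i \<in> A" if "i \<le> Suc n" for i
    using y[of i] that by (cases "i = Suc n") auto
  then have "l ^ n / l ^ Suc n \<in> A" using pow[of "Suc n" "l ^ n"] by blast
  moreover have "l ^ n / l ^ Suc n = 1 / l" using \<open>l \<noteq> 0\<close> by simp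
  ultimately show ?thesis using l[of 1] by simp
qed

lemma poly_mult_coeff_integral:
  fixes A :: "'k::field set"
  assumes A: "field_subring A" and pq: "p * q \<in> polys_over A"
  shows "integral_over A (coeff p i * coeff q j)"
proof -
  define F where "F = {..max i (degree p)}"
  define G where "G = {..max j (degree q)}"
  show ?thesis
  proof (rule gauss_integral[where lt = "(<)" and F = F and G = G])
    show "translation_order ((<) :: nat \<Rightarrow> _)" by (auto simp: translation_order_def)
    fix d
    have "(\<Sum>(a, b)\<in>{r \<in> F \<times> G. fst r + snd r = d}. coeff p a * coeff q b)
        = (\<Sum>(a, b)\<in>{r. fst r + snd r = d}. coeff p a * coeff q b)"
    proof (rule sum.mono_neutral_left)
      have "{r. fst r + snd r = d} \<subseteq> {..d} \<times> {..d}" by auto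
      then show "finite {r::nat \<times> nat. fst r + snd r = d}" by (rule finite_subset) simp
      show "\<forall>r\<in>{r. fst r + snd r = d} - {r \<in> F \<times> G. fst r + snd r = d}.
          (case r of (a, b) \<Rightarrow> coeff p a * coeff q b) = 0"
        by (auto simp: F_def G_def le_max_iff_disj intro: le_degree)
    qed auto
    also have "\<dots> = (\<Sum>a\<le>d. coeff p a * coeff q (d - a))"
      by (rule sum.reindex_bij_witness[of _ "\<lambda>a. (a, d - a)" fst]) auto
    also have "\<dots> = coeff (p * q) d" by (simp add: coeff_mult)
    also have "\<dots> \<in> A" using pq by (simp add: polys_over_def)
    finally show "(\<Sum>(a, b)\<in>{r \<in> F \<times> G. fst r + snd r = d}. coeff p a * coeff q b) \<in> A" .
  qed (auto simp: F_def G_def A)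
qed

text \<open>
  A nonzero common multiple \<open>m\<close> of least degree divides all others.  The division with remainder is
  carried out by hand, because the coefficient field \<open>F\<close> is only a subset of the field that is the coefficient type.
\<close>

lemma polys_over_common_multiples_principal:
  fixes F :: "'k::field set"
  assumes F: "field_subring F" and div: "\<And>x y. x \<in> F \<Longrightarrow> y \<in> F \<Longrightarrow> x / y \<in> F"
    and pq: "p \<in> polys_over F" "q \<in> polys_over F" "p \<noteq> 0" "q \<noteq> 0"
  obtains m p' q' where "m \<noteq> 0" "p' \<in> polys_over F" "q' \<in> polys_over F" "m = p * p'" "m = q * q'"
    "\<And>r s. r \<in> polys_over F \<Longrightarrow> s \<in> polys_over F \<Longrightarrow> p * r = q * s \<Longrightarrow> \<exists>w\<in>polys_over F. p * r = m * w"
proof -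
  define I where "I = {y. (\<exists>r\<in>polys_over F. y = p * r) \<and> (\<exists>s\<in>polys_over F. y = q * s)}"
  have "p * q \<in> I" unfolding I_def using pq by (auto simp: mult.commute)
  then have "\<exists>y. y \<in> I \<and> y \<noteq> 0" using pq by auto
  then obtain m where "m \<in> I \<and> m \<noteq> 0" and least: "\<And>y. y \<in> I \<and> y \<noteq> 0 \<Longrightarrow> degree m \<le> degree y"
    using ex_has_least_nat[of "\<lambda>y. y \<in> I \<and> y \<noteq> 0" _ degree] by blast
  then have m: "m \<in> I" "m \<noteq> 0" by auto
  have IF: "y \<in> polys_over F" if "y \<in> I" for y
    using that pq polys_over_mult[OF F] unfolding I_def by blast
  have Idiff: "y - w * z \<in> I" if "y \<in> I" "z \<in> I" "w \<in> polys_over F" for y z w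
  proof -
    from that obtain r s r' s' where *: "y = p * r" "y = q * s" "z = p * r'" "z = q * s'"
      "r \<in> polys_over F" "s \<in> polys_over F" "r' \<in> polys_over F" "s' \<in> polys_over F"
      unfolding I_def by blast
    have "y - w * z = p * (r - w * r')" unfolding *(1,3) by algebra
    moreover have "y - w * z = q * (s - w * s')" unfolding *(2,4) by algebra
    moreover have "r - w * r' \<in> polys_over F" "s - w * s' \<in> polys_over F"
      using * that by (auto intro!: polys_over_diff[OF F] polys_over_mult[OF F])
    ultimately show ?thesis unfolding I_def by blast
  qed
  have dvd: "\<exists>w\<in>polys_over F. y = m * w" if "y \<in> I" for y
    using that
  proof (induction "degree y" arbitrary: y rule: less_induct)
    case less
    show ?case
    proof (cases "y = 0")
      case True
      then show ?thesis using polys_over_0[OF F] by (intro bexI[of _ 0]) auto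
    next
      case False
      then have le: "degree m \<le> degree y" using least less.prems by blast
      define c where "c = monom (lead_coeff y / lead_coeff m) (degree y - degree m)"
      have "lead_coeff y / lead_coeff m \<in> F"
        using IF[OF less.prems] IF[OF m(1)] by (intro div) (auto simp: polys_over_def)
      then have c: "c \<in> polys_over F" unfolding c_def by (rule polys_over_monom[OF F])
      define y' where "y' = y - c * m"
      have y': "y' \<in> I" unfolding y'_def by (rule Idiff[OF less.prems m(1) c])
      have "degree (c * m) \<le> degree y"
        using degree_mult_le[of c m] degree_monom_le[of "lead_coeff y / lead_coeff m" "degree y - degree m"] le
        unfolding c_def by linarith
      then have "degree y' \<le> degree y" unfolding y'_def by (intro degree_diff_le) auto
      moreover have "coeff y' (degree y) = 0"
        using le m(2) by (simp add: y'_def c_def coeff_monom_mult)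
      ultimately have "y' = 0 \<or> degree y' < degree y" by (rule eq_zero_or_degree_less)
      then obtain w where w: "w \<in> polys_over F" "y' = m * w"
        using less.hyps[OF _ y'] polys_over_0[OF F] by (metis mult_zero_right)
      then have "y = m * (c + w)" by (simp add: y'_def algebra_simps)
      then show ?thesis using polys_over_add[OF F c w(1)] by blast
    qed
  qed
  from m(1) obtain p' q' where "p' \<in> polys_over F" "m = p * p'" "q' \<in> polys_over F" "m = q * q'"
    unfolding I_def by blast
  moreover have "\<exists>w\<in>polys_over F. p * r = m * w"
    if "r \<in> polys_over F" "s \<in> polys_over F" "p * r = q * s" for r s
    by (rule dvd) (use that in \<open>unfold I_def, blast\<close>)
  ultimately show ?thesis using that m(2) by blast
qed

text \<open>
  Over the fraction field, the common multiples of \<open>p\<close> and \<open>q\<close> are generated by one polynomial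
  \<open>m = p p' = q q'\<close>.  By the Gauss lemma a multiple \<open>m w\<close> lies in \<open>p A[X]\<close> and \<open>q A[X]\<close> if and only if
  each coefficient of \<open>w\<close> multiplies each coefficient of \<open>p'\<close> and of \<open>q'\<close> into \<open>A\<close>, which is
  a principal condition because \<open>A\<close> has least common multiples.
\<close>

lemma lcm_subring_polys:
  fixes A :: "'k::field set"
  assumes A: "field_subring A" and L: "lcm_subring A"
    and pq: "p \<in> polys_over A" "q \<in> polys_over A" "p \<noteq> 0" "q \<noteq> 0"
  obtains m p' q' where "m \<noteq> 0" "p' \<in> polys_over A" "q' \<in> polys_over A" "m = p * p'" "m = q * q'"
    "\<And>r s. r \<in> polys_over A \<Longrightarrow> s \<in> polys_over A \<Longrightarrow> p * r = q * s \<Longrightarrow> \<exists>w\<in>polys_over A. p * r = m * w"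
proof -
  define F where "F = fractions A"
  have F: "field_subring F" unfolding F_def by (rule field_subring_fractions[OF A])
  have AF: "polys_over A \<subseteq> polys_over F"
    using subset_fractions[OF A] unfolding F_def polys_over_def by blast
  have div: "x / y \<in> F" if "x \<in> F" "y \<in> F" for x y
    using divide_fractions[OF A] that unfolding F_def by blast
  obtain m p' q' where m: "m \<noteq> 0" "p' \<in> polys_over F" "q' \<in> polys_over F" "m = p * p'" "m = q * q'"
    "\<And>r s. r \<in> polys_over F \<Longrightarrow> s \<in> polys_over F \<Longrightarrow> p * r = q * s \<Longrightarrow> \<exists>w\<in>polys_over F. p * r = m * w"
    using polys_over_common_multiples_principal[OF F div subsetD[OF AF pq(1)] subsetD[OF AF pq(2)] pq(3,4)]
    by blast
  define X where "X = (inverse ` (coeff p' ` {..degree p'} \<union> coeff q' ` {..degree q'})) - {0}"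
  have coeff_range: "coeff f i \<in> coeff f ` {..degree f} \<or> coeff f i = 0" for f :: "'k poly" and i
    by (cases "i \<le> degree f") (auto simp: coeff_eq_0)
  have "p' \<noteq> 0" using m by auto
  then have "inverse (lead_coeff p') \<in> X" unfolding X_def by auto
  then have "X \<noteq> {}" by blast
  moreover have "finite X" "0 \<notin> X" unfolding X_def by simp_all
  ultimately have X: "finite X" "X \<noteq> {}" "0 \<notin> X" by blast+
  have "x \<in> fractions A" if "x \<in> X" for x
  proof -
    from that have "inverse x \<in> F" using m(2,3) unfolding X_def polys_over_def by auto
    then show ?thesis using div[OF field_subring_1[OF F]] by (force simp: F_def divide_inverse)
  qed
  from lcm_subring_finite[OF A L X(1,2) this X(3)] obtain l
    where l: "l \<noteq> 0" "\<And>y. (\<forall>x\<in>X. y / x \<in> A) \<longleftrightarrow> y / l \<in> A" by blast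
  have X_iff: "(\<forall>x\<in>X. y / x \<in> A) \<longleftrightarrow> (\<forall>i. coeff p' i * y \<in> A) \<and> (\<forall>i. coeff q' i * y \<in> A)" for y
  proof (intro iffI conjI allI)
    assume *: "\<forall>x\<in>X. y / x \<in> A"
    have "c * y \<in> A" if "c \<in> coeff p' ` {..degree p'} \<union> coeff q' ` {..degree q'} \<or> c = 0" for c
    proof (cases "c = 0")
      case True
      then show ?thesis using field_subring_0[OF A] by simp
    next
      case False
      then have "inverse c \<in> X" using that unfolding X_def by auto
      with * have "y / inverse c \<in> A" by blast
      then show ?thesis by (simp add: divide_inverse mult.commute)
    qed
    then show "coeff p' i * y \<in> A" "coeff q' i * y \<in> A" for i
      using coeff_range[of p' i] coeff_range[of q' i] by blast+
  next
    assume "(\<forall>i. coeff p' i * y \<in> A) \<and> (\<forall>i. coeff q' i * y \<in> A)"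
    then show "\<forall>x\<in>X. y / x \<in> A" unfolding X_def by (auto simp: divide_inverse mult.commute)
  qed
  have "l / l \<in> A" using l(1) field_subring_1[OF A] by simp
  then have lA: "\<And>i. coeff p' i * l \<in> A" "\<And>i. coeff q' i * l \<in> A" using l(2) X_iff by blast+
  show ?thesis
  proof (rule that)
    show "smult l m \<noteq> 0" using m(1) l(1) by simp
    show "smult l p' \<in> polys_over A" "smult l q' \<in> polys_over A"
      using lA by (auto simp: polys_over_def mult.commute)
    show "smult l m = p * smult l p'" using m(4) by simp
    show "smult l m = q * smult l q'" using m(5) by simp
    fix r s assume rs: "r \<in> polys_over A" "s \<in> polys_over A" "p * r = q * s"
    then obtain w where w: "w \<in> polys_over F" "p * r = m * w" using m(6)[of r s] AF by blast
    have "p * r = p * (p' * w)" unfolding w(2) by (subst m(4)) (rule mult.assoc)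
    then have r: "r = p' * w" using mult_left_cancel[OF pq(3)] by blast
    have "q * s = q * (q' * w)" unfolding rs(3)[symmetric] w(2) by (subst m(5)) (rule mult.assoc)
    then have s: "s = q' * w" using mult_left_cancel[OF pq(4)] by blast
    have cl: "coeff f i * coeff w j \<in> A" if "f * w \<in> polys_over A" "f \<in> polys_over F" for f i j
    proof (rule lcm_subring_integrally_closed[OF A L _ poly_mult_coeff_integral[OF A that(1)]])
      have "coeff f i \<in> F" "coeff w j \<in> F" using that(2) w(1) by (simp_all add: polys_over_def)
      then show "coeff f i * coeff w j \<in> fractions A"
        unfolding F_def by (rule field_subring_mult[OF field_subring_fractions[OF A]])
    qed
    have "coeff w j / l \<in> A" for j
    proof -
      have "\<forall>i. coeff p' i * coeff w j \<in> A" "\<forall>i. coeff q' i * coeff w j \<in> A"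
        using cl[of p' _ j] cl[of q' _ j] rs(1,2) m(2,3) unfolding r s by blast+
      then show ?thesis using l(2)[of "coeff w j"] X_iff[of "coeff w j"] by blast
    qed
    then have "smult (inverse l) w \<in> polys_over A" by (auto simp: polys_over_def divide_inverse mult.commute)
    moreover have "p * r = smult l m * smult (inverse l) w" using l(1) w(2) by simp
    ultimately show "\<exists>w\<in>polys_over A. p * r = smult l m * w" by blast
  qed
qed

lemma lcm_subring_adjoin:
  fixes A :: "'k::field set"
  assumes A: "field_subring A" and L: "lcm_subring A"
    and transcendental: "\<And>p. p \<in> polys_over A \<Longrightarrow> poly p x = 0 \<Longrightarrow> p = 0"
  shows "lcm_subring ((\<lambda>p. poly p x) ` polys_over A)"
  unfolding lcm_subring_def
proof (intro ballI impI)
  let ?B = "(\<lambda>p. poly p x) ` polys_over A"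
  fix u v assume "u \<in> ?B" "v \<in> ?B" and nz: "u \<noteq> 0" "v \<noteq> 0"
  then obtain p q where pq: "p \<in> polys_over A" "q \<in> polys_over A" "u = poly p x" "v = poly q x" by blast
  have "p \<noteq> 0" "q \<noteq> 0" using pq nz by auto
  from lcm_subring_polys[OF A L pq(1,2) this]
  obtain m p' q' where m: "m \<noteq> 0" "p' \<in> polys_over A" "q' \<in> polys_over A" "m = p * p'" "m = q * q'"
    and univ: "\<And>r s. r \<in> polys_over A \<Longrightarrow> s \<in> polys_over A \<Longrightarrow> p * r = q * s \<Longrightarrow> \<exists>w\<in>polys_over A. p * r = m * w"
    by blast
  have mA: "m \<in> polys_over A" using polys_over_mult[OF A pq(1) m(2)] m(4) by simp
  have mx: "poly m x \<noteq> 0" using transcendental[OF mA] m(1) by blast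
  show "\<exists>m\<in>?B. m \<noteq> 0 \<and> (\<forall>y. y / u \<in> ?B \<and> y / v \<in> ?B \<longleftrightarrow> y / m \<in> ?B)"
  proof (intro bexI[of _ "poly m x"] conjI allI iffI)
    show "poly m x \<noteq> 0" by fact
    show "poly m x \<in> ?B" using mA by blast
  next
    fix y assume "y / u \<in> ?B \<and> y / v \<in> ?B"
    then obtain r s where rs: "r \<in> polys_over A" "s \<in> polys_over A" "y / u = poly r x" "y / v = poly s x"
      by blast
    then have y: "y = poly (p * r) x" "y = poly (q * s) x" using nz pq by (auto simp: field_simps)
    then have "poly (p * r - q * s) x = 0" by simp
    then have "p * r - q * s = 0"
      by (rule transcendental[rotated]) (intro polys_over_diff polys_over_mult A pq rs)
    then obtain w where w: "w \<in> polys_over A" "p * r = m * w" using univ[OF rs(1,2)] by auto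
    then have "y / poly m x = poly w x" using y(1) mx by simp
    then show "y / poly m x \<in> ?B" using w by blast
  next
    fix y assume "y / poly m x \<in> ?B"
    then obtain w where w: "w \<in> polys_over A" "y / poly m x = poly w x" by blast
    then have y: "y = poly m x * poly w x" using mx by (simp add: field_simps)
    have "poly m x = u * poly p' x" by (simp only: m(4) pq(3) poly_mult)
    then have yu: "y = u * poly (p' * w) x" by (simp only: y poly_mult mult.assoc)
    have "poly m x = v * poly q' x" by (simp only: m(5) pq(4) poly_mult)
    then have yv: "y = v * poly (q' * w) x" by (simp only: y poly_mult mult.assoc)
    have "y / u = poly (p' * w) x" unfolding yu by (rule nonzero_mult_div_cancel_left[OF nz(1)])
    moreover have "y / v = poly (q' * w) x" unfolding yv by (rule nonzero_mult_div_cancel_left[OF nz(2)])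
    moreover note polys_over_mult[OF A m(2) w(1)] polys_over_mult[OF A m(3) w(1)]
    ultimately show "y / u \<in> ?B" "y / v \<in> ?B" by blast+
  qed
qed

text \<open>
  Together with the previous lemma this covers the ring of Laurent polynomials \<open>A[x, 1 / x]\<close>.
\<close>

lemma lcm_subring_localization:
  fixes B :: "'k::field set"
  assumes B: "field_subring B" and L: "lcm_subring B" and x: "x \<in> B" "x \<noteq> 0"
  shows "lcm_subring {y. \<exists>n. x ^ n * y \<in> B}"
  unfolding lcm_subring_def
proof (intro ballI impI)
  let ?C = "{y. \<exists>n. x ^ n * y \<in> B}"
  have mono: "x ^ (n + k) * y \<in> B" if "x ^ n * y \<in> B" for n k y
  proof -
    have "x ^ (n + k) * y = x ^ k * (x ^ n * y)" by (simp only: power_add mult_ac)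
    then show ?thesis using field_subring_mult[OF B field_subring_power[OF B x(1), of k] that] by (simp only:)
  qed
  fix p q assume "p \<in> ?C" "q \<in> ?C" and nz: "p \<noteq> 0" "q \<noteq> 0"
  then obtain a b where ab: "x ^ a * p \<in> B" "x ^ b * q \<in> B" by blast
  have nz': "x ^ a * p \<noteq> 0" "x ^ b * q \<noteq> 0" using nz x by auto
  obtain m where m: "m \<in> B" "m \<noteq> 0" "\<And>y. y / (x ^ a * p) \<in> B \<and> y / (x ^ b * q) \<in> B \<longleftrightarrow> y / m \<in> B"
    using L ab nz' unfolding lcm_subring_def by blast
  have shift: "y / p \<in> ?C \<longleftrightarrow> (\<exists>N. \<forall>n\<ge>N. x ^ n * y / (x ^ a * p) \<in> B)" if "p \<noteq> 0" for y p a
  proof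
    assume "y / p \<in> ?C"
    then obtain n where n: "x ^ n * (y / p) \<in> B" by blast
    have "x ^ k * y / (x ^ a * p) \<in> B" if "k \<ge> n + a" for k
    proof -
      have "x ^ k = x ^ (n + (k - n - a)) * x ^ a" using that by (simp flip: power_add)
      then have "x ^ k * y / (x ^ a * p) = x ^ (n + (k - n - a)) * (y / p)"
        by (simp only:) (simp add: x(2))
      then show ?thesis using mono[OF n] by (simp only:)
    qed
    then show "\<exists>N. \<forall>n\<ge>N. x ^ n * y / (x ^ a * p) \<in> B" by blast
  next
    assume "\<exists>N. \<forall>n\<ge>N. x ^ n * y / (x ^ a * p) \<in> B"
    then obtain n where "x ^ n * y / (x ^ a * p) \<in> B" by blast
    then have "x ^ n * (y / (x ^ a * p)) \<in> B" by (simp only: times_divide_eq_right)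
    then have "x ^ (n + a) * (y / (x ^ a * p)) \<in> B" by (rule mono)
    moreover have "x ^ (n + a) * (y / (x ^ a * p)) = x ^ n * (y / p)"
      using x(2) by (simp add: power_add)
    ultimately have "x ^ n * (y / p) \<in> B" by (simp only:)
    then show "y / p \<in> ?C" by blast
  qed
  show "\<exists>m\<in>?C. m \<noteq> 0 \<and> (\<forall>y. y / p \<in> ?C \<and> y / q \<in> ?C \<longleftrightarrow> y / m \<in> ?C)"
  proof (intro bexI[of _ m] conjI allI)
    show "m \<noteq> 0" by fact
    show "m \<in> ?C" using m(1) by (auto intro: exI[of _ 0])
    fix y
    have "y / p \<in> ?C \<and> y / q \<in> ?C \<longleftrightarrow>
        (\<exists>N. \<forall>n\<ge>N. x ^ n * y / (x ^ a * p) \<in> B \<and> x ^ n * y / (x ^ b * q) \<in> B)"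
      unfolding shift[OF nz(1), of y a] shift[OF nz(2), of y b]
      by (meson nat_le_linear order_trans)
    also have "\<dots> \<longleftrightarrow> y / m \<in> ?C"
      unfolding m(3) using shift[OF m(2), of y 0] by simp
    finally show "y / p \<in> ?C \<and> y / q \<in> ?C \<longleftrightarrow> y / m \<in> ?C" .
  qed
qed

section \<open>Graded rings whose nonzero homogeneous elements are units\<close>

text \<open>
  This is the structure of the homogeneous quotient ring of a graded domain, with its pieces in
  the quotient field.  A piece may be \<open>{0}\<close>, so the degrees that occur form a subgroup only.
\<close>

locale graded_field =
  fixes P :: "'h::ab_group_add \<Rightarrow> 'k::field set"
  assumes piece_0: "0 \<in> P \<alpha>"
    and piece_diff: "x \<in> P \<alpha> \<Longrightarrow> y \<in> P \<alpha> \<Longrightarrow> x - y \<in> P \<alpha>"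
    and piece_mult: "x \<in> P \<alpha> \<Longrightarrow> y \<in> P \<beta> \<Longrightarrow> x * y \<in> P (\<alpha> + \<beta>)"
    and piece_1: "1 \<in> P 0"
    and piece_inverse: "x \<in> P \<alpha> \<Longrightarrow> inverse x \<in> P (- \<alpha>)"
    and pieces_independent: "finite A \<Longrightarrow> (\<And>\<alpha>. \<alpha> \<in> A \<Longrightarrow> t \<alpha> \<in> P \<alpha>) \<Longrightarrow>
      (\<Sum>\<alpha>\<in>A. t \<alpha>) = 0 \<Longrightarrow> \<alpha> \<in> A \<Longrightarrow> t \<alpha> = 0"
begin

definition T :: "'k set" where "T = {x. \<exists>f. decomposes P x f}"

text \<open>
  The component function is arbitrary outside \<open>T\<close>.
\<close>

definition comp :: "'k \<Rightarrow> 'h \<Rightarrow> 'k" where "comp x = (THE f. decomposes P x f)"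

definition supp :: "'k \<Rightarrow> 'h set" where "supp x = {\<alpha>. comp x \<alpha> \<noteq> 0}"

lemma piece_minus: "x \<in> P \<alpha> \<Longrightarrow> - x \<in> P \<alpha>"
  using piece_diff[OF piece_0, of x \<alpha>] by simp

lemma piece_add: "x \<in> P \<alpha> \<Longrightarrow> y \<in> P \<alpha> \<Longrightarrow> x + y \<in> P \<alpha>"
  using piece_diff[of x \<alpha> "- y"] piece_minus by simp

lemma piece_sum: "(\<And>i. i \<in> S \<Longrightarrow> f i \<in> P \<alpha>) \<Longrightarrow> sum f S \<in> P \<alpha>"
  by (induction S rule: infinite_finite_induct) (auto simp: piece_0 piece_add)

lemma piece_divide: "x \<in> P \<alpha> \<Longrightarrow> y \<in> P \<beta> \<Longrightarrow> x / y \<in> P (\<alpha> - \<beta>)"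
  using piece_mult[of x \<alpha> "inverse y" "- \<beta>"] piece_inverse[of y \<beta>] by (simp add: divide_inverse)

lemma decomposes_unique:
  assumes f: "decomposes P x f" and g: "decomposes P x g"
  shows "f = g"
proof
  fix \<alpha>
  define A where "A = {\<alpha>. f \<alpha> \<noteq> 0} \<union> {\<alpha>. g \<alpha> \<noteq> 0}"
  have A: "finite A" using f g unfolding A_def decomposes_def by auto
  have "x = (\<Sum>\<alpha>\<in>A. f \<alpha>)"
    using f A unfolding decomposes_def by (auto simp: A_def intro!: sum.mono_neutral_left)
  moreover have "x = (\<Sum>\<alpha>\<in>A. g \<alpha>)"
    using g A unfolding decomposes_def by (auto simp: A_def intro!: sum.mono_neutral_left)
  ultimately have "(\<Sum>\<alpha>\<in>A. f \<alpha> - g \<alpha>) = 0" by (simp add: sum_subtractf)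
  moreover have "f \<alpha> - g \<alpha> \<in> P \<alpha>" for \<alpha>
    using f g by (intro piece_diff) (auto simp: decomposes_def)
  ultimately have "\<alpha> \<in> A \<Longrightarrow> f \<alpha> - g \<alpha> = 0"
    using pieces_independent[OF A, of "\<lambda>\<alpha>. f \<alpha> - g \<alpha>"] by blast
  then show "f \<alpha> = g \<alpha>" by (cases "\<alpha> \<in> A") (auto simp: A_def)
qed

lemma comp_eqI:
  assumes "decomposes P x f" shows "comp x = f"
  unfolding comp_def using assms decomposes_unique by (blast intro: the_equality)

lemma decomposes_comp: "x \<in> T \<Longrightarrow> decomposes P x (comp x)"
  unfolding T_def using comp_eqI by blast

lemma comp_piece: "x \<in> T \<Longrightarrow> comp x \<alpha> \<in> P \<alpha>"
  and finite_supp: "x \<in> T \<Longrightarrow> finite (supp x)"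
  and sum_comp: "x \<in> T \<Longrightarrow> (\<Sum>\<alpha>\<in>supp x. comp x \<alpha>) = x"
  using decomposes_comp[of x] unfolding decomposes_def supp_def by simp_all

lemma sum_comp_superset:
  assumes "x \<in> T" "finite A" "supp x \<subseteq> A" shows "(\<Sum>\<alpha>\<in>A. comp x \<alpha>) = x"
proof -
  have "(\<Sum>\<alpha>\<in>A. comp x \<alpha>) = (\<Sum>\<alpha>\<in>supp x. comp x \<alpha>)"
    using assms by (intro sum.mono_neutral_right) (auto simp: supp_def)
  then show ?thesis using sum_comp[OF assms(1)] by simp
qed

lemma
  assumes "\<And>\<alpha>. f \<alpha> \<in> P \<alpha>" "finite A" "\<And>\<alpha>. \<alpha> \<notin> A \<Longrightarrow> f \<alpha> = 0" "x = (\<Sum>\<alpha>\<in>A. f \<alpha>)"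
  shows T_sumI: "x \<in> T" and comp_sumI: "comp x = f"
proof -
  have sub: "{\<alpha>. f \<alpha> \<noteq> 0} \<subseteq> A" using assms(3) by auto
  have "x = (\<Sum>\<alpha> | f \<alpha> \<noteq> 0. f \<alpha>)"
    unfolding assms(4) using assms(2) sub by (intro sum.mono_neutral_right) auto
  with sub assms(1,2) have "decomposes P x f"
    unfolding decomposes_def by (auto intro: finite_subset)
  then show "x \<in> T" "comp x = f" using comp_eqI by (auto simp: T_def)
qed

lemma
  assumes "x \<in> P \<alpha>"
  shows T_piece: "x \<in> T" and comp_homogeneous: "comp x = (\<lambda>\<beta>. if \<beta> = \<alpha> then x else 0)"
proof -
  have *: "(if \<beta> = \<alpha> then x else 0) \<in> P \<beta>" for \<beta> using assms piece_0 by simp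
  show "x \<in> T" by (rule T_sumI[where A = "{\<alpha>}", OF *]) auto
  show "comp x = (\<lambda>\<beta>. if \<beta> = \<alpha> then x else 0)" by (rule comp_sumI[where A = "{\<alpha>}", OF *]) auto
qed

lemma degree_unique: "x \<in> P \<alpha> \<Longrightarrow> x \<in> P \<beta> \<Longrightarrow> x \<noteq> 0 \<Longrightarrow> \<alpha> = \<beta>"
  using comp_homogeneous[of x \<alpha>] comp_homogeneous[of x \<beta>] by (metis (full_types))

lemma comp_0: "comp 0 \<alpha> = 0" and comp_1: "comp 1 \<alpha> = (if \<alpha> = 0 then 1 else 0)"
  using comp_homogeneous[OF piece_0[of 0]] comp_homogeneous[OF piece_1] by simp_all

lemma
  assumes "x \<in> T" "y \<in> T"
  shows T_diff: "x - y \<in> T" and comp_diff: "comp (x - y) = (\<lambda>\<alpha>. comp x \<alpha> - comp y \<alpha>)"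
proof -
  have 1: "comp x \<alpha> - comp y \<alpha> \<in> P \<alpha>" for \<alpha> using comp_piece assms piece_diff by blast
  have 2: "finite (supp x \<union> supp y)" using finite_supp assms by simp
  have 3: "comp x \<alpha> - comp y \<alpha> = 0" if "\<alpha> \<notin> supp x \<union> supp y" for \<alpha>
    using that by (simp add: supp_def)
  have 4: "x - y = (\<Sum>\<alpha>\<in>supp x \<union> supp y. comp x \<alpha> - comp y \<alpha>)"
    unfolding sum_subtractf using assms 2 by (simp add: sum_comp_superset)
  show "x - y \<in> T" by (rule T_sumI[OF 1 2 3 4])
  show "comp (x - y) = (\<lambda>\<alpha>. comp x \<alpha> - comp y \<alpha>)" by (rule comp_sumI[OF 1 2 3 4])
qed

lemma
  assumes x: "x \<in> T" and y: "y \<in> T" and F: "finite F" "supp x \<subseteq> F" and G: "finite G" "supp y \<subseteq> G"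
  shows T_mult: "x * y \<in> T"
    and comp_mult: "comp (x * y) = (\<lambda>\<delta>. \<Sum>(\<alpha>, \<beta>)\<in>{p \<in> F \<times> G. fst p + snd p = \<delta>}. comp x \<alpha> * comp y \<beta>)"
proof -
  define h where "h p = comp x (fst p) * comp y (snd p)" for p
  define s where "s p = fst p + snd p" for p :: "'h \<times> 'h"
  have 1: "sum h {p \<in> F \<times> G. s p = \<delta>} \<in> P \<delta>" for \<delta>
  proof (rule piece_sum)
    fix p assume p: "p \<in> {p \<in> F \<times> G. s p = \<delta>}"
    have "h p \<in> P (fst p + snd p)" unfolding h_def by (intro piece_mult comp_piece x y)
    then show "h p \<in> P \<delta>" using p by (simp add: s_def)
  qed
  have 2: "finite (s ` (F \<times> G))" using F G by simp
  have 3: "sum h {p \<in> F \<times> G. s p = \<delta>} = 0" if "\<delta> \<notin> s ` (F \<times> G)" for \<delta>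
  proof -
    have "{p \<in> F \<times> G. s p = \<delta>} = {}" using that by blast
    then show ?thesis by (simp only: sum.empty)
  qed
  have "x * y = (\<Sum>\<alpha>\<in>F. comp x \<alpha>) * (\<Sum>\<beta>\<in>G. comp y \<beta>)"
    by (simp only: sum_comp_superset[OF x F] sum_comp_superset[OF y G])
  also have "\<dots> = (\<Sum>p\<in>F \<times> G. h p)"
    unfolding h_def sum_product sum.cartesian_product by (simp add: case_prod_unfold)
  also have "\<dots> = (\<Sum>\<delta>\<in>s ` (F \<times> G). sum h {p \<in> F \<times> G. s p = \<delta>})"
    using F G by (intro sum.image_gen) simp
  finally have 4: "x * y = (\<Sum>\<delta>\<in>s ` (F \<times> G). sum h {p \<in> F \<times> G. s p = \<delta>})" .
  show "x * y \<in> T" by (rule T_sumI[OF 1 2 3 4])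
  have "comp (x * y) = (\<lambda>\<delta>. sum h {p \<in> F \<times> G. s p = \<delta>})" by (rule comp_sumI[OF 1 2 3 4])
  then show "comp (x * y) = (\<lambda>\<delta>. \<Sum>(\<alpha>, \<beta>)\<in>{p \<in> F \<times> G. fst p + snd p = \<delta>}. comp x \<alpha> * comp y \<beta>)"
    by (simp add: h_def s_def case_prod_unfold)
qed

lemma field_subring_T: "field_subring T"
  unfolding field_subring_def
  using T_piece[OF piece_1] T_diff T_mult[OF _ _ finite_supp order_refl finite_supp order_refl] by blast

lemmas T_simps = field_subring_simps[OF field_subring_T]

lemma supp_mult:
  assumes "x \<in> T" "y \<in> T" "\<delta> \<in> supp (x * y)"
  obtains \<alpha> \<beta> where "\<alpha> \<in> supp x" "\<beta> \<in> supp y" "\<delta> = \<alpha> + \<beta>"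
proof -
  let ?S = "{p \<in> supp x \<times> supp y. fst p + snd p = \<delta>}"
  have "(\<Sum>(\<alpha>, \<beta>)\<in>?S. comp x \<alpha> * comp y \<beta>) \<noteq> 0"
    using assms(3) comp_mult[OF assms(1,2) finite_supp[OF assms(1)] order_refl finite_supp[OF assms(2)] order_refl]
    by (simp add: supp_def)
  then have "?S \<noteq> {}" by (metis (no_types, lifting) sum.empty)
  then obtain p where "p \<in> supp x \<times> supp y" "fst p + snd p = \<delta>" by blast
  then show ?thesis using that[of "fst p" "snd p"] by (simp add: mem_Times_iff)
qed

lemma comp_add:
  assumes "x \<in> T" "y \<in> T" shows "comp (x + y) \<alpha> = comp x \<alpha> + comp y \<alpha>"
proof -
  have "x - (0 - y) \<in> T" "comp (x - (0 - y)) \<alpha> = comp x \<alpha> - (comp 0 \<alpha> - comp y \<alpha>)"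
    using assms T_simps(2) by (simp_all only: T_diff comp_diff)
  then show ?thesis by (simp add: comp_0)
qed

lemma comp_sum:
  assumes "\<And>i. i \<in> S \<Longrightarrow> f i \<in> T" shows "comp (sum f S) \<alpha> = (\<Sum>i\<in>S. comp (f i) \<alpha>)"
  using assms
  by (induction S rule: infinite_finite_induct) (simp_all add: comp_0 comp_add T_simps(7))

lemma comp_shift:
  assumes u: "u \<in> P \<delta>" and x: "x \<in> T" shows "comp (u * x) \<alpha> = u * comp x (\<alpha> - \<delta>)"
proof -
  have 1: "u * comp x (\<alpha> - \<delta>) \<in> P \<alpha>" for \<alpha>
    using piece_mult[OF u comp_piece[OF x], of "\<alpha> - \<delta>"] by simp
  have 2: "finite ((+) \<delta> ` supp x)" using finite_supp[OF x] by simp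
  have 3: "u * comp x (\<alpha> - \<delta>) = 0" if "\<alpha> \<notin> (+) \<delta> ` supp x" for \<alpha>
  proof -
    have "\<alpha> = \<delta> + (\<alpha> - \<delta>)" by simp
    then have "\<alpha> - \<delta> \<notin> supp x" using that by blast
    then show ?thesis by (simp add: supp_def)
  qed
  have "u * x = (\<Sum>\<alpha>\<in>supp x. u * comp x \<alpha>)"
    by (subst sum_comp[OF x, symmetric]) (rule sum_distrib_left)
  also have "\<dots> = (\<Sum>\<alpha>\<in>(+) \<delta> ` supp x. u * comp x (\<alpha> - \<delta>))"
    by (subst sum.reindex) simp_all
  finally have 4: "u * x = (\<Sum>\<alpha>\<in>(+) \<delta> ` supp x. u * comp x (\<alpha> - \<delta>))" .
  show ?thesis using comp_sumI[OF 1 2 3 4] by metis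
qed

lemma comp_inject: "x \<in> T \<Longrightarrow> y \<in> T \<Longrightarrow> (\<And>\<alpha>. comp x \<alpha> = comp y \<alpha>) \<Longrightarrow> x = y"
  using sum_comp[of x] sum_comp[of y] by (simp add: supp_def)

lemma supp_empty_iff: "x \<in> T \<Longrightarrow> supp x = {} \<longleftrightarrow> x = 0"
  using sum_comp[of x] by (auto simp: supp_def comp_0)

subsection \<open>Leading components\<close>

definition lowest :: "('h \<Rightarrow> 'h \<Rightarrow> bool) \<Rightarrow> 'k \<Rightarrow> 'h \<Rightarrow> bool" where
  "lowest lt x \<alpha> \<longleftrightarrow> \<alpha> \<in> supp x \<and> (\<forall>\<beta>\<in>supp x. \<beta> = \<alpha> \<or> lt \<alpha> \<beta>)"

lemma lowest_exists:
  assumes "translation_order lt" "x \<in> T" "x \<noteq> 0"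
  obtains \<alpha> where "lowest lt x \<alpha>"
proof -
  have "supp x \<noteq> {}" using supp_empty_iff assms by blast
  then obtain \<alpha> where "\<alpha> \<in> supp x" "\<And>\<beta>. \<beta> \<in> supp x \<Longrightarrow> \<beta> \<noteq> \<alpha> \<Longrightarrow> lt \<alpha> \<beta>"
    using translation_order_max[OF translation_order_converse[OF assms(1)] finite_supp[OF assms(2)]] by blast
  then show ?thesis using that unfolding lowest_def by blast
qed

lemma comp_mult_lowest:
  assumes lt: "translation_order lt" and T: "x \<in> T" "y \<in> T" and low: "lowest lt x \<alpha>" "lowest lt y \<beta>"
  shows "comp (x * y) (\<alpha> + \<beta>) = comp x \<alpha> * comp y \<beta>"
proof -
  have "{p \<in> supp x \<times> supp y. fst p + snd p = \<alpha> + \<beta>} = {(\<alpha>, \<beta>)}"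
  proof (intro equalityI subsetI)
    fix p assume p: "p \<in> {p \<in> supp x \<times> supp y. fst p + snd p = \<alpha> + \<beta>}"
    then have "\<alpha> = fst p \<or> lt \<alpha> (fst p)" "\<beta> = snd p \<or> lt \<beta> (snd p)" "\<alpha> + \<beta> = fst p + snd p"
      using low unfolding lowest_def by (auto simp: mem_Times_iff)
    then have "\<alpha> = fst p \<and> \<beta> = snd p" by (rule translation_order_add_le[OF lt])
    then show "p \<in> {(\<alpha>, \<beta>)}" by (simp add: prod_eq_iff)
  qed (use low in \<open>auto simp: lowest_def\<close>)
  then show ?thesis
    using comp_mult[OF T finite_supp[OF T(1)] order_refl finite_supp[OF T(2)] order_refl] by simp
qed

lemma lowest_mult_supp:
  assumes "translation_order lt" "x \<in> T" "y \<in> T" "lowest lt x \<alpha>" "lowest lt y \<beta>"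
  shows "\<alpha> + \<beta> \<in> supp (x * y)"
  using comp_mult_lowest[OF assms] assms(4,5) by (simp add: supp_def lowest_def)

text \<open>
  The lowest degrees of \<open>u\<close> and of its inverse add up to \<open>0\<close>, and so do the highest degrees.  Hence
  the lowest and the highest degree of \<open>u\<close> agree.
\<close>

lemma unit_homogeneous:
  assumes lt: "translation_order (lt :: 'h \<Rightarrow> 'h \<Rightarrow> bool)" and u: "u \<in> T" "inverse u \<in> T" "u \<noteq> 0"
  shows "\<exists>\<alpha>. u \<in> P \<alpha>"
proof -
  note gt = translation_order_converse[OF lt]
  have v: "inverse u \<noteq> 0" using u by simp
  obtain \<alpha> \<beta> where low: "lowest lt u \<alpha>" "lowest lt (inverse u) \<beta>"
    using lowest_exists[OF lt] u v by metis
  obtain \<gamma> \<delta> where high: "lowest (\<lambda>a b. lt b a) u \<gamma>" "lowest (\<lambda>a b. lt b a) (inverse u) \<delta>"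
    using lowest_exists[OF gt] u v by metis
  have 0: "\<epsilon> = 0" if "\<epsilon> \<in> supp (u * inverse u)" for \<epsilon>
    using that u(3) by (auto simp: supp_def comp_1 split: if_splits)
  have "\<alpha> + \<beta> = 0" by (rule 0) (rule lowest_mult_supp[OF lt u(1,2) low])
  moreover have "\<gamma> + \<delta> = 0" by (rule 0) (rule lowest_mult_supp[OF gt u(1,2) high])
  moreover have "\<alpha> = \<gamma> \<or> lt \<alpha> \<gamma>" "\<beta> = \<delta> \<or> lt \<beta> \<delta>" using low high unfolding lowest_def by blast+
  ultimately have "\<alpha> = \<gamma>" using translation_order_add_le[OF lt] by metis
  have "supp u = {\<alpha>}"
  proof (intro equalityI subsetI)
    fix \<epsilon> assume "\<epsilon> \<in> supp u"
    then have "\<epsilon> = \<alpha> \<or> lt \<alpha> \<epsilon>" "\<epsilon> = \<alpha> \<or> lt \<epsilon> \<alpha>" using low high \<open>\<alpha> = \<gamma>\<close> unfolding lowest_def by blast+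
    then show "\<epsilon> \<in> {\<alpha>}" using translation_order_asym[OF lt] by blast
  qed (use low in \<open>auto simp: lowest_def\<close>)
  then have "u = comp u \<alpha>" using sum_comp[OF u(1)] by simp
  then show ?thesis using comp_piece[OF u(1)] by metis
qed

end

section \<open>Least common multiples in a graded field\<close>

context graded_field
begin

definition homogeneous_units :: "'k set" where
  "homogeneous_units = {u. u \<noteq> 0 \<and> (\<exists>\<alpha>. u \<in> P \<alpha>)}"

definition unit_group :: "'k set \<Rightarrow> bool" where
  "unit_group M \<longleftrightarrow> M \<subseteq> homogeneous_units \<and> P 0 - {0} \<subseteq> M \<and>
     (\<forall>x\<in>M. \<forall>y\<in>M. x * y \<in> M) \<and> (\<forall>x\<in>M. inverse x \<in> M)"

text \<open>
  The unit groups that are free of finite rank modulo the elements of degree \<open>0\<close>, built by adjoining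
  one generator after another.
\<close>

inductive free_unit_group :: "'k set \<Rightarrow> bool" where
  base: "free_unit_group (P 0 - {0})"
| adjoin: "free_unit_group M \<Longrightarrow> x \<in> homogeneous_units \<Longrightarrow> (\<And>k::int. k \<noteq> 0 \<Longrightarrow> x powi k \<notin> M) \<Longrightarrow>
    free_unit_group {m * x powi k | m k. m \<in> M}"

lemma homogeneous_units_mult: "x \<in> homogeneous_units \<Longrightarrow> y \<in> homogeneous_units \<Longrightarrow> x * y \<in> homogeneous_units"
  unfolding homogeneous_units_def using piece_mult by fastforce

lemma homogeneous_units_inverse: "x \<in> homogeneous_units \<Longrightarrow> inverse x \<in> homogeneous_units"
  unfolding homogeneous_units_def using piece_inverse by fastforce

lemma homogeneous_units_1: "1 \<in> homogeneous_units"
  unfolding homogeneous_units_def using piece_1 by auto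

lemma homogeneous_units_power: "x \<in> homogeneous_units \<Longrightarrow> x ^ n \<in> homogeneous_units"
  by (induction n) (auto simp: homogeneous_units_1 homogeneous_units_mult)

lemma homogeneous_units_power_int: "x \<in> homogeneous_units \<Longrightarrow> x powi k \<in> homogeneous_units"
  by (simp add: power_int_def homogeneous_units_power homogeneous_units_inverse)

lemma homogeneous_units_T: "x \<in> homogeneous_units \<Longrightarrow> x \<in> T"
  unfolding homogeneous_units_def using T_piece by blast

lemma homogeneous_units_nonzero: "x \<in> homogeneous_units \<Longrightarrow> x \<noteq> 0"
  unfolding homogeneous_units_def by blast

lemma unit_group_power_int:
  assumes M: "unit_group M" and x: "x \<in> M" shows "x powi k \<in> M"
proof -
  have "1 \<in> M" using M piece_1 unfolding unit_group_def by auto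
  then have "y ^ n \<in> M" if "y \<in> M" for y n
    using that M by (induction n) (auto simp: unit_group_def)
  then show ?thesis using x M by (simp add: power_int_def unit_group_def)
qed

lemma free_unit_group_unit_group: "free_unit_group M \<Longrightarrow> unit_group M"
proof (induction rule: free_unit_group.induct)
  case base
  have "x * y \<in> P 0" if "x \<in> P 0" "y \<in> P 0" for x y using piece_mult[OF that] by simp
  moreover have "inverse x \<in> P 0" if "x \<in> P 0" for x using piece_inverse[OF that] by simp
  ultimately show ?case unfolding unit_group_def homogeneous_units_def by auto
next
  case (adjoin M x)
  have x: "x \<noteq> 0" using adjoin(2) homogeneous_units_nonzero by blast
  have M: "M \<subseteq> homogeneous_units" "P 0 - {0} \<subseteq> M" and Mm: "\<And>x y. x \<in> M \<Longrightarrow> y \<in> M \<Longrightarrow> x * y \<in> M"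
    and Mi: "\<And>x. x \<in> M \<Longrightarrow> inverse x \<in> M"
    using adjoin(4) unfolding unit_group_def by blast+
  let ?N = "{m * x powi k | m k. m \<in> M}"
  have "?N \<subseteq> homogeneous_units"
    using M adjoin(2) by (auto intro: homogeneous_units_mult homogeneous_units_power_int)
  moreover have "P 0 - {0} \<subseteq> ?N"
    using M(2) by (force intro: exI[of _ "0::int"])
  moreover have "a * b \<in> ?N" if ab: "a \<in> ?N" "b \<in> ?N" for a b
  proof -
    from ab obtain m n k l where *: "a = m * x powi k" "b = n * x powi l" "m \<in> M" "n \<in> M" by blast
    have "a * b = (m * n) * x powi (k + l)" using x unfolding * by (simp add: power_int_add)
    then show ?thesis using Mm[OF *(3,4)] by blast
  qed
  moreover have "inverse a \<in> ?N" if a: "a \<in> ?N" for a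
  proof -
    from a obtain m k where *: "a = m * x powi k" "m \<in> M" by blast
    have "inverse a = inverse m * x powi (- k)" unfolding * by (simp add: power_int_minus)
    then show ?thesis using Mi[OF *(2)] by blast
  qed
  ultimately show ?case unfolding unit_group_def by blast
qed

lemma homogeneous_power_0:
  assumes tf: "torsion_free TYPE('h)" and x: "x \<in> homogeneous_units" and k: "k \<noteq> 0" "x powi k \<in> P 0"
  shows "x \<in> P 0"
proof -
  obtain \<delta> where \<delta>: "x \<in> P \<delta>" "x \<noteq> 0" using x unfolding homogeneous_units_def by blast
  have pow: "x ^ n \<in> P (\<Sum>i<n. \<delta>)" for n
  proof (induction n)
    case (Suc n)
    then show ?case using piece_mult[OF \<delta>(1) Suc] by (simp add: add.commute)
  qed (simp add: piece_1)
  define n where "n = nat \<bar>k\<bar>"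
  have "x ^ n \<in> P 0"
  proof (cases "k \<ge> 0")
    case True
    then show ?thesis using k(2) by (simp add: n_def power_int_def)
  next
    case False
    then have "inverse (x ^ n) \<in> P 0" using k(2) by (simp add: n_def power_int_def power_inverse)
    then show ?thesis using piece_inverse[of "inverse (x ^ n)" 0] by simp
  qed
  then have "(\<Sum>i<n. \<delta>) = 0" using degree_unique[OF pow] \<delta>(2) by simp
  moreover have "n > 0" using k(1) by (simp add: n_def)
  ultimately have "\<delta> = 0" using tf unfolding torsion_free_def by blast
  then show ?thesis using \<delta> by simp
qed

text \<open>
  Suppose that \<open>M\<close> is generated by a smaller group and \<open>b\<close>.  A relation between \<open>x\<close> and \<open>b\<close> over the smaller group
  is removed by a unimodular change of the generators \<open>x, b\<close> into \<open>e, a\<close>: a power of \<open>e\<close> lies in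
  the smaller group, so that the induction hypothesis applies to \<open>e\<close>, and \<open>a\<close> is free.  The last
  part of the conclusion is what the induction needs for the freeness of \<open>a\<close>.
\<close>

lemma free_unit_group_torsion:
  assumes tf: "torsion_free TYPE('h)"
    and "free_unit_group M" "x \<in> homogeneous_units" "k \<noteq> 0" "x powi k \<in> M"
  shows "\<exists>N. free_unit_group N \<and> M \<subseteq> N \<and> x \<in> N \<and> (\<forall>y\<in>N. \<exists>j::int. j \<noteq> 0 \<and> y powi j \<in> M)"
  using assms(2-5)
proof (induction arbitrary: x k rule: free_unit_group.induct)
  case base
  then have "x \<in> P 0 - {0}"
    using homogeneous_power_0[OF tf base(1,2)] homogeneous_units_nonzero by blast
  then show ?case
    using free_unit_group.base by (intro exI[of _ "P 0 - {0}"]) (auto intro!: exI[of _ "1::int"])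
next
  case (adjoin M b)
  note M = free_unit_group_unit_group[OF adjoin(1)]
  have Mm: "x * y \<in> M" if "x \<in> M" "y \<in> M" for x y using M that unfolding unit_group_def by blast
  have Mp: "x powi j \<in> M" if "x \<in> M" for x j using unit_group_power_int[OF M that] .
  have x0: "x \<noteq> 0" and b0: "b \<noteq> 0" using adjoin homogeneous_units_nonzero by blast+
  obtain m c where m: "x powi k = m * b powi c" "m \<in> M" using adjoin(7) by blast
  define g where "g = gcd k c"
  have "g \<noteq> 0" using adjoin(6) by (simp add: g_def)
  define k' where "k' = k div g"
  define c' where "c' = c div g"
  have k': "k = k' * g" and c': "c = c' * g" by (simp_all add: k'_def c'_def g_def)
  have "k' \<noteq> 0" using k' adjoin(6) by auto
  have "coprime k' c'" unfolding k'_def c'_def g_def using adjoin(6) by (intro div_gcd_coprime) simp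
  then obtain u v where uv: "u * k' + v * c' = 1"
    using bezout_int[of k' c'] by (auto simp: coprime_iff_gcd_eq_1)
  define e where "e = x powi k' * b powi (- c')"
  define a where "a = b powi u * x powi v"
  have e_unit: "e \<in> homogeneous_units" and a_unit: "a \<in> homogeneous_units"
    unfolding e_def a_def using adjoin(2,5) by (auto intro: homogeneous_units_mult homogeneous_units_power_int)
  have nz: "e \<noteq> 0" "a \<noteq> 0" using e_unit a_unit homogeneous_units_nonzero by blast+
  have pow: "(y * z) powi j = y powi j * z powi j" "(y powi i) powi j = y powi (i * j)" for y z :: 'k and i j
    by (simp_all add: power_int_mult_distrib power_int_mult)
  have padd: "x powi i * x powi j = x powi (i + j)" "b powi i * b powi j = b powi (i + j)" for i j
    using x0 b0 by (simp_all add: power_int_add)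
  have "e powi g = x powi k * b powi (- c)"
    unfolding e_def pow k' c' by simp
  also have "\<dots> = m * (b powi c * b powi (- c))" unfolding m by (simp only: mult.assoc)
  also have "\<dots> = m" unfolding padd by simp
  finally have eg: "e powi g = m" .
  \<comment> \<open>The inverse change of generators.\<close>
  have x_eq: "x = e powi u * a powi c'"
  proof -
    have "e powi u * a powi c' = (x powi (k' * u) * x powi (v * c')) * (b powi (- c' * u) * b powi (u * c'))"
      unfolding e_def a_def pow by (simp only: mult_ac)
    also have "\<dots> = x powi 1 * b powi 0"
      unfolding padd using uv by (simp add: mult.commute)
    finally show ?thesis by simp
  qed
  have b_eq: "a powi k' = b * e powi v"
  proof -
    have "b * e powi v = (b powi 1 * b powi (- c' * v)) * x powi (k' * v)"
      unfolding e_def pow by (simp only: power_int_1_right mult_ac)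
    also have "\<dots> = b powi (u * k') * x powi (v * k')"
    proof -
      have "1 + - c' * v = u * k'" using uv by (simp add: mult.commute)
      then show ?thesis unfolding padd by (simp only: mult.commute)
    qed
    also have "\<dots> = a powi k'" unfolding a_def pow by (rule refl)
    finally show ?thesis by (rule sym)
  qed
  have "e powi g \<in> M" using m(2) eg by simp
  from adjoin.IH[OF e_unit \<open>g \<noteq> 0\<close> this] obtain N where N: "free_unit_group N" "M \<subseteq> N" "e \<in> N"
    and "\<forall>y\<in>N. \<exists>j::int. j \<noteq> 0 \<and> y powi j \<in> M" by (elim exE conjE)
  then have tors: "\<exists>j::int. j \<noteq> 0 \<and> y powi j \<in> M" if "y \<in> N" for y using that by simp
  note NG = free_unit_group_unit_group[OF N(1)]
  have Nm: "x * y \<in> N" if "x \<in> N" "y \<in> N" for x y using NG that unfolding unit_group_def by blast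
  have Np: "x powi j \<in> N" if "x \<in> N" for x j using unit_group_power_int[OF NG that] .
  have free: "a powi i \<notin> N" if "i \<noteq> 0" for i
  proof
    assume "a powi i \<in> N"
    then obtain j where j: "j \<noteq> 0" "(a powi i) powi j \<in> M" using tors by blast
    have "((a powi i) powi j) powi (k' * g) = (a powi k') powi (i * j * g)"
      unfolding pow by (simp only: mult_ac)
    also have "\<dots> = b powi (i * j * g) * (e powi g) powi (v * i * j)"
      unfolding b_eq pow by (simp only: mult_ac)
    also have "\<dots> = b powi (i * j * g) * m powi (v * i * j)" by (simp only: eg)
    finally have "b powi (i * j * g) * m powi (v * i * j) \<in> M" using Mp[OF j(2)] by metis
    then have "b powi (i * j * g) * m powi (v * i * j) * m powi (- (v * i * j)) \<in> M"
      using Mm Mp m(2) by blast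
    moreover have "m \<noteq> 0" using m(2) M homogeneous_units_nonzero unfolding unit_group_def by blast
    then have "m powi l * m powi (- l) = 1" for l by (simp add: power_int_minus)
    ultimately have "b powi (i * j * g) \<in> M"
      by (simp only: mult.assoc[of "b powi (i * j * g)"] mult_1_right)
    then show False using adjoin(3) that j(1) \<open>g \<noteq> 0\<close> by simp
  qed
  let ?N = "{n * a powi k | n k. n \<in> N}"
  have "free_unit_group ?N" by (rule free_unit_group.adjoin[OF N(1) a_unit free])
  moreover have "{m * b powi k | m k. m \<in> M} \<subseteq> ?N"
  proof
    fix y assume "y \<in> {m * b powi k | m k. m \<in> M}"
    then obtain n i where y: "y = n * b powi i" "n \<in> M" by blast
    have "b = a powi k' * e powi (- v)"
    proof -
      have "e powi v * e powi (- v) = 1" using nz by (simp add: power_int_minus)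
      then show ?thesis unfolding b_eq by (simp only: mult.assoc mult_1_right)
    qed
    then have "b powi i = a powi (k' * i) * e powi (- v * i)" by (simp only: pow)
    then have "y = (n * e powi (- v * i)) * a powi (k' * i)" unfolding y(1) by (simp only: mult_ac)
    moreover have "n * e powi (- v * i) \<in> N" using y(2) N by (intro Nm Np) auto
    ultimately show "y \<in> ?N" by blast
  qed
  moreover have "x \<in> ?N" using x_eq Np[OF N(3)] by blast
  moreover have "\<exists>j::int. j \<noteq> 0 \<and> y powi j \<in> {m * b powi k | m k. m \<in> M}" if "y \<in> ?N" for y
  proof -
    from that obtain n i where y: "y = n * a powi i" "n \<in> N" by blast
    obtain j where j: "j \<noteq> 0" "n powi j \<in> M" using tors[OF y(2)] by blast
    have "y powi (j * k' * g) = (n powi j) powi (k' * g) * (a powi k') powi (i * j * g)"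
      unfolding y(1) pow by (simp only: mult_ac)
    also have "\<dots> = (n powi j) powi (k' * g) * (b powi (i * j * g) * (e powi g) powi (v * i * j))"
      unfolding b_eq pow by (simp only: mult_ac)
    also have "\<dots> = ((n powi j) powi (k' * g) * m powi (v * i * j)) * b powi (i * j * g)"
      unfolding eg by (simp only: mult_ac)
    finally have "y powi (j * k' * g) = ((n powi j) powi (k' * g) * m powi (v * i * j)) * b powi (i * j * g)" .
    moreover have "(n powi j) powi (k' * g) * m powi (v * i * j) \<in> M"
      by (rule Mm[OF Mp[OF j(2)] Mp[OF m(2)]])
    moreover have "j * k' * g \<noteq> 0" using j(1) \<open>k' \<noteq> 0\<close> \<open>g \<noteq> 0\<close> by simp
    ultimately show ?thesis by blast
  qed
  ultimately show ?case by blast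
qed

text \<open>
  Finitely generated torsion-free groups are free.
\<close>

lemma finite_subset_free_unit_group:
  assumes tf: "torsion_free TYPE('h)" and "finite E" "E \<subseteq> homogeneous_units"
  shows "\<exists>M. free_unit_group M \<and> E \<subseteq> M"
  using assms(2,3)
proof (induction E rule: finite_induct)
  case empty
  then show ?case using free_unit_group.base by blast
next
  case (insert x E)
  then obtain M where M: "free_unit_group M" "E \<subseteq> M" by blast
  show ?case
  proof (cases "\<exists>k::int. k \<noteq> 0 \<and> x powi k \<in> M")
    case True
    then obtain k :: int where k: "k \<noteq> 0" "x powi k \<in> M" by (elim exE conjE)
    have "x \<in> homogeneous_units" using insert.prems by simp
    from free_unit_group_torsion[OF tf M(1) this k]
    obtain N where "free_unit_group N" "M \<subseteq> N" "x \<in> N" by (elim exE conjE)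
    then show ?thesis using M(2) by (intro exI[of _ N]) simp
  next
    case False
    then have free: "x powi k \<notin> M" if "k \<noteq> 0" for k :: int using that by metis
    let ?N = "{m * x powi k | m k. m \<in> M}"
    have "free_unit_group ?N" using insert.prems by (intro free_unit_group.adjoin M(1) free) simp_all
    moreover have "1 \<in> M"
      using free_unit_group_unit_group[OF M(1)] piece_1 unfolding unit_group_def by auto
    then have "x \<in> ?N" by (intro CollectI exI[of _ 1] exI[of _ "1::int"]) simp
    moreover have "M \<subseteq> ?N" by (force intro: exI[of _ "0::int"])
    ultimately show ?thesis using M(2) by (intro exI[of _ ?N] conjI insert_subsetI) (simp_all only: subset_trans)
  qed
qed

end

context graded_field
begin

definition degrees :: "'k set \<Rightarrow> 'h set" where
  "degrees M = {\<alpha>. \<exists>u\<in>M. u \<in> P \<alpha>}"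

definition supported :: "'h set \<Rightarrow> 'k set" where
  "supported H = {x \<in> T. supp x \<subseteq> H}"

lemma
  assumes M: "unit_group M"
  shows degrees_0: "0 \<in> degrees M"
    and degrees_add: "\<alpha> \<in> degrees M \<Longrightarrow> \<beta> \<in> degrees M \<Longrightarrow> \<alpha> + \<beta> \<in> degrees M"
    and degrees_minus: "\<alpha> \<in> degrees M \<Longrightarrow> - \<alpha> \<in> degrees M"
proof -
  have "1 \<in> M" using M piece_1 unfolding unit_group_def by auto
  then show "0 \<in> degrees M" unfolding degrees_def using piece_1 by blast
  show "\<alpha> + \<beta> \<in> degrees M" if "\<alpha> \<in> degrees M" "\<beta> \<in> degrees M"
    using that M piece_mult unfolding degrees_def unit_group_def by blast
  show "- \<alpha> \<in> degrees M" if "\<alpha> \<in> degrees M"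
    using that M piece_inverse unfolding degrees_def unit_group_def by blast
qed

text \<open>
  Two nonzero elements of the same degree differ by a factor of degree \<open>0\<close>, which belongs to \<open>M\<close>.
\<close>

lemma unit_group_saturated:
  assumes M: "unit_group M" and x: "x \<in> P \<alpha>" "x \<noteq> 0" "\<alpha> \<in> degrees M"
  shows "x \<in> M"
proof -
  obtain u where u: "u \<in> M" "u \<in> P \<alpha>" using x(3) unfolding degrees_def by blast
  then have "u \<noteq> 0" using M homogeneous_units_nonzero unfolding unit_group_def by blast
  then have "x / u \<in> P 0 - {0}" using piece_divide[OF x(1) u(2)] x(2) by simp
  then have "x / u * u \<in> M" using M u(1) unfolding unit_group_def by blast
  then show ?thesis using \<open>u \<noteq> 0\<close> by simp
qed

lemma supported_piece: "x \<in> P \<alpha> \<Longrightarrow> \<alpha> \<in> H \<Longrightarrow> x \<in> supported H"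
  unfolding supported_def supp_def using T_piece comp_homogeneous by auto

lemma unit_group_supported:
  assumes M: "unit_group M" and y: "y \<in> M"
  shows "y \<in> supported (degrees M)"
proof -
  have "y \<in> homogeneous_units" using y M by (auto simp: unit_group_def)
  then obtain \<alpha> where \<alpha>: "y \<in> P \<alpha>" by (auto simp: homogeneous_units_def)
  then have "\<alpha> \<in> degrees M" using y by (auto simp: degrees_def)
  with \<alpha> show ?thesis by (rule supported_piece)
qed

lemma field_subring_supported:
  assumes H: "0 \<in> H" "\<And>\<alpha> \<beta>. \<alpha> \<in> H \<Longrightarrow> \<beta> \<in> H \<Longrightarrow> \<alpha> + \<beta> \<in> H"
  shows "field_subring (supported H)"
  unfolding field_subring_def
proof (intro conjI ballI)
  show "1 \<in> supported H" using supported_piece[OF piece_1 H(1)] .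
  fix x y assume xy: "x \<in> supported H" "y \<in> supported H"
  then have T: "x \<in> T" "y \<in> T" and s: "supp x \<subseteq> H" "supp y \<subseteq> H" unfolding supported_def by auto
  have "supp (x - y) \<subseteq> supp x \<union> supp y" using comp_diff[OF T] by (auto simp: supp_def)
  then show "x - y \<in> supported H" using T_diff[OF T] s unfolding supported_def by blast
  have "supp (x * y) \<subseteq> H"
  proof
    fix \<delta> assume "\<delta> \<in> supp (x * y)"
    then obtain \<alpha> \<beta> where "\<alpha> \<in> supp x" "\<beta> \<in> supp y" "\<delta> = \<alpha> + \<beta>" by (rule supp_mult[OF T])
    then show "\<delta> \<in> H" using s H(2)[of \<alpha> \<beta>] by auto
  qed
  then show "x * y \<in> supported H" using field_subring_mult[OF field_subring_T T] unfolding supported_def by blast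
qed

lemma field_subring_supported_degrees:
  "unit_group M \<Longrightarrow> field_subring (supported (degrees M))"
  by (rule field_subring_supported) (rule degrees_0 degrees_add, assumption+)+

text \<open>
  The degrees of the powers of \<open>x\<close> lie in distinct cosets of the degrees of \<open>M\<close>, so the summands of a
  polynomial in \<open>x\<close> have no degree in common.
\<close>

lemma transcendental_over_supported:
  assumes M: "unit_group M" and x: "x \<in> homogeneous_units" and free: "\<And>k::int. k \<noteq> 0 \<Longrightarrow> x powi k \<notin> M"
    and p: "p \<in> polys_over (supported (degrees M))" "poly p x = 0"
  shows "p = 0"
proof (rule ccontr)
  assume "p \<noteq> 0"
  define n where "n = degree p"
  have "coeff p n \<noteq> 0" using \<open>p \<noteq> 0\<close> by (simp add: n_def)
  have cT: "coeff p i \<in> T" and cs: "supp (coeff p i) \<subseteq> degrees M" for i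
    using p(1) unfolding polys_over_def supported_def by auto
  have x0: "x \<noteq> 0" and xT: "x ^ i \<in> T" and xu: "x ^ i \<in> homogeneous_units" for i
    using x homogeneous_units_nonzero homogeneous_units_T homogeneous_units_power by blast+
  have tT: "coeff p i * x ^ i \<in> T" for i by (rule T_simps(4)[OF cT xT])
  \<comment> \<open>Each degree of the \<open>i\<close>-th summand lies in the coset of \<open>x ^ i\<close>.\<close>
  have inM: "\<exists>m\<in>M. m * x ^ i \<in> P \<alpha>" if \<alpha>: "\<alpha> \<in> supp (coeff p i * x ^ i)" for i \<alpha>
  proof -
    obtain \<delta> where \<delta>: "x ^ i \<in> P \<delta>" using xu unfolding homogeneous_units_def by blast
    obtain \<beta> \<gamma> where *: "\<beta> \<in> supp (coeff p i)" "\<gamma> \<in> supp (x ^ i)" "\<alpha> = \<beta> + \<gamma>"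
      by (rule supp_mult[OF cT xT \<alpha>])
    have "\<gamma> = \<delta>" using *(2) comp_homogeneous[OF \<delta>] by (auto simp: supp_def split: if_splits)
    obtain u where "u \<in> M" "u \<in> P \<beta>" using *(1) cs unfolding degrees_def by blast
    then show ?thesis using piece_mult[OF _ \<delta>, of u \<beta>] *(3) \<open>\<gamma> = \<delta>\<close> by blast
  qed
  have "coeff p n * x ^ n \<noteq> 0" using \<open>coeff p n \<noteq> 0\<close> x0 by simp
  then obtain \<alpha> where \<alpha>: "\<alpha> \<in> supp (coeff p n * x ^ n)" using supp_empty_iff[OF tT] by blast
  have zero: "comp (coeff p i * x ^ i) \<alpha> = 0" if "i \<noteq> n" for i
  proof (rule ccontr)
    assume "comp (coeff p i * x ^ i) \<alpha> \<noteq> 0"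
    then obtain m where m: "m \<in> M" "m * x ^ i \<in> P \<alpha>" using inM[of \<alpha> i] by (auto simp: supp_def)
    obtain m' where m': "m' \<in> M" "m' * x ^ n \<in> P \<alpha>" using inM[OF \<alpha>] by blast
    have nz: "m \<noteq> 0" "m' \<noteq> 0" using m m' M homogeneous_units_nonzero unfolding unit_group_def by blast+
    then have "(m * x ^ i) / (m' * x ^ n) \<in> P 0 - {0}"
      using piece_divide[OF m(2) m'(2)] x0 by simp
    then have "(m * x ^ i) / (m' * x ^ n) \<in> M" using M unfolding unit_group_def by blast
    then have "(m * x ^ i) / (m' * x ^ n) * (m' * inverse m) \<in> M"
      using M m m' unfolding unit_group_def by blast
    also have "(m * x ^ i) / (m' * x ^ n) * (m' * inverse m) = x ^ i / x ^ n"
      using nz x0 by (simp add: field_simps)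
    also have "\<dots> = x powi (int i - int n)" using x0 by (simp add: power_int_diff)
    finally show False using free[of "int i - int n"] that by simp
  qed
  have "0 = comp (poly p x) \<alpha>" by (simp add: p(2) comp_0)
  also have "\<dots> = (\<Sum>i\<le>n. comp (coeff p i * x ^ i) \<alpha>)"
    unfolding poly_altdef n_def by (rule comp_sum[OF tT])
  also have "\<dots> = comp (coeff p n * x ^ n) \<alpha>"
    using zero by (subst sum.remove[of _ n]) (auto intro!: sum.neutral)
  finally show False using \<alpha> by (simp add: supp_def)
qed

lemma supported_adjoin:
  assumes M: "unit_group M" and x: "x \<in> homogeneous_units"
    and N: "unit_group N" "N = {m * x powi k | m k. m \<in> M}"
  shows "supported (degrees N) = {y. \<exists>n. x ^ n * y \<in> (\<lambda>p. poly p x) ` polys_over (supported (degrees M))}"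
    (is "?L = {y. \<exists>n. x ^ n * y \<in> ?B}")
proof (intro equalityI subsetI)
  let ?A = "supported (degrees M)"
  note A = field_subring_supported_degrees[OF M]
  note L = field_subring_supported_degrees[OF N(1)]
  have x0: "x \<noteq> 0" using x homogeneous_units_nonzero by blast
  have "1 \<in> M" using M piece_1 unfolding unit_group_def by auto
  then have "x \<in> N" unfolding N(2) by (intro CollectI exI[of _ 1] exI[of _ "1::int"]) simp
  have sub: "M \<subseteq> N" unfolding N(2) by (force intro: exI[of _ "0::int"])
  note NL = unit_group_supported[OF N(1)]
  have AL: "?A \<subseteq> ?L" using sub unfolding supported_def degrees_def by blast
  show "y \<in> ?L" if "y \<in> {y. \<exists>n. x ^ n * y \<in> ?B}" for y
  proof -
    from that obtain n p where p: "p \<in> polys_over ?A" "x ^ n * y = poly p x" by blast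
    have "p \<in> polys_over ?L" using p(1) AL unfolding polys_over_def by blast
    then have "x ^ n * y \<in> ?L" using polys_over_eval[OF L NL[OF \<open>x \<in> N\<close>]] p(2) by simp
    moreover have "inverse x \<in> N" using N(1) \<open>x \<in> N\<close> unfolding unit_group_def by blast
    then have "inverse x ^ n \<in> ?L" by (intro field_subring_power L NL)
    ultimately have "inverse x ^ n * (x ^ n * y) \<in> ?L" using field_subring_mult[OF L] by blast
    then show ?thesis using x0 by (simp add: power_inverse)
  qed
  have B: "field_subring ?B" by (rule field_subring_adjoin[OF A])
  have xB: "x \<in> ?B" by (rule mem_adjoin[OF A])
  let ?S = "{y. \<exists>n. x ^ n * y \<in> ?B}"
  have add: "y + z \<in> ?S" if yz: "y \<in> ?S" "z \<in> ?S" for y z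
  proof -
    from yz obtain k l where k: "x ^ k * y \<in> ?B" and l: "x ^ l * z \<in> ?B" by auto
    have "x ^ l * (x ^ k * y) + x ^ k * (x ^ l * z) \<in> ?B"
      by (intro field_subring_add[OF B] field_subring_mult[OF B] field_subring_power[OF B] xB k l)
    moreover have "x ^ (k + l) * (y + z) = x ^ l * (x ^ k * y) + x ^ k * (x ^ l * z)"
      unfolding power_add by algebra
    ultimately have "x ^ (k + l) * (y + z) \<in> ?B" by (simp only:)
    then show ?thesis by (intro CollectI exI)
  qed
  have "0 \<in> ?S" using field_subring_0[OF B] by (intro CollectI exI[of _ 0]) (simp only: mult_zero_right)
  then have sum: "sum f J \<in> ?S" if "\<And>i. i \<in> J \<Longrightarrow> f i \<in> ?S" for f and J :: "'h set"
    using that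
  proof (induction J rule: infinite_finite_induct)
    case (insert j J)
    then have "f j + sum f J \<in> ?S" by (intro add) simp_all
    then show ?case unfolding sum.insert[OF insert.hyps] .
  qed (simp_all only: sum.infinite sum.empty not_False_eq_True)
  show "y \<in> ?S" if y: "y \<in> ?L" for y
  proof -
    have yT: "y \<in> T" and ys: "supp y \<subseteq> degrees N" using y unfolding supported_def by auto
    have "comp y \<alpha> \<in> ?S" if \<alpha>: "\<alpha> \<in> supp y" for \<alpha>
    proof -
      have "comp y \<alpha> \<in> N"
        using \<alpha> ys comp_piece[OF yT] by (intro unit_group_saturated[OF N(1)]) (auto simp: supp_def)
      then obtain m k where mk: "comp y \<alpha> = m * x powi k" "m \<in> M" unfolding N(2) by blast
      have "m \<in> ?A" by (rule unit_group_supported[OF M mk(2)])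
      then have mB: "m \<in> ?B" using subset_adjoin[OF A] by blast
      have "x ^ nat (- k) * x powi k = x ^ nat k"
        using x0 by (cases "k \<ge> 0") (simp_all add: power_int_def flip: power_mult_distrib)
      then have "x ^ nat (- k) * comp y \<alpha> = m * x ^ nat k" unfolding mk(1) by (simp only: mult.left_commute)
      also have "\<dots> \<in> ?B" by (intro field_subring_mult[OF B] field_subring_power[OF B] xB mB)
      finally show ?thesis by (intro CollectI exI)
    qed
    then have "(\<Sum>\<alpha>\<in>supp y. comp y \<alpha>) \<in> ?S" by (rule sum)
    then show ?thesis by (simp only: sum_comp[OF yT])
  qed
qed

text \<open>
  The ring is an iterated ring of Laurent polynomials over the field of elements of degree \<open>0\<close>.
\<close>

lemma lcm_subring_free_unit_group:
  "free_unit_group M \<Longrightarrow> lcm_subring (supported (degrees M))"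
proof (induction rule: free_unit_group.induct)
  case base
  let ?A = "supported (degrees (P 0 - {0}))"
  have "degrees (P 0 - {0}) \<subseteq> {0}" unfolding degrees_def using degree_unique by blast
  then have AP: "x \<in> P 0" if "x \<in> ?A" for x
  proof -
    have xT: "x \<in> T" and s: "supp x \<subseteq> {0}" using that \<open>degrees _ \<subseteq> {0}\<close> unfolding supported_def by auto
    have "x = (\<Sum>\<alpha>\<in>{0}. comp x \<alpha>)" using sum_comp_superset[OF xT _ s] by simp
    then show ?thesis using comp_piece[OF xT, of 0] by simp
  qed
  note A = field_subring_supported_degrees[OF free_unit_group_unit_group[OF free_unit_group.base]]
  have "0 \<in> degrees (P 0 - {0})" using degrees_0[OF free_unit_group_unit_group[OF free_unit_group.base]] .
  then have PA: "x \<in> ?A" if "x \<in> P 0" for x using supported_piece[OF that] by blast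
  have div: "y / p \<in> ?A \<longleftrightarrow> y / 1 \<in> ?A" if p: "p \<in> ?A" "p \<noteq> 0" for y p
  proof -
    have "inverse p \<in> ?A" using PA piece_inverse[OF AP[OF p(1)]] by simp
    then have "y \<in> ?A \<Longrightarrow> y * inverse p \<in> ?A" using field_subring_mult[OF A] by blast
    moreover have "y / p \<in> ?A \<Longrightarrow> y / p * p \<in> ?A" using field_subring_mult[OF A] p(1) by blast
    ultimately show ?thesis using p(2) by (auto simp: divide_inverse mult.assoc)
  qed
  show ?case
    unfolding lcm_subring_def
    using div field_subring_1[OF A] by (intro ballI impI bexI[of _ 1]) simp_all
next
  case (adjoin M x)
  note M = free_unit_group_unit_group[OF adjoin(1)]
  note N = free_unit_group_unit_group[OF free_unit_group.adjoin[OF adjoin(1-3)]]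
  note A = field_subring_supported_degrees[OF M]
  let ?B = "(\<lambda>p. poly p x) ` polys_over (supported (degrees M))"
  have "lcm_subring {y. \<exists>n. x ^ n * y \<in> ?B}"
  proof (rule lcm_subring_localization)
    show "field_subring ?B"
      by (rule field_subring_adjoin[OF A])
    show "lcm_subring ?B"
      by (rule lcm_subring_adjoin[OF A adjoin(4)])
        (rule transcendental_over_supported[OF M adjoin(2,3)])
    show "x \<in> ?B" by (rule mem_adjoin[OF A])
    show "x \<noteq> 0" using adjoin(2) homogeneous_units_nonzero by blast
  qed
  moreover have "supported (degrees {m * x powi k | m k. m \<in> M}) = {y. \<exists>n. x ^ n * y \<in> ?B}"
    by (rule supported_adjoin[OF M adjoin(2) N refl])
  ultimately show ?case by (simp only:)
qed

definition restrict :: "'h set \<Rightarrow> 'k \<Rightarrow> 'k" where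
  "restrict Z x = (\<Sum>\<alpha>\<in>supp x \<inter> Z. comp x \<alpha>)"

lemma
  assumes "x \<in> T"
  shows T_restrict: "restrict Z x \<in> T"
    and comp_restrict: "comp (restrict Z x) = (\<lambda>\<alpha>. if \<alpha> \<in> Z then comp x \<alpha> else 0)"
proof -
  have 1: "(if \<alpha> \<in> Z then comp x \<alpha> else 0) \<in> P \<alpha>" for \<alpha>
    using comp_piece[OF assms] piece_0 by simp
  have 2: "finite (supp x \<inter> Z)" using finite_supp[OF assms] by simp
  have 3: "(if \<alpha> \<in> Z then comp x \<alpha> else 0) = 0" if "\<alpha> \<notin> supp x \<inter> Z" for \<alpha>
    using that by (auto simp: supp_def)
  have 4: "restrict Z x = (\<Sum>\<alpha>\<in>supp x \<inter> Z. if \<alpha> \<in> Z then comp x \<alpha> else 0)"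
    unfolding restrict_def by (intro sum.cong) auto
  show "restrict Z x \<in> T" by (rule T_sumI[OF 1 2 3 4])
  show "comp (restrict Z x) = (\<lambda>\<alpha>. if \<alpha> \<in> Z then comp x \<alpha> else 0)" by (rule comp_sumI[OF 1 2 3 4])
qed

text \<open>
  For a union \<open>Z\<close> of cosets of \<open>H\<close>, restriction to \<open>Z\<close> is linear over the subring supported on \<open>H\<close>.
\<close>

lemma restrict_mult:
  assumes p: "p \<in> supported H" and x: "x \<in> T" and Z: "\<And>\<alpha> \<beta>. \<alpha> \<in> H \<Longrightarrow> \<alpha> + \<beta> \<in> Z \<longleftrightarrow> \<beta> \<in> Z"
  shows "restrict Z (p * x) = p * restrict Z x"
proof (rule comp_inject)
  have pT: "p \<in> T" and ps: "supp p \<subseteq> H" using p unfolding supported_def by auto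
  have px: "p * x \<in> T" "p * restrict Z x \<in> T" "x - restrict Z x \<in> T" "p * (x - restrict Z x) \<in> T"
    using pT x T_restrict[OF x] T_simps(3,4) by simp_all
  show "restrict Z (p * x) \<in> T" "p * restrict Z x \<in> T" using px T_restrict by auto
  fix \<alpha>
  have "p * x = p * restrict Z x + p * (x - restrict Z x)" by (simp add: algebra_simps)
  then have eq: "comp (p * x) \<alpha> = comp (p * restrict Z x) \<alpha> + comp (p * (x - restrict Z x)) \<alpha>"
    using comp_add[OF px(2,4)] by simp
  show "comp (restrict Z (p * x)) \<alpha> = comp (p * restrict Z x) \<alpha>"
  proof (cases "\<alpha> \<in> Z")
    case True
    have "\<alpha> \<notin> supp (p * (x - restrict Z x))"
    proof
      assume "\<alpha> \<in> supp (p * (x - restrict Z x))"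
      then obtain \<beta> \<gamma> where *: "\<beta> \<in> supp p" "\<gamma> \<in> supp (x - restrict Z x)" "\<alpha> = \<beta> + \<gamma>"
        by (rule supp_mult[OF pT px(3)])
      then have "\<gamma> \<notin> Z" using comp_diff[OF x T_restrict[OF x]] comp_restrict[OF x] by (auto simp: supp_def)
      then show False using Z[of \<beta> \<gamma>] * ps True by blast
    qed
    then show ?thesis using eq comp_restrict[OF px(1)] True by (simp add: supp_def)
  next
    case False
    have "\<alpha> \<notin> supp (p * restrict Z x)"
    proof
      assume "\<alpha> \<in> supp (p * restrict Z x)"
      then obtain \<beta> \<gamma> where *: "\<beta> \<in> supp p" "\<gamma> \<in> supp (restrict Z x)" "\<alpha> = \<beta> + \<gamma>"
        by (rule supp_mult[OF pT T_restrict[OF x]])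
      then have "\<gamma> \<in> Z" using comp_restrict[OF x] by (auto simp: supp_def split: if_splits)
      then show False using Z[of \<beta> \<gamma>] * ps False by blast
    qed
    then show ?thesis using comp_restrict[OF px(1)] False by (simp add: supp_def)
  qed
qed

text \<open>
  \<open>T\<close> is the direct sum of the translates of \<open>supported H\<close> by units, one for each coset of \<open>H\<close>.
  Hence common multiples in \<open>T\<close> of two elements of \<open>supported H\<close> may be treated coset by coset.
\<close>

lemma lcm_subring_T:
  assumes tf: "torsion_free TYPE('h)"
  shows "lcm_subring T"
  unfolding lcm_subring_def
proof (intro ballI impI)
  fix p q assume pT: "p \<in> T" and qT: "q \<in> T" and nz: "p \<noteq> 0" "q \<noteq> 0"
  define E where "E = comp p ` supp p \<union> comp q ` supp q"
  have "E \<subseteq> homogeneous_units"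
    using comp_piece[OF pT] comp_piece[OF qT] by (auto simp: E_def homogeneous_units_def supp_def)
  moreover have "finite E" using finite_supp pT qT by (simp add: E_def)
  ultimately obtain M where M: "free_unit_group M" "E \<subseteq> M" using finite_subset_free_unit_group[OF tf] by blast
  note UM = free_unit_group_unit_group[OF M(1)]
  define H where "H = degrees M"
  define A where "A = supported H"
  have A: "field_subring A" "lcm_subring A"
    unfolding A_def H_def using field_subring_supported_degrees[OF UM] lcm_subring_free_unit_group[OF M(1)] by auto
  have AT: "A \<subseteq> T" unfolding A_def supported_def by blast
  have "supp p \<subseteq> H" "supp q \<subseteq> H"
    using M(2) comp_piece[OF pT] comp_piece[OF qT] unfolding E_def H_def degrees_def by blast+
  then have pA: "p \<in> A" "q \<in> A" using pT qT unfolding A_def supported_def by auto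
  obtain m where m: "m \<in> A" "m \<noteq> 0" "\<And>y. y / p \<in> A \<and> y / q \<in> A \<longleftrightarrow> y / m \<in> A"
    using A(2) pA nz unfolding lcm_subring_def by blast
  have common: "p * r / m \<in> T" if "r \<in> T" "s \<in> T" "p * r = q * s" for r s
    using that
  proof (induction "card (supp r)" arbitrary: r s rule: less_induct)
    case less
    show ?case
    proof (cases "r = 0")
      case True
      then show ?thesis using T_simps(2) by simp
    next
      case False
      then obtain \<alpha> where \<alpha>: "\<alpha> \<in> supp r" using supp_empty_iff[OF less.prems(1)] by blast
      define u where "u = comp r \<alpha>"
      have u: "u \<in> P \<alpha>" "u \<noteq> 0" using comp_piece[OF less.prems(1)] \<alpha> by (auto simp: u_def supp_def)
      define Z where "Z = {\<beta>. \<beta> - \<alpha> \<in> H}"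
      have Z: "\<beta> + \<gamma> \<in> Z \<longleftrightarrow> \<gamma> \<in> Z" if "\<beta> \<in> H" for \<beta> \<gamma>
      proof -
        have "(\<gamma> - \<alpha>) + \<beta> \<in> H" if "\<gamma> - \<alpha> \<in> H"
          using degrees_add[OF UM] that \<open>\<beta> \<in> H\<close> unfolding H_def by blast
        moreover have "(\<beta> + \<gamma> - \<alpha>) + - \<beta> \<in> H" if "\<beta> + \<gamma> - \<alpha> \<in> H"
          using degrees_add[OF UM that[unfolded H_def] degrees_minus[OF UM \<open>\<beta> \<in> H\<close>[unfolded H_def]]]
          unfolding H_def .
        ultimately show ?thesis unfolding Z_def by (auto simp: algebra_simps)
      qed
      have part: "inverse u * restrict Z t \<in> A" if "t \<in> T" for t
      proof -
        have T': "inverse u * restrict Z t \<in> T"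
          by (rule T_simps(4)[OF T_piece[OF piece_inverse[OF u(1)]] T_restrict[OF that]])
        moreover have "supp (inverse u * restrict Z t) \<subseteq> H"
        proof
          fix \<beta> assume "\<beta> \<in> supp (inverse u * restrict Z t)"
          then have "\<beta> + \<alpha> \<in> supp (restrict Z t)"
            using comp_shift[OF piece_inverse[OF u(1)] T_restrict[OF that], of Z \<beta>] by (auto simp: supp_def)
          then have "\<beta> + \<alpha> \<in> Z" using comp_restrict[OF that] by (auto simp: supp_def split: if_splits)
          then show "\<beta> \<in> H" by (simp add: Z_def)
        qed
        ultimately show ?thesis unfolding A_def supported_def by blast
      qed
      let ?r = "restrict Z r" and ?s = "restrict Z s"
      have eq: "p * ?r = q * ?s"
        using restrict_mult[OF pA(1)[unfolded A_def] less.prems(1) Z]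
          restrict_mult[OF pA(2)[unfolded A_def] less.prems(2) Z] less.prems(3) by simp
      have "inverse u * (p * ?r) / p = inverse u * ?r" using nz by simp
      moreover have "inverse u * (p * ?r) / q = inverse u * ?s" unfolding eq using nz by simp
      ultimately have "inverse u * (p * ?r) / m \<in> A"
        using part less.prems(1,2) m(3) by (metis)
      then have "u * (inverse u * (p * ?r) / m) \<in> T"
        using AT T_piece[OF u(1)] field_subring_mult[OF field_subring_T] by blast
      then have 1: "p * ?r / m \<in> T" using u(2) by (simp add: mult.assoc[symmetric])
      have rT: "r - ?r \<in> T" "s - ?s \<in> T"
        using less.prems T_restrict by (auto intro: T_diff)
      have comp': "comp (r - ?r) = (\<lambda>\<beta>. if \<beta> \<in> Z then 0 else comp r \<beta>)"
        using comp_diff[OF less.prems(1) T_restrict[OF less.prems(1)]] comp_restrict[OF less.prems(1)] by auto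
      have "\<alpha> \<in> Z" unfolding Z_def H_def using degrees_0[OF UM] by simp
      then have "supp (r - ?r) \<subset> supp r" using \<alpha> by (auto simp: supp_def comp' split: if_splits)
      then have "card (supp (r - ?r)) < card (supp r)" by (intro psubset_card_mono finite_supp less.prems)
      moreover have "p * (r - ?r) = q * (s - ?s)" using eq less.prems(3) by (simp add: right_diff_distrib)
      ultimately have 2: "p * (r - ?r) / m \<in> T" by (rule less.hyps[OF _ rT])
      have "p * r / m = p * ?r / m + p * (r - ?r) / m"
        by (simp add: right_diff_distrib diff_divide_distrib)
      then show ?thesis using field_subring_add[OF field_subring_T 1 2] by simp
    qed
  qed
  have "m / m \<in> A" using m(2) field_subring_1[OF A(1)] by simp
  then have mpq: "m / p \<in> T" "m / q \<in> T" using m(3) AT by blast+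
  show "\<exists>m\<in>T. m \<noteq> 0 \<and> (\<forall>y. y / p \<in> T \<and> y / q \<in> T \<longleftrightarrow> y / m \<in> T)"
  proof (intro bexI[of _ m] conjI allI iffI)
    show "m \<in> T" "m \<noteq> 0" using m AT by auto
    fix y assume y: "y / m \<in> T"
    have "y / m * (m / p) = y / p" "y / m * (m / q) = y / q" using m(2) by simp_all
    then show "y / p \<in> T" "y / q \<in> T"
      using field_subring_mult[OF field_subring_T y mpq(1)] field_subring_mult[OF field_subring_T y mpq(2)]
      by (simp_all only:)
  next
    fix y assume y: "y / p \<in> T \<and> y / q \<in> T"
    have "p * (y / p) / m \<in> T" by (rule common[of _ "y / q"]) (use y nz in simp_all)
    then show "y / m \<in> T" using nz by simp
  qed
qed

end

section \<open>The homogeneous quotient ring of a graded domain\<close>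

lemma to_quot_group_add: "to_quot_group (\<alpha> + \<beta>) = to_quot_group \<alpha> + to_quot_group \<beta>"
  by transfer (auto simp: quot_rel_def)

lemma to_quot_group_0: "to_quot_group 0 = 0"
  by transfer (auto simp: quot_rel_def)

lemma to_quot_group_inject:
  fixes \<alpha> \<beta> :: "'g::comm_monoid_add"
  assumes "torsionless_grading_monoid TYPE('g)"
  shows "to_quot_group \<alpha> = to_quot_group \<beta> \<longleftrightarrow> \<alpha> = \<beta>"
proof
  have cancel: "b = c" if "a + b = a + c" for a b c :: 'g
    using assms that unfolding torsionless_grading_monoid_def by blast
  assume "to_quot_group \<alpha> = to_quot_group \<beta>"
  then have "quot_rel (\<alpha>, 0) (\<beta>, 0)" by transfer
  then show "\<alpha> = \<beta>" unfolding quot_rel_def using cancel by (auto simp: add.commute)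
qed simp

lemma field_subring_range_to_fract: "field_subring (range to_fract)"
  unfolding field_subring_def
proof (intro conjI ballI)
  show "1 \<in> range to_fract" by (rule range_eqI[of _ _ 1]) simp
  fix x y :: "'a fract" assume "x \<in> range to_fract" "y \<in> range to_fract"
  then obtain a b where "x = to_fract a" "y = to_fract b" by blast
  then have "x - y = to_fract (a - b)" "x * y = to_fract (a * b)" by simp_all
  then show "x - y \<in> range to_fract" "x * y \<in> range to_fract" by blast+
qed

lemma integral_over_iff_integral_elem:
  "integral_over (range to_fract) (z :: 'a::idom fract) \<longleftrightarrow> integral_elem z"
proof
  assume "integral_over (range to_fract) z"
  then obtain p where p: "lead_coeff p = 1" "\<And>i. coeff p i \<in> range to_fract" "poly p z = 0"
    unfolding integral_over_def by blast
  define q where "q = map_poly (inv_into UNIV to_fract) p"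
  have inj: "inj (to_fract :: 'a \<Rightarrow> _)" by (rule injI) simp
  have inv: "inv_into UNIV to_fract (to_fract a) = a" for a :: 'a using inj by (rule inv_f_f)
  have "map_poly to_fract q = p"
  proof (rule poly_eqI)
    fix i
    obtain a where "coeff p i = to_fract a" using p(2) by blast
    then show "coeff (map_poly to_fract q) i = coeff p i"
      using inv[of 0] inv[of a] by (simp add: q_def coeff_map_poly)
  qed
  moreover have "lead_coeff q = 1"
  proof -
    have "degree q = degree p" unfolding \<open>map_poly to_fract q = p\<close>[symmetric]
      by (rule sym, rule degree_map_poly) simp
    then show ?thesis using p(1) inv[of 0] inv[of 1] by (simp add: q_def coeff_map_poly)
  qed
  ultimately show "integral_elem z" unfolding integral_elem_def using p(3) by blast
next
  assume "integral_elem z"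
  then obtain p where p: "lead_coeff p = (1::'a)" "poly (map_poly to_fract p) z = 0"
    unfolding integral_elem_def by blast
  have "degree (map_poly to_fract p) = degree p" by (rule degree_map_poly) simp
  then have "lead_coeff (map_poly to_fract p) = 1" using p(1) by (simp add: coeff_map_poly)
  moreover have "\<forall>i. coeff (map_poly to_fract p) i \<in> range to_fract" by (simp add: coeff_map_poly)
  ultimately show "integral_over (range to_fract) z" unfolding integral_over_def using p(2) by blast
qed

locale torsionless_graded_domain =
  fixes D :: "'g::comm_monoid_add \<Rightarrow> 'a::idom set"
  assumes torsionless: "torsionless_grading_monoid TYPE('g)"
    and graded: "graded_domain D"
begin

abbreviation "R \<equiv> range (to_fract :: 'a \<Rightarrow> 'a fract)"

abbreviation "S \<equiv> nonzero_homogeneous D"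

lemmas R_ring = field_subring_range_to_fract[where 'a = 'a]

lemma D_0: "0 \<in> D \<alpha>" and D_diff: "x \<in> D \<alpha> \<Longrightarrow> y \<in> D \<alpha> \<Longrightarrow> x - y \<in> D \<alpha>"
  and D_mult: "x \<in> D \<alpha> \<Longrightarrow> y \<in> D \<beta> \<Longrightarrow> x * y \<in> D (\<alpha> + \<beta>)"
  and D_decomposition: "\<exists>!f. decomposes D x f"
  using graded unfolding graded_domain_def by blast+

lemma torsion_free_degrees: "torsion_free TYPE('g quot_group)"
  using torsionless unfolding torsionless_grading_monoid_def by blast

lemma cancel_degree: "\<alpha> + \<beta> = \<alpha> + \<gamma> \<Longrightarrow> \<beta> = \<gamma>" for \<alpha> \<beta> \<gamma> :: 'g
  using torsionless unfolding torsionless_grading_monoid_def by blast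

lemmas to_quot_inject = to_quot_group_inject[OF torsionless]

lemma decomposes_sum:
  assumes "finite A" "inj_on b A" "\<And>i. i \<in> A \<Longrightarrow> t i \<in> D (b i)"
  obtains f where "decomposes D (sum t A) f" "\<And>i. i \<in> A \<Longrightarrow> f (b i) = t i"
proof -
  define f where "f \<gamma> = (if \<gamma> \<in> b ` A then t (inv_into A b \<gamma>) else 0)" for \<gamma>
  have f: "f (b i) = t i" if "i \<in> A" for i using that assms(2) by (simp add: f_def)
  have "f \<gamma> \<in> D \<gamma>" for \<gamma>
    using assms(3) f D_0 by (cases "\<gamma> \<in> b ` A") (auto, simp add: f_def)
  moreover have sub: "{\<gamma>. f \<gamma> \<noteq> 0} \<subseteq> b ` A" by (auto simp: f_def)
  moreover have "finite {\<gamma>. f \<gamma> \<noteq> 0}" using sub assms(1) by (auto intro: finite_subset)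
  moreover have "sum t A = (\<Sum>\<gamma> | f \<gamma> \<noteq> 0. f \<gamma>)"
  proof -
    have "(\<Sum>\<gamma> | f \<gamma> \<noteq> 0. f \<gamma>) = (\<Sum>\<gamma>\<in>b ` A. f \<gamma>)"
      using sub assms(1) by (intro sum.mono_neutral_left) auto
    also have "\<dots> = sum t A" using assms(2) f by (simp add: sum.reindex)
    finally show ?thesis by simp
  qed
  ultimately show ?thesis using that[of f] f unfolding decomposes_def by blast
qed

lemma decomposes_0: "decomposes D 0 (\<lambda>_. 0)"
  using D_0 by (simp add: decomposes_def)

lemma D_independent:
  assumes "finite A" "inj_on b A" "\<And>i. i \<in> A \<Longrightarrow> t i \<in> D (b i)" "sum t A = 0" "i \<in> A"
  shows "t i = 0"
proof -
  obtain f where f: "decomposes D (sum t A) f" "\<And>i. i \<in> A \<Longrightarrow> f (b i) = t i"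
    using decomposes_sum[OF assms(1-3)] by blast
  then have "f = (\<lambda>_. 0)" using D_decomposition[of 0] decomposes_0 assms(4) by auto
  then show ?thesis using f(2)[OF assms(5)] by simp
qed

text \<open>The component \<open>e\<close> of degree \<open>0\<close> of \<open>1\<close> satisfies \<open>x e = x\<close> for homogeneous \<open>x\<close>.\<close>

lemma one_homogeneous: "1 \<in> D 0"
proof -
  obtain e where e: "decomposes D 1 e" using D_decomposition by blast
  have eD: "e \<alpha> \<in> D \<alpha>" and fin: "finite {\<alpha>. e \<alpha> \<noteq> 0}" and one: "1 = (\<Sum>\<alpha> | e \<alpha> \<noteq> 0. e \<alpha>)" for \<alpha>
    using e unfolding decomposes_def by auto
  have "\<exists>\<beta>. e \<beta> \<noteq> 0" using one by (metis (mono_tags, lifting) Collect_empty_eq sum.empty zero_neq_one)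
  then obtain \<beta> where \<beta>: "e \<beta> \<noteq> 0" by blast
  define A where "A = insert 0 {\<alpha>. e \<alpha> \<noteq> 0}"
  have A: "finite A" "0 \<in> A" using fin by (auto simp: A_def)
  have inj: "inj_on ((+) \<beta>) A" using cancel_degree by (auto intro: inj_onI)
  have t: "e \<beta> * e \<alpha> - (if \<alpha> = 0 then e \<beta> else 0) \<in> D (\<beta> + \<alpha>)" for \<alpha>
    using D_mult[OF eD eD, of \<beta> \<alpha>] eD[of \<beta>] by (auto intro: D_diff)
  have one': "(\<Sum>\<alpha>\<in>A. e \<alpha>) = 1"
    unfolding one using A by (intro sum.mono_neutral_right) (auto simp: A_def)
  have "(\<Sum>\<alpha>\<in>A. e \<beta> * e \<alpha> - (if \<alpha> = 0 then e \<beta> else 0)) = e \<beta> * (\<Sum>\<alpha>\<in>A. e \<alpha>) - e \<beta>"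
    using A by (simp add: sum_subtractf sum_distrib_left)
  also have "\<dots> = 0" unfolding one' by simp
  finally have "e \<beta> * e 0 - (if (0::'g) = 0 then e \<beta> else 0) = 0"
    using D_independent[OF A(1) inj t] A(2) by blast
  then have "e 0 = 1" using \<beta> by simp
  then show ?thesis using eD[of 0] by simp
qed

text \<open>
  Zero is added because \<^const>\<open>RS_piece\<close> is empty in a degree that is not the difference of some degree and
  the degree of a nonzero element.
\<close>

definition piece :: "'g quot_group \<Rightarrow> 'a fract set" where
  "piece \<alpha> = insert 0 (RS_piece D \<alpha>)"

lemma RS_pieceI:
  assumes "a \<in> D \<beta>" "b \<in> D \<gamma>" "b \<noteq> 0" "\<alpha> = to_quot_group \<beta> - to_quot_group \<gamma>"
    "x = to_fract a / to_fract b"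
  shows "x \<in> piece \<alpha>"
  using assms unfolding piece_def RS_piece_def by blast

lemma pieceE:
  assumes "x \<in> piece \<alpha>" "x \<noteq> 0"
  obtains a b \<beta> \<gamma> where "a \<in> D \<beta>" "b \<in> D \<gamma>" "a \<noteq> 0" "b \<noteq> 0"
    "\<alpha> = to_quot_group \<beta> - to_quot_group \<gamma>" "x = to_fract a / to_fract b"
proof -
  from assms have "x \<in> RS_piece D \<alpha>" unfolding piece_def by blast
  then obtain a b \<beta> \<gamma> where *: "a \<in> D \<beta>" "b \<in> D \<gamma>" "b \<noteq> 0" "\<alpha> = to_quot_group \<beta> - to_quot_group \<gamma>"
    "x = to_fract a / to_fract b" unfolding RS_piece_def by blast
  with assms(2) have "a \<noteq> 0" by auto
  with * that show ?thesis by blast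
qed

lemma S_mult: "s \<in> S \<Longrightarrow> s' \<in> S \<Longrightarrow> s * s' \<in> S"
  unfolding nonzero_homogeneous_def using D_mult by fastforce

lemma S_1: "1 \<in> S"
  unfolding nonzero_homogeneous_def using one_homogeneous by auto

lemma common_denominator:
  assumes "finite X" "\<And>x. x \<in> X \<Longrightarrow> \<exists>s\<in>S. to_fract s * x \<in> R"
  shows "\<exists>s\<in>S. \<forall>x\<in>X. to_fract s * x \<in> R"
  using assms
proof (induction X rule: finite_induct)
  case empty
  then show ?case using S_1 by blast
next
  case (insert x X)
  then obtain s where s: "s \<in> S" "\<forall>x\<in>X. to_fract s * x \<in> R" by auto
  obtain r where r: "r \<in> S" "to_fract r * x \<in> R" using insert.prems by blast
  have eq: "to_fract (r * s) * y = to_fract r * (to_fract s * y)"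
    "to_fract (r * s) * y = to_fract s * (to_fract r * y)" for y
    by (simp_all only: to_fract_mult mult_ac)
  have "to_fract (r * s) * y \<in> R" if "y \<in> insert x X" for y
  proof (cases "y = x")
    case True
    then show ?thesis unfolding eq(2) using r(2) field_subring_mult[OF R_ring] by blast
  next
    case False
    then show ?thesis unfolding eq(1) using that s(2) field_subring_mult[OF R_ring] by blast
  qed
  then show ?case using S_mult[OF r(1) s(1)] by blast
qed

lemma piece_diff_closed:
  assumes "x \<in> piece \<alpha>" "y \<in> piece \<alpha>" shows "x - y \<in> piece \<alpha>"
proof -
  have minus: "- y \<in> piece \<alpha>" if y: "y \<in> piece \<alpha>" for y
  proof (cases "y = 0")
    case False
    then obtain a b \<beta> \<gamma> where *: "a \<in> D \<beta>" "b \<in> D \<gamma>" "a \<noteq> 0" "b \<noteq> 0"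
      "\<alpha> = to_quot_group \<beta> - to_quot_group \<gamma>" "y = to_fract a / to_fract b" by (rule pieceE[OF y])
    then have "0 - a \<in> D \<beta>" by (intro D_diff D_0)
    then show ?thesis by (rule RS_pieceI[OF _ *(2,4,5)]) (simp add: *(6))
  qed (use y in simp)
  show ?thesis
  proof (cases "x = 0 \<or> y = 0")
    case True
    then show ?thesis using assms minus by auto
  next
    case False
    then have nz: "x \<noteq> 0" "y \<noteq> 0" by simp_all
    obtain a b \<beta> \<gamma> where x: "a \<in> D \<beta>" "b \<in> D \<gamma>" "a \<noteq> 0" "b \<noteq> 0"
      "\<alpha> = to_quot_group \<beta> - to_quot_group \<gamma>" "x = to_fract a / to_fract b"
      by (rule pieceE[OF assms(1) nz(1)])
    obtain c d \<delta> \<epsilon> where y: "c \<in> D \<delta>" "d \<in> D \<epsilon>" "c \<noteq> 0" "d \<noteq> 0"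
      "\<alpha> = to_quot_group \<delta> - to_quot_group \<epsilon>" "y = to_fract c / to_fract d"
      by (rule pieceE[OF assms(2) nz(2)])
    have "to_quot_group (\<beta> + \<epsilon>) = to_quot_group (\<gamma> + \<delta>)"
      using x(5) y(5) unfolding to_quot_group_add by (simp add: algebra_simps)
    then have deg: "\<beta> + \<epsilon> = \<gamma> + \<delta>" using to_quot_inject by blast
    show ?thesis
    proof (rule RS_pieceI)
      show "a * d - b * c \<in> D (\<beta> + \<epsilon>)"
        using D_mult[OF x(1) y(2)] D_mult[OF x(2) y(1)] unfolding deg by (rule D_diff)
      show "b * d \<in> D (\<gamma> + \<epsilon>)" using D_mult[OF x(2) y(2)] .
      show "b * d \<noteq> 0" using x y by simp
      show "\<alpha> = to_quot_group (\<beta> + \<epsilon>) - to_quot_group (\<gamma> + \<epsilon>)"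
        unfolding x(5) to_quot_group_add by simp
      show "x - y = to_fract (a * d - b * c) / to_fract (b * d)"
        unfolding x(6) y(6) using x(4) y(4) by (simp add: diff_frac_eq mult.commute)
    qed
  qed
qed

lemma piece_mult_closed:
  assumes "x \<in> piece \<alpha>" "y \<in> piece \<alpha>'" shows "x * y \<in> piece (\<alpha> + \<alpha>')"
proof (cases "x = 0 \<or> y = 0")
  case True
  then show ?thesis by (auto simp: piece_def)
next
  case False
  then have nz: "x \<noteq> 0" "y \<noteq> 0" by simp_all
  obtain a b \<beta> \<gamma> where x: "a \<in> D \<beta>" "b \<in> D \<gamma>" "a \<noteq> 0" "b \<noteq> 0"
    "\<alpha> = to_quot_group \<beta> - to_quot_group \<gamma>" "x = to_fract a / to_fract b"
    by (rule pieceE[OF assms(1) nz(1)])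
  obtain c d \<delta> \<epsilon> where y: "c \<in> D \<delta>" "d \<in> D \<epsilon>" "c \<noteq> 0" "d \<noteq> 0"
    "\<alpha>' = to_quot_group \<delta> - to_quot_group \<epsilon>" "y = to_fract c / to_fract d"
    by (rule pieceE[OF assms(2) nz(2)])
  show ?thesis
  proof (rule RS_pieceI[OF D_mult[OF x(1) y(1)] D_mult[OF x(2) y(2)]])
    show "b * d \<noteq> 0" using x y by simp
    show "\<alpha> + \<alpha>' = to_quot_group (\<beta> + \<delta>) - to_quot_group (\<gamma> + \<epsilon>)"
      unfolding x(5) y(5) to_quot_group_add by simp
    show "x * y = to_fract (a * c) / to_fract (b * d)" unfolding x(6) y(6) by simp
  qed
qed

lemma piece_inverse_closed:
  assumes "x \<in> piece \<alpha>" shows "inverse x \<in> piece (- \<alpha>)"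
proof (cases "x = 0")
  case True
  then show ?thesis by (simp add: piece_def)
next
  case False
  then obtain a b \<beta> \<gamma> where x: "a \<in> D \<beta>" "b \<in> D \<gamma>" "a \<noteq> 0" "b \<noteq> 0"
    "\<alpha> = to_quot_group \<beta> - to_quot_group \<gamma>" "x = to_fract a / to_fract b"
    by (rule pieceE[OF assms])
  show ?thesis by (rule RS_pieceI[OF x(2,1,3)]) (simp_all add: x(5,6))
qed

lemma piece_common_denominator:
  assumes "finite A" "\<And>\<alpha>. \<alpha> \<in> A \<Longrightarrow> t \<alpha> \<in> piece \<alpha>" "\<And>\<alpha>. \<alpha> \<in> A \<Longrightarrow> t \<alpha> \<noteq> 0"
  shows "\<exists>s \<sigma>. s \<noteq> 0 \<and> s \<in> D \<sigma> \<and> (\<forall>\<alpha>\<in>A. \<exists>a \<beta>. to_fract s * t \<alpha> = to_fract a \<and> a \<in> D \<beta> \<and>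
    to_quot_group \<beta> = \<alpha> + to_quot_group \<sigma>)"
  using assms
proof (induction A rule: finite_induct)
  case empty
  then show ?case using one_homogeneous by (intro exI[of _ 1] exI[of _ 0]) simp
next
  case (insert \<alpha> A)
  then obtain s \<sigma> where s: "s \<noteq> 0" "s \<in> D \<sigma>" and A: "\<And>\<alpha>. \<alpha> \<in> A \<Longrightarrow> \<exists>a \<beta>. to_fract s * t \<alpha> = to_fract a \<and>
    a \<in> D \<beta> \<and> to_quot_group \<beta> = \<alpha> + to_quot_group \<sigma>" by auto
  obtain a b \<beta> \<gamma> where x: "a \<in> D \<beta>" "b \<in> D \<gamma>" "a \<noteq> 0" "b \<noteq> 0"
    "\<alpha> = to_quot_group \<beta> - to_quot_group \<gamma>" "t \<alpha> = to_fract a / to_fract b"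
    by (rule pieceE[OF insert.prems(1)[OF insertI1] insert.prems(2)[OF insertI1]])
  have "\<exists>a' \<beta>'. to_fract (s * b) * t \<alpha>' = to_fract a' \<and> a' \<in> D \<beta>' \<and> to_quot_group \<beta>' = \<alpha>' + to_quot_group (\<sigma> + \<gamma>)"
    if mem: "\<alpha>' \<in> insert \<alpha> A" for \<alpha>'
  proof (cases "\<alpha>' = \<alpha>")
    case True
    then show ?thesis
      using x D_mult[OF s(2) x(1)]
      by (intro exI[of _ "s * a"] exI[of _ "\<sigma> + \<beta>"]) (simp add: to_quot_group_add)
  next
    case False
    then obtain c \<delta> where c: "to_fract s * t \<alpha>' = to_fract c" "c \<in> D \<delta>" "to_quot_group \<delta> = \<alpha>' + to_quot_group \<sigma>"
      using mem A[of \<alpha>'] by blast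
    have "to_fract (s * b) * t \<alpha>' = to_fract s * t \<alpha>' * to_fract b" by (simp only: to_fract_mult mult_ac)
    also have "\<dots> = to_fract (c * b)" by (simp add: c(1))
    finally show ?thesis using D_mult[OF c(2) x(2)] c(3)
      by (intro exI[of _ "c * b"] exI[of _ "\<delta> + \<gamma>"]) (simp add: to_quot_group_add add.assoc)
  qed
  moreover have "s * b \<noteq> 0" "s * b \<in> D (\<sigma> + \<gamma>)" using s x D_mult by auto
  ultimately show ?case by blast
qed

text \<open>
  A common homogeneous denominator turns the summands into homogeneous elements of \<open>R\<close> whose degrees
  are still distinct, because cancellation embeds the monoid into its quotient group.
\<close>

lemma pieces_independent_aux:
  assumes A: "finite A" and t: "\<And>\<alpha>. \<alpha> \<in> A \<Longrightarrow> t \<alpha> \<in> piece \<alpha>" and sum: "(\<Sum>\<alpha>\<in>A. t \<alpha>) = 0" and "\<alpha> \<in> A"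
  shows "t \<alpha> = 0"
proof (rule ccontr)
  assume "t \<alpha> \<noteq> 0"
  define A' where "A' = {\<alpha> \<in> A. t \<alpha> \<noteq> 0}"
  have A': "finite A'" "\<alpha> \<in> A'" using A \<open>\<alpha> \<in> A\<close> \<open>t \<alpha> \<noteq> 0\<close> by (auto simp: A'_def)
  have "\<exists>s \<sigma>. s \<noteq> 0 \<and> s \<in> D \<sigma> \<and> (\<forall>\<alpha>\<in>A'. \<exists>a \<beta>. to_fract s * t \<alpha> = to_fract a \<and> a \<in> D \<beta> \<and>
      to_quot_group \<beta> = \<alpha> + to_quot_group \<sigma>)"
    using t by (intro piece_common_denominator A') (auto simp: A'_def)
  then obtain s \<sigma> where s: "s \<noteq> 0" "s \<in> D \<sigma>" and "\<forall>\<alpha>\<in>A'. \<exists>a \<beta>. to_fract s * t \<alpha> = to_fract a \<and> a \<in> D \<beta> \<and>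
      to_quot_group \<beta> = \<alpha> + to_quot_group \<sigma>" by blast
  then obtain a b where ab: "\<And>\<alpha>. \<alpha> \<in> A' \<Longrightarrow> to_fract s * t \<alpha> = to_fract (a \<alpha>)"
    "\<And>\<alpha>. \<alpha> \<in> A' \<Longrightarrow> a \<alpha> \<in> D (b \<alpha>)" "\<And>\<alpha>. \<alpha> \<in> A' \<Longrightarrow> to_quot_group (b \<alpha>) = \<alpha> + to_quot_group \<sigma>" by metis
  have inj: "inj_on b A'" by (rule inj_onI) (metis ab(3) add_right_cancel)
  have "(\<Sum>\<alpha>\<in>A'. t \<alpha>) = 0"
    unfolding sum[symmetric] using A by (intro sum.mono_neutral_left) (auto simp: A'_def)
  then have "(\<Sum>\<alpha>\<in>A'. to_fract s * t \<alpha>) = 0" by (simp flip: sum_distrib_left)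
  then have "(\<Sum>\<alpha>\<in>A'. to_fract (a \<alpha>)) = 0" using ab(1) by (simp cong: sum.cong)
  moreover have "(\<Sum>\<alpha>\<in>A'. to_fract (a \<alpha>)) = to_fract (sum a A')"
    using A'(1) by (induction A' rule: finite_induct) auto
  ultimately have "to_fract (sum a A') = 0" by (simp only:)
  then have "sum a A' = 0" by (simp only: to_fract_eq_0_iff)
  have "a \<alpha> = 0"
    by (rule D_independent[where t = a, OF A'(1) inj]) (fact ab(2) \<open>sum a A' = 0\<close> A'(2))+
  then show False using ab(1)[OF A'(2)] s(1) \<open>t \<alpha> \<noteq> 0\<close> by simp
qed

sublocale graded_field piece
proof
  show "0 \<in> piece \<alpha>" for \<alpha> by (simp add: piece_def)
  show "1 \<in> piece 0" by (rule RS_pieceI[OF one_homogeneous one_homogeneous]) simp_all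
qed (fact piece_diff_closed piece_mult_closed piece_inverse_closed pieces_independent_aux)+

lemma to_fract_piece: "x \<in> D \<gamma> \<Longrightarrow> to_fract x \<in> piece (to_quot_group \<gamma>)"
  by (rule RS_pieceI[OF _ one_homogeneous]) (simp_all add: to_quot_group_0)

lemma
  assumes "decomposes D x f"
  shows to_fract_T: "to_fract x \<in> T"
    and comp_to_fract: "comp (to_fract x) (to_quot_group \<gamma>) = to_fract (f \<gamma>)"
    and supp_to_fract: "\<alpha> \<in> supp (to_fract x) \<Longrightarrow> \<exists>\<gamma>. \<alpha> = to_quot_group \<gamma> \<and> f \<gamma> \<noteq> 0"
proof -
  let ?F = "{\<gamma>. f \<gamma> \<noteq> 0}"
  have f: "f \<gamma> \<in> D \<gamma>" and fin: "finite ?F" and x: "x = sum f ?F" for \<gamma>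
    using assms unfolding decomposes_def by auto
  have "to_fract (sum f B) = (\<Sum>\<gamma>\<in>B. to_fract (f \<gamma>))" for B
    by (induction B rule: infinite_finite_induct) auto
  from trans[OF arg_cong[OF x, of to_fract] this]
  have x': "to_fract x = (\<Sum>\<gamma>\<in>?F. to_fract (f \<gamma>))" .
  have T: "to_fract (f \<gamma>) \<in> T" for \<gamma> by (rule T_piece[OF to_fract_piece[OF f]])
  show "to_fract x \<in> T" unfolding x' using T by (rule T_simps(7))
  have c: "comp (to_fract x) \<alpha> = (\<Sum>\<gamma>\<in>?F. if \<alpha> = to_quot_group \<gamma> then to_fract (f \<gamma>) else 0)" for \<alpha>
    unfolding x' comp_sum[OF T] comp_homogeneous[OF to_fract_piece[OF f]] ..
  show "comp (to_fract x) (to_quot_group \<gamma>) = to_fract (f \<gamma>)"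
    unfolding c to_quot_inject using fin by (simp add: sum.delta)
  show "\<exists>\<gamma>. \<alpha> = to_quot_group \<gamma> \<and> f \<gamma> \<noteq> 0" if "\<alpha> \<in> supp (to_fract x)"
  proof (rule ccontr)
    assume "\<not> ?thesis"
    then have "comp (to_fract x) \<alpha> = 0" unfolding c by (intro sum.neutral) auto
    with that show False by (simp add: supp_def)
  qed
qed

lemma R_subset_T: "R \<subseteq> T"
  using to_fract_T D_decomposition by blast

lemma R_comp:
  assumes "x \<in> R" shows "comp x \<alpha> \<in> R"
proof -
  obtain a where a: "x = to_fract a" using assms by blast
  obtain f where f: "decomposes D a f" using D_decomposition by blast
  show ?thesis
  proof (cases "\<alpha> \<in> supp x")
    case True
    then obtain \<gamma> where "\<alpha> = to_quot_group \<gamma>" using supp_to_fract[OF f] a by blast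
    then show ?thesis using comp_to_fract[OF f] a by simp
  next
    case False
    then show ?thesis using field_subring_0[OF R_ring] by (simp add: supp_def)
  qed
qed

lemma S_piece:
  assumes "s \<in> S" obtains \<sigma> where "to_fract s \<in> piece \<sigma>" "to_fract s \<noteq> 0"
  using assms to_fract_piece unfolding nonzero_homogeneous_def by auto

lemma T_iff: "x \<in> T \<longleftrightarrow> (\<exists>s\<in>S. to_fract s * x \<in> R)"
proof
  assume x: "x \<in> T"
  have "\<exists>s\<in>S. to_fract s * y \<in> R" if y: "y \<in> comp x ` supp x" for y
  proof -
    obtain \<alpha> where \<alpha>: "y = comp x \<alpha>" "comp x \<alpha> \<noteq> 0" using y by (auto simp: supp_def)
    obtain a b \<beta> \<gamma> where "b \<in> D \<gamma>" "b \<noteq> 0" "comp x \<alpha> = to_fract a / to_fract b"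
      by (rule pieceE[OF comp_piece[OF x] \<alpha>(2)])
    then have "b \<in> S" "to_fract b * y = to_fract a" by (auto simp: nonzero_homogeneous_def \<alpha>(1))
    then show ?thesis by blast
  qed
  then obtain s where s: "s \<in> S" "\<forall>y\<in>comp x ` supp x. to_fract s * y \<in> R"
    using common_denominator[of "comp x ` supp x"] finite_supp[OF x] by blast
  have "to_fract s * x = (\<Sum>\<alpha>\<in>supp x. to_fract s * comp x \<alpha>)"
    by (subst sum_comp[OF x, symmetric]) (rule sum_distrib_left)
  also have "\<dots> \<in> R" using s(2) by (intro field_subring_sum[OF R_ring]) blast
  finally show "\<exists>s\<in>S. to_fract s * x \<in> R" using s(1) by blast
next
  assume "\<exists>s\<in>S. to_fract s * x \<in> R"
  then obtain s where s: "s \<in> S" "to_fract s * x \<in> R" by blast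
  then obtain \<sigma> where \<sigma>: "to_fract s \<in> piece \<sigma>" "to_fract s \<noteq> 0" using S_piece by blast
  have "inverse (to_fract s) * (to_fract s * x) \<in> T"
    using T_piece[OF piece_inverse[OF \<sigma>(1)]] s(2) R_subset_T field_subring_mult[OF field_subring_T] by blast
  then show "x \<in> T" using \<sigma>(2) by (simp add: mult.assoc[symmetric])
qed

lemma T_common_denominator:
  "finite X \<Longrightarrow> X \<subseteq> T \<Longrightarrow> \<exists>s\<in>S. \<forall>x\<in>X. to_fract s * x \<in> R"
  using T_iff by (intro common_denominator) auto

lemma fractions_T: "x \<in> fractions T"
proof (cases x)
  case (Fract a b)
  then have "x = to_fract a / to_fract b" "to_fract b \<noteq> 0" by (simp_all add: Fract_conv_to_fract)
  moreover have "to_fract a \<in> T" "to_fract b \<in> T" using R_subset_T by auto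
  ultimately show ?thesis unfolding fractions_def by blast
qed

text \<open>
  Greatest common divisors in \<open>T\<close>, for elements of the quotient field: the inverse of a least common
  multiple of the inverses.
\<close>

lemma T_gcd:
  assumes "finite X" "X \<noteq> {}" "0 \<notin> X"
  obtains d where "d \<noteq> 0" "\<And>h. (\<forall>x\<in>X. x * h \<in> T) \<longleftrightarrow> d * h \<in> T"
proof -
  have "\<exists>m\<in>fractions T. m \<noteq> 0 \<and> (\<forall>y. (\<forall>x\<in>inverse ` X. y / x \<in> T) \<longleftrightarrow> y / m \<in> T)"
    using assms fractions_T
    by (intro lcm_subring_finite[OF field_subring_T lcm_subring_T[OF torsion_free_degrees]]) auto
  then obtain m where "m \<noteq> 0" "\<And>y. (\<forall>x\<in>inverse ` X. y / x \<in> T) \<longleftrightarrow> y / m \<in> T" by blast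
  then show ?thesis using that[of "inverse m"] by (simp add: divide_inverse mult.commute)
qed

end

section \<open>Homogeneity of products in almost normal domains\<close>

context torsionless_graded_domain
begin

lemma degree_order_exists:
  obtains lt where "translation_order (lt :: 'g quot_group \<Rightarrow> 'g quot_group \<Rightarrow> bool)"
proof -
  have "pointed_cone {0 :: 'g quot_group}" by (simp add: pointed_cone_def)
  from pointed_cone_extends_to_order[OF torsion_free_degrees this] that show ?thesis by blast
qed

lemma component_products_integral:
  assumes f: "f \<in> T" and g: "g \<in> T" and fg: "f * g \<in> R"
  shows "integral_elem (comp f \<alpha> * comp g \<beta>)"
proof -
  obtain lt where lt: "translation_order (lt :: 'g quot_group \<Rightarrow> 'g quot_group \<Rightarrow> bool)"
    by (rule degree_order_exists)
  define F where "F = insert \<alpha> (supp f)"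
  define G where "G = insert \<beta> (supp g)"
  have F: "finite F" "supp f \<subseteq> F" "\<alpha> \<in> F" and G: "finite G" "supp g \<subseteq> G" "\<beta> \<in> G"
    using finite_supp f g by (auto simp: F_def G_def)
  have "(\<Sum>(a, b)\<in>{p \<in> F \<times> G. fst p + snd p = d}. comp f a * comp g b) \<in> R" for d
    using R_comp[OF fg, of d] unfolding comp_mult[OF f g F(1,2) G(1,2)] .
  then show ?thesis
    unfolding integral_over_iff_integral_elem[symmetric]
    by (rule gauss_integral[OF lt R_ring F(1) G(1) _ F(3) G(3)])
qed

lemma component_products_nonzero_degree:
  assumes an: "almost_normal D" and f: "f \<in> T" and g: "g \<in> T" and fg: "f * g \<in> R" and "\<alpha> + \<beta> \<noteq> 0"
  shows "comp f \<alpha> * comp g \<beta> \<in> R"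
proof (cases "comp f \<alpha> * comp g \<beta> = 0")
  case True
  then show ?thesis using field_subring_0[OF R_ring] by (simp only:)
next
  case False
  have "comp f \<alpha> * comp g \<beta> \<in> piece (\<alpha> + \<beta>)" using comp_piece f g by (intro piece_mult)
  with False have "comp f \<alpha> * comp g \<beta> \<in> RS_piece D (\<alpha> + \<beta>)" unfolding piece_def by blast
  then show ?thesis
    using an \<open>\<alpha> + \<beta> \<noteq> 0\<close> component_products_integral[OF f g fg] unfolding almost_normal_def by blast
qed

text \<open>
  Inertness enters only through this dichotomy.  If \<open>x\<close> and \<open>y\<close> are homogeneous of opposite degrees,
  then \<open>x y\<close> lies in \<open>R\<^sub>0\<close>, so that \<open>x\<close> is an element of \<open>R\<^sub>0\<close> times a unit, which has the degree of \<open>x\<close>.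
\<close>

lemma homogeneous_unit_or_pointed_support:
  assumes "inert (D 0)"
  obtains (unit) u \<delta> where "u \<in> R" "inverse u \<in> R" "u \<noteq> 0" "u \<in> piece \<delta>" "\<delta> \<noteq> 0"
  | (pointed) "pointed_cone {to_quot_group \<gamma> | \<gamma>. D \<gamma> \<noteq> {0}}"
proof (cases "\<exists>u \<delta>. u \<in> R \<and> inverse u \<in> R \<and> u \<noteq> 0 \<and> u \<in> piece \<delta> \<and> \<delta> \<noteq> 0")
  case True
  then show ?thesis using unit by blast
next
  case False
  have nz: "\<exists>a\<in>D \<gamma>. a \<noteq> 0" if "D \<gamma> \<noteq> {0}" for \<gamma> using that D_0 by blast
  have "pointed_cone {to_quot_group \<gamma> | \<gamma>. D \<gamma> \<noteq> {0}}"
    unfolding pointed_cone_def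
  proof (intro conjI ballI impI)
    have "D 0 \<noteq> {0}" using one_homogeneous by (metis singletonD zero_neq_one)
    then show "0 \<in> {to_quot_group \<gamma> | \<gamma>. D \<gamma> \<noteq> {0}}" using to_quot_group_0 by force
  next
    fix x y assume "x \<in> {to_quot_group \<gamma> | \<gamma>. D \<gamma> \<noteq> {0}}" "y \<in> {to_quot_group \<gamma> | \<gamma>. D \<gamma> \<noteq> {0}}"
    then obtain \<gamma> \<delta> where *: "x = to_quot_group \<gamma>" "y = to_quot_group \<delta>" "D \<gamma> \<noteq> {0}" "D \<delta> \<noteq> {0}" by blast
    obtain a b where "a \<in> D \<gamma>" "b \<in> D \<delta>" "a \<noteq> 0" "b \<noteq> 0" using nz * by blast
    then have "a * b \<in> D (\<gamma> + \<delta>)" "a * b \<noteq> 0" using D_mult by auto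
    then have "D (\<gamma> + \<delta>) \<noteq> {0}" by blast
    moreover have "x + y = to_quot_group (\<gamma> + \<delta>)" by (simp add: * to_quot_group_add)
    ultimately show "x + y \<in> {to_quot_group \<gamma> | \<gamma>. D \<gamma> \<noteq> {0}}" by blast
  next
    fix x assume "x \<in> {to_quot_group \<gamma> | \<gamma>. D \<gamma> \<noteq> {0}}" "- x \<in> {to_quot_group \<gamma> | \<gamma>. D \<gamma> \<noteq> {0}}"
    then obtain \<gamma> \<delta> where *: "x = to_quot_group \<gamma>" "- x = to_quot_group \<delta>" "D \<gamma> \<noteq> {0}" "D \<delta> \<noteq> {0}" by blast
    have "to_quot_group (\<gamma> + \<delta>) = to_quot_group 0"
      unfolding to_quot_group_add *(1,2)[symmetric] to_quot_group_0 by simp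
    then have deg: "\<gamma> + \<delta> = 0" using to_quot_inject by blast
    obtain a b where ab: "a \<in> D \<gamma>" "b \<in> D \<delta>" "a \<noteq> 0" "b \<noteq> 0" using nz * by blast
    then have "a * b \<in> D 0" "a * b \<noteq> 0" using D_mult[OF ab(1,2)] deg by auto
    then obtain r u w where u: "r \<in> D 0" "u * w = 1" "a = r * u"
      using \<open>inert (D 0)\<close> unfolding inert_def by blast
    let ?u = "to_fract u" and ?r = "to_fract r"
    have uT: "?u \<in> T" using R_subset_T by blast
    have r0: "?r \<in> piece 0" using to_fract_piece[OF u(1)] by (simp add: to_quot_group_0)
    have rnz: "?r \<noteq> 0" using u(3) ab(3) by auto
    have "comp (to_fract a) \<alpha> = ?r * comp ?u \<alpha>" for \<alpha>
      using comp_shift[OF r0 uT, of \<alpha>] u(3) by (simp only: diff_0_right to_fract_mult)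
    then have "comp ?u \<alpha> = 0" if "\<alpha> \<noteq> x" for \<alpha>
      using comp_homogeneous[OF to_fract_piece[OF ab(1)]] *(1) that rnz by (metis mult_eq_0_iff)
    then have "supp ?u \<subseteq> {x}" by (auto simp: supp_def)
    then have "?u = comp ?u x" using sum_comp_superset[OF uT, of "{x}"] by simp
    then have "?u \<in> piece x" using comp_piece[OF uT, of x] by simp
    moreover have "to_fract (u * w) = 1" using u(2) by simp
    then have "?u * to_fract w = 1" by simp
    then have "inverse ?u = to_fract w" by (rule inverse_unique)
    then have "inverse ?u \<in> R" by simp
    moreover have "?u \<noteq> 0" using u(2) by auto
    ultimately show "x = 0" using False by blast
  qed
  then show ?thesis using pointed by blast
qed

text \<open>
  In nonzero degrees this is almost normality, applied to elements that are integral by Gauss'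
  lemma.  The degree \<open>0\<close> is reduced to nonzero degrees by a homogeneous unit, or else reached by the
  product of the lowest components only.
\<close>

lemma component_products:
  assumes an: "almost_normal D" and "inert (D 0)" and f: "f \<in> T" and g: "g \<in> T" and fg: "f * g \<in> R"
  shows "comp f \<alpha> * comp g \<beta> \<in> R"
proof (cases "\<alpha> + \<beta> = 0 \<and> comp f \<alpha> \<noteq> 0 \<and> comp g \<beta> \<noteq> 0")
  case False
  then show ?thesis
    using component_products_nonzero_degree[OF an f g fg, of \<alpha> \<beta>] field_subring_0[OF R_ring]
    by (metis mult_zero_left mult_zero_right)
next
  case True
  then have 0: "\<alpha> + \<beta> = 0" and supp: "\<alpha> \<in> supp f" "\<beta> \<in> supp g" by (simp_all add: supp_def)
  from \<open>inert (D 0)\<close> show ?thesis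
  proof (cases rule: homogeneous_unit_or_pointed_support)
    case (unit u \<delta>)
    \<comment> \<open>Multiplication with a unit of nonzero degree reduces to products of nonzero degree.\<close>
    have uf: "u * f \<in> T" using T_piece[OF unit(4)] f by (rule T_simps(4))
    have "u * f * g \<in> R" using field_subring_mult[OF R_ring unit(1) fg] by (simp only: mult.assoc)
    moreover have "(\<alpha> + \<delta>) + \<beta> = (\<alpha> + \<beta>) + \<delta>" by (simp only: add_ac)
    then have "(\<alpha> + \<delta>) + \<beta> \<noteq> 0" using unit(5) by (simp only: 0 add_0_left not_False_eq_True)
    ultimately have "comp (u * f) (\<alpha> + \<delta>) * comp g \<beta> \<in> R"
      by (rule component_products_nonzero_degree[OF an uf g])
    moreover have "comp (u * f) (\<alpha> + \<delta>) = u * comp f \<alpha>" using comp_shift[OF unit(4) f, of "\<alpha> + \<delta>"] by simp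
    ultimately have "u * comp f \<alpha> * comp g \<beta> \<in> R" by (simp only:)
    then have "inverse u * (u * comp f \<alpha> * comp g \<beta>) \<in> R" using field_subring_mult[OF R_ring unit(2)] by blast
    then show ?thesis using unit(3) by (simp add: mult.assoc[symmetric])
  next
    case pointed
    \<comment> \<open>For an order in which \<open>R\<close> has no negative degrees, a product of degree \<open>0\<close> of components
      has to be the product of the lowest components.\<close>
    obtain lt where lt: "translation_order lt" and pos: "\<And>x. x \<in> {to_quot_group \<gamma> | \<gamma>. D \<gamma> \<noteq> {0}} \<Longrightarrow> x \<noteq> 0 \<Longrightarrow> lt 0 x"
      using pointed_cone_extends_to_order[OF torsion_free_degrees pointed] by blast
    have "f \<noteq> 0" "g \<noteq> 0" using True by (auto simp: comp_0)
    obtain \<alpha>0 where low_f: "lowest lt f \<alpha>0" by (rule lowest_exists[OF lt f \<open>f \<noteq> 0\<close>])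
    obtain \<beta>0 where low_g: "lowest lt g \<beta>0" by (rule lowest_exists[OF lt g \<open>g \<noteq> 0\<close>])
    have mem: "\<alpha>0 + \<beta>0 \<in> supp (f * g)" by (rule lowest_mult_supp[OF lt f g low_f low_g])
    obtain a where a: "f * g = to_fract a" using fg by blast
    obtain h where h: "decomposes D a h" using D_decomposition by blast
    obtain \<gamma> where \<gamma>: "\<alpha>0 + \<beta>0 = to_quot_group \<gamma>" "h \<gamma> \<noteq> 0" using supp_to_fract[OF h] mem a by auto
    have "h \<gamma> \<in> D \<gamma>" using h unfolding decomposes_def by blast
    with \<gamma>(2) have "D \<gamma> \<noteq> {0}" by blast
    then have "\<alpha>0 + \<beta>0 \<in> {to_quot_group \<gamma> | \<gamma>. D \<gamma> \<noteq> {0}}" using \<gamma>(1) by blast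
    then have "\<alpha>0 + \<beta>0 \<noteq> 0 \<Longrightarrow> lt 0 (\<alpha>0 + \<beta>0)" by (rule pos)
    then have ge: "\<alpha>0 + \<beta>0 = 0 \<or> lt 0 (\<alpha>0 + \<beta>0)" by blast
    have le: "\<alpha>0 = \<alpha> \<or> lt \<alpha>0 \<alpha>" "\<beta>0 = \<beta> \<or> lt \<beta>0 \<beta>"
      using low_f low_g supp unfolding lowest_def by metis+
    have "\<alpha>0 + \<beta>0 = \<alpha> + \<beta>"
    proof (rule ccontr)
      assume ne: "\<alpha>0 + \<beta>0 \<noteq> \<alpha> + \<beta>"
      have mono: "lt (a + c) (b + c)" if "lt a b" for a b c using lt that unfolding translation_order_def by blast
      have trans: "lt a c" if "lt a b" "lt b c" for a b c
        using lt that by (simp add: translation_order_def)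
      have 1: "\<alpha>0 + \<beta>0 = \<alpha> + \<beta>0 \<or> lt (\<alpha>0 + \<beta>0) (\<alpha> + \<beta>0)" using le(1) mono by blast
      have 2: "\<alpha> + \<beta>0 = \<alpha> + \<beta> \<or> lt (\<alpha> + \<beta>0) (\<alpha> + \<beta>)"
        using le(2) mono[of \<beta>0 \<beta> \<alpha>] by (auto simp: add.commute)
      have "lt (\<alpha>0 + \<beta>0) (\<alpha> + \<beta>)" using 1 2 ne trans by metis
      then have "lt (\<alpha>0 + \<beta>0) 0" by (simp only: 0)
      moreover have "lt 0 (\<alpha>0 + \<beta>0)" using ge ne unfolding 0 by blast
      ultimately show False using translation_order_asym[OF lt] by blast
    qed
    then have eq: "\<alpha>0 = \<alpha>" "\<beta>0 = \<beta>"
      using translation_order_add_le[OF lt le] by blast+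
    have "comp (f * g) (\<alpha> + \<beta>) = comp f \<alpha> * comp g \<beta>"
      using comp_mult_lowest[OF lt f g low_f low_g] unfolding eq .
    then show ?thesis using R_comp[OF fg, of "\<alpha> + \<beta>"] by simp
  qed
qed

lemma colon_homogeneous:
  assumes "almost_normal D" "inert (D 0)" and c: "c \<in> T" and y: "y \<in> T" and yc: "y * c \<in> R"
  shows "comp y \<alpha> * c \<in> R"
proof -
  have "comp y \<alpha> * c = (\<Sum>\<beta>\<in>supp c. comp y \<alpha> * comp c \<beta>)"
    by (subst sum_comp[OF c, symmetric]) (rule sum_distrib_left)
  also have "\<dots> \<in> R"
    by (intro field_subring_sum[OF R_ring] component_products assms)
  finally show ?thesis .
qed

end

section \<open>Characterization of t-invertible t-ideals by finite sets\<close>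

lemmas range_to_fract_simps = field_subring_simps[OF field_subring_range_to_fract]

lemma mem_ideal_inverse: "x \<in> ideal_inverse X \<longleftrightarrow> (\<forall>y\<in>X. x * y \<in> range to_fract)"
  by (simp add: ideal_inverse_def ideal_quotient_def)

lemma subspace_iff:
  "fract_module.subspace I \<longleftrightarrow> 0 \<in> I \<and> (\<forall>x\<in>I. \<forall>y\<in>I. x + y \<in> I) \<and> (\<forall>r\<in>range to_fract. \<forall>x\<in>I. r * x \<in> I)"
  unfolding fract_module.subspace_def fract_scale_def by blast

lemma subspace_colon: "fract_module.subspace {y. x * y \<in> range to_fract}"
  unfolding subspace_iff
proof (intro conjI ballI)
  show "0 \<in> {y. x * y \<in> range to_fract}"
    using range_to_fract_simps(2) by simp
  fix y z assume "y \<in> {y. x * y \<in> range to_fract}" "z \<in> {y. x * y \<in> range to_fract}"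
  then have "x * y \<in> range to_fract" "x * z \<in> range to_fract" by simp_all
  then have "x * y + x * z \<in> range to_fract" by (rule range_to_fract_simps(6))
  then show "y + z \<in> {y. x * y \<in> range to_fract}" by (simp only: mem_Collect_eq distrib_left)
next
  fix r y assume r: "r \<in> range (to_fract :: 'a \<Rightarrow> _)" and "y \<in> {y. x * y \<in> range to_fract}"
  then have "r * (x * y) \<in> range to_fract" by (intro range_to_fract_simps(4)[OF r]) simp
  then show "r * y \<in> {y. x * y \<in> range to_fract}" by (simp only: mem_Collect_eq mult.left_commute)
qed

lemma ideal_inverse_span: "ideal_inverse (fract_module.span B) = ideal_inverse B"
proof (intro equalityI subsetI)
  fix x assume "x \<in> ideal_inverse (fract_module.span B)"
  then show "x \<in> ideal_inverse B" using fract_module.span_superset[of B] by (auto simp: mem_ideal_inverse)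
next
  fix x assume "x \<in> ideal_inverse B"
  then have "B \<subseteq> {y. x * y \<in> range to_fract}" by (auto simp: mem_ideal_inverse)
  then have "fract_module.span B \<subseteq> {y. x * y \<in> range to_fract}"
    by (rule fract_module.span_minimal[OF _ subspace_colon])
  then show "x \<in> ideal_inverse (fract_module.span B)" by (auto simp: mem_ideal_inverse)
qed

lemma ideal_inverse_antimono: "X \<subseteq> Y \<Longrightarrow> ideal_inverse Y \<subseteq> ideal_inverse X"
  unfolding mem_ideal_inverse subset_iff by blast

lemma subset_v_closure: "X \<subseteq> v_closure X"
proof
  fix x assume "x \<in> X"
  then have "y * x \<in> range to_fract" if "y \<in> ideal_inverse X" for y
    using that unfolding mem_ideal_inverse by blast
  then have "x * y \<in> range to_fract" if "y \<in> ideal_inverse X" for y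
    using that by (simp only: mult.commute[of x])
  then show "x \<in> v_closure X" unfolding v_closure_def mem_ideal_inverse[of x] by blast
qed

lemma v_closure_mono: "X \<subseteq> Y \<Longrightarrow> v_closure X \<subseteq> v_closure Y"
  unfolding v_closure_def by (intro ideal_inverse_antimono)

lemma v_closure_ideal_inverse: "v_closure (ideal_inverse X) = ideal_inverse X"
proof
  show "v_closure (ideal_inverse X) \<subseteq> ideal_inverse X"
    using ideal_inverse_antimono[OF subset_v_closure[of X]] by (simp add: v_closure_def)
qed (rule subset_v_closure)

lemma v_closure_span: "v_closure (fract_module.span B) = ideal_inverse (ideal_inverse B)"
  by (simp add: v_closure_def ideal_inverse_span)

lemma subspace_ideal_inverse: "fract_module.subspace (ideal_inverse X)"
proof -
  have "ideal_inverse X = (\<Inter>x\<in>X. {y. x * y \<in> range to_fract})"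
    unfolding set_eq_iff mem_ideal_inverse by (simp add: mult.commute)
  moreover have "fract_module.subspace (\<Inter>x\<in>X. {y. x * y \<in> range to_fract})"
    by (rule fract_module.subspace_Inter) (use subspace_colon in auto)
  ultimately show ?thesis by simp
qed

lemma fractional_ideal_mult:
  "fractional_ideal I \<Longrightarrow> r \<in> range to_fract \<Longrightarrow> x \<in> I \<Longrightarrow> r * x \<in> I"
  unfolding fractional_ideal_def subspace_iff by blast

lemma fractional_ideal_nonzero: "fractional_ideal I \<Longrightarrow> \<exists>x\<in>I. x \<noteq> 0"
  unfolding fractional_ideal_def subspace_iff by blast

lemma fract_quotient: obtains a b where "x = to_fract a / to_fract b" "b \<noteq> 0"
  by (cases x) (auto simp: Fract_conv_to_fract)

lemma finite_common_denominator:
  fixes B :: "'a::idom fract set"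
  assumes "finite B" shows "\<exists>d. d \<noteq> 0 \<and> (\<forall>x\<in>B. to_fract d * x \<in> range to_fract)"
  using assms
proof (induction B rule: finite_induct)
  case empty
  then show ?case by (intro exI[of _ 1]) simp
next
  case (insert x B)
  then obtain d where d: "d \<noteq> 0" "\<And>x. x \<in> B \<Longrightarrow> to_fract d * x \<in> range to_fract" by blast
  obtain a b where ab: "x = to_fract a / to_fract b" "b \<noteq> 0" by (rule fract_quotient)
  have "to_fract (d * b) * y \<in> range to_fract" if y: "y \<in> insert x B" for y
  proof (cases "y = x")
    case True
    have "to_fract (d * b) * y = to_fract (d * a)" unfolding True ab(1) using ab(2) by simp
    then show ?thesis by (simp only: rangeI)
  next
    case False
    then have "to_fract d * y \<in> range to_fract" using y d(2) by blast
    then have "to_fract b * (to_fract d * y) \<in> range to_fract"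
      by (rule range_to_fract_simps(4)[OF rangeI])
    then show ?thesis by (simp only: to_fract_mult mult_ac)
  qed
  then show ?case using d(1) ab(2) by (intro exI[of _ "d * b"]) simp
qed

lemma fractional_idealI:
  assumes "fract_module.subspace I" "x \<in> I" "x \<noteq> 0" "d \<noteq> 0"
    and "\<And>x. x \<in> I \<Longrightarrow> to_fract d * x \<in> range to_fract"
  shows "fractional_ideal I"
  unfolding fractional_ideal_def
proof (intro conjI exI[of _ d] ballI)
  show "fract_scale d x \<in> range to_fract" if "x \<in> I" for x
    unfolding fract_scale_def by (rule assms(5)[OF that])
qed (use assms in auto)

lemma fractional_ideal_span:
  assumes "finite B" "b \<in> B" "b \<noteq> 0" shows "fractional_ideal (fract_module.span B)"
proof -
  obtain d where d: "d \<noteq> 0" "\<And>x. x \<in> B \<Longrightarrow> to_fract d * x \<in> range to_fract"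
    using finite_common_denominator[OF assms(1)] by blast
  have "fract_module.span B \<subseteq> {y. to_fract d * y \<in> range to_fract}"
    by (rule fract_module.span_minimal[OF _ subspace_colon]) (use d in auto)
  moreover have "b \<in> fract_module.span B" using assms(2) by (rule fract_module.span_base)
  ultimately show ?thesis
    using d(1) assms(3) by (intro fractional_idealI[of _ b d] fract_module.subspace_span) auto
qed

lemma fractional_ideal_inverse:
  assumes "finite B" "b \<in> B" "b \<noteq> 0" shows "fractional_ideal (ideal_inverse B)"
proof -
  obtain d where d: "d \<noteq> 0" "\<And>x. x \<in> B \<Longrightarrow> to_fract d * x \<in> range to_fract"
    using finite_common_denominator[OF assms(1)] by blast
  then have "to_fract d \<in> ideal_inverse B" "to_fract d \<noteq> 0" unfolding mem_ideal_inverse by simp_all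
  moreover obtain p q where pq: "b = to_fract p / to_fract q" "q \<noteq> 0" by (rule fract_quotient)
  have "to_fract p * x \<in> range to_fract" if "x \<in> ideal_inverse B" for x
  proof -
    have "x * b \<in> range to_fract" using that assms(2) by (auto simp: mem_ideal_inverse)
    then have "to_fract q * (x * b) \<in> range to_fract" by (rule range_to_fract_simps(4)[OF rangeI])
    moreover have "to_fract q * (x * b) = to_fract p * x" using pq by simp
    ultimately show ?thesis by (simp only:)
  qed
  moreover have "p \<noteq> 0" using pq assms(3) by auto
  ultimately show ?thesis by (intro fractional_idealI[OF subspace_ideal_inverse])
qed

lemma v_closure_subset_t_closure:
  assumes "finite B" "b \<in> B" "b \<noteq> 0" "fract_module.span B \<subseteq> I"
  shows "ideal_inverse (ideal_inverse B) \<subseteq> t_closure I"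
  unfolding t_closure_def v_closure_span[symmetric]
  using fractional_ideal_span[OF assms(1-3)] assms(1,4) by blast

lemma t_closure_subset_v_closure: "t_closure I \<subseteq> v_closure I"
  unfolding t_closure_def using v_closure_mono by blast

lemma nonzero_mem_t_closure:
  assumes "x \<in> I" "x \<noteq> 0" "fract_module.subspace I" shows "x \<in> t_closure I"
proof -
  have "fract_module.span {x} \<subseteq> I" using assms by (intro fract_module.span_minimal) auto
  then have "ideal_inverse (ideal_inverse {x}) \<subseteq> t_closure I"
    using v_closure_subset_t_closure[of "{x}" x I] assms by simp
  moreover have "x \<in> ideal_inverse (ideal_inverse {x})"
    using subset_v_closure[of "{x}"] by (simp add: v_closure_def)
  ultimately show ?thesis by blast
qed

lemma subset_t_closure:
  assumes "fractional_ideal I" shows "I \<subseteq> t_closure I"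
proof
  have I: "fract_module.subspace I" using assms by (simp add: fractional_ideal_def)
  obtain y where y: "y \<in> I" "y \<noteq> 0" using fractional_ideal_nonzero[OF assms] by blast
  fix x assume x: "x \<in> I"
  show "x \<in> t_closure I"
  proof (cases "x = 0")
    case True
    have "fract_module.span {y} \<subseteq> I" using y I by (intro fract_module.span_minimal) auto
    then have "ideal_inverse (ideal_inverse {y}) \<subseteq> t_closure I"
      using v_closure_subset_t_closure[of "{y}" y I] y by simp
    moreover have "0 \<in> ideal_inverse (ideal_inverse {y})"
      using subspace_ideal_inverse fract_module.subspace_0 by blast
    ultimately show ?thesis using True by blast
  qed (use nonzero_mem_t_closure x I in blast)
qed

text \<open>
  An elementary form of t-invertibility: up to the v-closure, \<open>B\<close> generates an ideal and \<open>B'\<close> its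
  inverse.  The last condition says that the products generate an ideal with inverse \<open>R\<close>.
\<close>

definition inverse_pair :: "'a::idom fract set \<Rightarrow> 'a fract set \<Rightarrow> bool" where
  "inverse_pair B B' \<longleftrightarrow> finite B \<and> finite B' \<and> (\<exists>b\<in>B. b \<noteq> 0) \<and> (\<exists>b\<in>B'. b \<noteq> 0) \<and>
     (\<forall>b\<in>B. \<forall>b'\<in>B'. b * b' \<in> range to_fract) \<and>
     (\<forall>z. (\<forall>b\<in>B. \<forall>b'\<in>B'. z * (b * b') \<in> range to_fract) \<longrightarrow> z \<in> range to_fract)"

lemma inverse_pair_sym:
  assumes "inverse_pair B B'" shows "inverse_pair B' B"
proof -
  have 1: "(\<forall>b\<in>B'. \<forall>b'\<in>B. z * (b * b') \<in> range to_fract) \<longleftrightarrow>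
      (\<forall>b\<in>B. \<forall>b'\<in>B'. z * (b * b') \<in> range to_fract)" for z
    by (metis mult.commute)
  have 2: "(\<forall>b\<in>B'. \<forall>b'\<in>B. b * b' \<in> range to_fract) \<longleftrightarrow>
      (\<forall>b\<in>B. \<forall>b'\<in>B'. b * b' \<in> range to_fract)"
    by (metis mult.commute)
  show ?thesis using assms unfolding inverse_pair_def 1 2 by (elim conjE) (intro conjI)
qed

lemma inverse_pair_subset: "inverse_pair B B' \<Longrightarrow> B \<subseteq> ideal_inverse B'"
  unfolding inverse_pair_def by (auto simp: mem_ideal_inverse)

lemma inverse_pair_mult:
  assumes "inverse_pair B B'" "x \<in> ideal_inverse B'" "y \<in> ideal_inverse B"
  shows "x * y \<in> range to_fract"
proof -
  have "x * y * (b * b') \<in> range to_fract" if "b \<in> B" "b' \<in> B'" for b b'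
  proof -
    have "x * b' \<in> range to_fract" "y * b \<in> range to_fract"
      using assms(2,3) that by (auto simp: mem_ideal_inverse)
    then have "(x * b') * (y * b) \<in> range to_fract" by (rule range_to_fract_simps(4))
    then show ?thesis by (simp only: mult_ac)
  qed
  then show ?thesis using assms(1) unfolding inverse_pair_def by blast
qed

lemma mem_t_invertible_group:
  "I \<in> carrier t_invertible_group \<longleftrightarrow> fractional_ideal I \<and> t_closure I = I \<and>
    (\<exists>I'. fractional_ideal I' \<and> t_closure I' = I' \<and>
      t_closure (ideal_product I I') = range to_fract \<and> t_closure (ideal_product I' I) = range to_fract)"
  unfolding t_invertible_group_def units_of_def Units_def t_ideal_monoid_def by auto

lemma ideal_inverse_t_closed:
  assumes "finite B" "b \<in> B" "b \<noteq> 0" shows "t_closure (ideal_inverse B) = ideal_inverse B"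
  using t_closure_subset_v_closure[of "ideal_inverse B"] subset_t_closure[OF fractional_ideal_inverse[OF assms]]
  unfolding v_closure_ideal_inverse by blast

lemma inverse_pair_t_closure_product:
  assumes "inverse_pair B B'"
  shows "t_closure (ideal_product (ideal_inverse B') (ideal_inverse B)) = range to_fract"
proof
  let ?P = "{x * y | x y. x \<in> ideal_inverse B' \<and> y \<in> ideal_inverse B}"
  let ?R = "range (to_fract :: 'a \<Rightarrow> _)"
  have "?P \<subseteq> ?R" using inverse_pair_mult[OF assms] by blast
  then have "1 \<in> ideal_inverse (ideal_product (ideal_inverse B') (ideal_inverse B))"
    unfolding ideal_product_def ideal_inverse_span by (auto simp: mem_ideal_inverse)
  then have "v_closure (ideal_product (ideal_inverse B') (ideal_inverse B)) \<subseteq> ?R"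
    unfolding v_closure_def by (force simp: mem_ideal_inverse[of _ "ideal_inverse _"])
  then show "t_closure (ideal_product (ideal_inverse B') (ideal_inverse B)) \<subseteq> ?R"
    using t_closure_subset_v_closure by blast
  define F where "F = (\<lambda>(b, b'). b * b') ` (B \<times> B')"
  have BB: "B \<subseteq> ideal_inverse B'" "B' \<subseteq> ideal_inverse B"
    using inverse_pair_subset assms inverse_pair_sym by blast+
  have "F \<subseteq> ?P" unfolding F_def using BB by auto
  then have "fract_module.span F \<subseteq> ideal_product (ideal_inverse B') (ideal_inverse B)"
    unfolding ideal_product_def by (rule fract_module.span_mono)
  moreover have "finite F" using assms unfolding F_def inverse_pair_def by simp
  moreover obtain b b' where "b \<in> B" "b \<noteq> 0" "b' \<in> B'" "b' \<noteq> 0"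
    using assms unfolding inverse_pair_def by blast
  then have "b * b' \<in> F" "b * b' \<noteq> 0" by (auto simp: F_def)
  ultimately have sub: "ideal_inverse (ideal_inverse F) \<subseteq> t_closure (ideal_product (ideal_inverse B') (ideal_inverse B))"
    by (intro v_closure_subset_t_closure)
  have "ideal_inverse F \<subseteq> ?R"
    using assms unfolding inverse_pair_def F_def by (auto simp: mem_ideal_inverse)
  then have "r * z \<in> ?R" if "r \<in> ?R" "z \<in> ideal_inverse F" for r z
    by (rule range_to_fract_simps(4)[OF that(1) subsetD, OF _ that(2)])
  then have "?R \<subseteq> ideal_inverse (ideal_inverse F)"
    unfolding subset_iff mem_ideal_inverse[of _ "ideal_inverse F"] by blast
  with sub show "?R \<subseteq> t_closure (ideal_product (ideal_inverse B') (ideal_inverse B))" by blast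
qed

lemma t_invertible_ideal_inverse:
  assumes pair: "inverse_pair B B'" shows "ideal_inverse B' \<in> carrier t_invertible_group"
proof -
  obtain b b' where "finite B" "finite B'" "b \<in> B" "b \<noteq> 0" "b' \<in> B'" "b' \<noteq> 0"
    using pair unfolding inverse_pair_def by blast
  then show ?thesis
    unfolding mem_t_invertible_group
    using fractional_ideal_inverse ideal_inverse_t_closed
      inverse_pair_t_closure_product[OF pair] inverse_pair_t_closure_product[OF inverse_pair_sym[OF pair]]
    by (intro conjI exI[of _ "ideal_inverse B"]) blast+
qed

lemma span_finite_witness:
  assumes "finite F" "F \<subseteq> fract_module.span X"
  obtains Y where "finite Y" "Y \<subseteq> X" "F \<subseteq> fract_module.span Y"
proof -
  have "\<exists>Y. finite Y \<and> Y \<subseteq> X \<and> F \<subseteq> fract_module.span Y"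
    using assms
  proof (induction F rule: finite_induct)
    case empty
    then show ?case by (intro exI[of _ "{}"]) simp
  next
    case (insert x F)
    then obtain Y where Y: "finite Y" "Y \<subseteq> X" "F \<subseteq> fract_module.span Y" by blast
    have "x \<in> fract_module.span X" using insert.prems by blast
    then obtain t r where t: "finite t" "t \<subseteq> X" "x = (\<Sum>a\<in>t. fract_scale (r a) a)"
      unfolding fract_module.span_explicit by blast
    have "x \<in> fract_module.span t"
      unfolding t(3) by (intro fract_module.span_sum fract_module.span_scale fract_module.span_base)
    then have "insert x F \<subseteq> fract_module.span (Y \<union> t)"
      using Y(3) fract_module.span_mono[of Y "Y \<union> t"] fract_module.span_mono[of t "Y \<union> t"] by blast
    then show ?case using Y t by (intro exI[of _ "Y \<union> t"]) simp
  qed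
  then show ?thesis using that by blast
qed

text \<open>
  That \<open>1\<close> lies in the t-closure of \<open>I I'\<close> involves only finitely many products of elements of \<open>I\<close>
  and \<open>I'\<close>; their factors generate \<open>I\<close> and its inverse up to the v-closure.
\<close>

lemma t_invertible_inverse_pair:
  assumes "I \<in> carrier t_invertible_group"
  obtains B B' where "inverse_pair B B'" "I = ideal_inverse B'"
proof -
  let ?R = "range (to_fract :: 'a \<Rightarrow> _)"
  obtain I' where I: "fractional_ideal I" "t_closure I = I" and I': "fractional_ideal I'"
    and one: "t_closure (ideal_product I I') = ?R"
    using assms unfolding mem_t_invertible_group by blast
  let ?P = "{x * y | x y. x \<in> I \<and> y \<in> I'}"
  have PR: "x * y \<in> ?R" if "x \<in> I" "y \<in> I'" for x y
  proof (cases "x * y = 0")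
    case False
    have "x * y \<in> ideal_product I I'"
      unfolding ideal_product_def using that by (intro fract_module.span_base) blast
    then have "x * y \<in> t_closure (ideal_product I I')"
      using False fract_module.subspace_span unfolding ideal_product_def by (rule nonzero_mem_t_closure)
    then show ?thesis using one by blast
  qed (simp only: range_to_fract_simps(2))
  have "1 \<in> t_closure (ideal_product I I')" unfolding one by (rule range_to_fract_simps(1))
  then obtain J F where J: "J \<subseteq> ideal_product I I'" "fractional_ideal J" "finite F" "J = fract_module.span F"
    and 1: "1 \<in> v_closure J" unfolding t_closure_def by blast
  have "F \<subseteq> fract_module.span ?P"
    using J fract_module.span_superset[of F] unfolding ideal_product_def by blast
  then obtain Y where Y: "finite Y" "Y \<subseteq> ?P" "F \<subseteq> fract_module.span Y"
    by (rule span_finite_witness[OF J(3)])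
  have "Y \<subseteq> (\<lambda>(x, y). x * y) ` (I \<times> I')" using Y(2) by auto
  then obtain C where C: "C \<subseteq> I \<times> I'" "finite C" "Y = (\<lambda>(x, y). x * y) ` C"
    using finite_subset_image[OF Y(1)] by metis
  define B where "B = fst ` C"
  define B' where "B' = snd ` C"
  have BI: "B \<subseteq> I" "B' \<subseteq> I'" using C(1) by (auto simp: B_def B'_def)
  have JY: "J \<subseteq> fract_module.span Y"
    unfolding J(4) by (rule fract_module.span_minimal[OF Y(3) fract_module.subspace_span])
  have coprime: "z \<in> ?R" if z: "\<forall>b\<in>B. \<forall>b'\<in>B'. z * (b * b') \<in> ?R" for z
  proof -
    have "z \<in> ideal_inverse Y" using z unfolding C(3) by (force simp: mem_ideal_inverse B_def B'_def)
    then have "z \<in> ideal_inverse J"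
      using ideal_inverse_antimono[OF JY] unfolding ideal_inverse_span by blast
    then have "1 * z \<in> ?R" using 1 unfolding v_closure_def by (simp only: mem_ideal_inverse[of 1])
    then show ?thesis by simp
  qed
  have "\<exists>y\<in>Y. y \<noteq> 0"
  proof (rule ccontr)
    assume "\<not> ?thesis"
    then have "Y \<subseteq> {0}" by blast
    then have "fract_module.span Y \<subseteq> {0}"
      by (rule fract_module.span_minimal) (simp add: fract_module.subspace_0 subspace_iff)
    then show False using JY fractional_ideal_nonzero[OF J(2)] by blast
  qed
  then have nz: "\<exists>b\<in>B. b \<noteq> 0" "\<exists>b\<in>B'. b \<noteq> 0" unfolding C(3) by (force simp: B_def B'_def)+
  have pair: "inverse_pair B B'"
    unfolding inverse_pair_def
  proof (intro conjI ballI allI impI)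
    show "finite B" "finite B'" using C(2) by (simp_all add: B_def B'_def)
    show "b * b' \<in> ?R" if "b \<in> B" "b' \<in> B'" for b b' using PR BI that by blast
  qed (fact nz coprime)+
  moreover have "I = ideal_inverse B'"
  proof
    show "I \<subseteq> ideal_inverse B'" unfolding mem_ideal_inverse subset_iff using PR BI by blast
    obtain b where b: "b \<in> B" "b \<noteq> 0" using nz by blast
    have "fract_module.span B \<subseteq> I"
      using BI I(1) by (intro fract_module.span_minimal) (auto simp: fractional_ideal_def)
    then have "ideal_inverse (ideal_inverse B) \<subseteq> t_closure I"
      using C(2) by (intro v_closure_subset_t_closure[OF _ b]) (simp_all add: B_def)
    then have "ideal_inverse (ideal_inverse B) \<subseteq> I" by (simp only: I(2))
    moreover have "ideal_inverse B' \<subseteq> ideal_inverse (ideal_inverse B)"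
    proof
      fix x assume "x \<in> ideal_inverse B'"
      then show "x \<in> ideal_inverse (ideal_inverse B)"
        using inverse_pair_mult[OF pair] unfolding mem_ideal_inverse[of x "ideal_inverse B"] by blast
    qed
    ultimately show "ideal_inverse B' \<subseteq> I" by blast
  qed
  ultimately show ?thesis using that by blast
qed

lemma inverse_pair_scale:
  assumes pair: "inverse_pair B B'" and x: "x \<noteq> 0"
  shows "inverse_pair ((*) x ` B) ((*) (inverse x) ` B')"
    and "(*) x ` ideal_inverse B' = ideal_inverse ((*) (inverse x) ` B')"
proof -
  have eq: "x * b * (inverse x * b') = b * b'" for b b' using x by (simp add: mult.left_commute)
  show "inverse_pair ((*) x ` B) ((*) (inverse x) ` B')"
  proof -
    have "finite ((*) x ` B)" "finite ((*) (inverse x) ` B')"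
      "\<exists>b\<in>(*) x ` B. b \<noteq> 0" "\<exists>b\<in>(*) (inverse x) ` B'. b \<noteq> 0"
      using pair x unfolding inverse_pair_def by auto
    then show ?thesis
      using pair unfolding inverse_pair_def ball_simps(9) eq by (elim conjE) (intro conjI)
  qed
  show "(*) x ` ideal_inverse B' = ideal_inverse ((*) (inverse x) ` B')"
  proof (intro equalityI subsetI)
    fix y assume "y \<in> (*) x ` ideal_inverse B'"
    then obtain z where z: "y = x * z" "z \<in> ideal_inverse B'" by blast
    show "y \<in> ideal_inverse ((*) (inverse x) ` B')"
      using z(2) unfolding z(1) mem_ideal_inverse ball_simps(9) eq .
  next
    fix y assume y: "y \<in> ideal_inverse ((*) (inverse x) ` B')"
    have "inverse x * y * b = y * (inverse x * b)" for b by (simp only: mult_ac)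
    then have "inverse x * y \<in> ideal_inverse B'" using y unfolding mem_ideal_inverse by (metis imageI)
    moreover have "y = x * (inverse x * y)" using x by simp
    ultimately show "y \<in> (*) x ` ideal_inverse B'" by (rule rev_image_eqI)
  qed
qed

lemma t_invertible_scale:
  assumes "I \<in> carrier t_invertible_group" "x \<noteq> 0"
  shows "(*) x ` I \<in> carrier t_invertible_group"
proof -
  obtain B B' where "inverse_pair B B'" "I = ideal_inverse B'" by (rule t_invertible_inverse_pair[OF assms(1)])
  then show ?thesis
    using t_invertible_ideal_inverse[OF inverse_pair_scale(1)] inverse_pair_scale(2) assms(2) by metis
qed

section \<open>Classes of t-invertible t-ideals\<close>

lemma span_singleton: "fract_module.span {x} = (\<lambda>r. r * x) ` range to_fract"
  unfolding fract_module.span_singleton by (auto simp: fract_scale_def)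

lemma principal_product:
  assumes I: "I \<in> carrier t_invertible_group" and x: "x \<noteq> 0"
  shows "fract_module.span {x} \<otimes>\<^bsub>t_invertible_group\<^esub> I = (*) x ` I"
proof -
  have xI: "fractional_ideal ((*) x ` I)" "t_closure ((*) x ` I) = (*) x ` I"
    using t_invertible_scale[OF assms] unfolding mem_t_invertible_group by blast+
  have fI: "fractional_ideal I" using I unfolding mem_t_invertible_group by blast
  let ?P = "{p * y | p y. p \<in> fract_module.span {x} \<and> y \<in> I}"
  have "?P \<subseteq> (*) x ` I"
  proof
    fix z assume "z \<in> ?P"
    then obtain r y where z: "z = r * x * y" "r \<in> range to_fract" "y \<in> I" unfolding span_singleton by blast
    have "z = x * (r * y)" unfolding z(1) by (simp only: mult_ac)
    moreover have "r * y \<in> I" by (rule fractional_ideal_mult[OF fI z(2,3)])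
    ultimately show "z \<in> (*) x ` I" by blast
  qed
  moreover have "(*) x ` I \<subseteq> ?P" using fract_module.span_base[of x "{x}"] by blast
  ultimately have "?P = (*) x ` I" by blast
  then have "ideal_product (fract_module.span {x}) I = (*) x ` I"
    unfolding ideal_product_def using xI(1) by (simp add: fractional_ideal_def fract_module.span_eq_iff)
  then show ?thesis
    using xI(2) by (simp add: t_invertible_group_def units_of_def t_ideal_monoid_def)
qed

definition multiples :: "'a::idom fract set \<Rightarrow> 'a fract set set" where
  "multiples I = {(*) x ` I | x. x \<noteq> 0}"

lemma multiples_scale: "x \<noteq> 0 \<Longrightarrow> multiples ((*) x ` I) = multiples I"
proof -
  assume x: "x \<noteq> 0"
  have 1: "multiples ((*) x ` I) \<subseteq> multiples I" if "x \<noteq> 0" for x and I :: "'a fract set"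
  proof
    fix J assume "J \<in> multiples ((*) x ` I)"
    then obtain y where y: "y \<noteq> 0" "J = (*) y ` (*) x ` I" unfolding multiples_def by blast
    have "J = (*) (y * x) ` I" unfolding y(2) image_image by (intro image_cong refl) (simp only: mult.assoc)
    moreover have "y * x \<noteq> 0" using y(1) that by simp
    ultimately show "J \<in> multiples I" unfolding multiples_def by blast
  qed
  have "inverse x * (x * y) = y" for y using x by simp
  then have inv: "(*) (inverse x) ` (*) x ` I = I" by (simp only: image_image image_ident)
  have "inverse x \<noteq> 0" using x by simp
  from 1[OF this, of "(*) x ` I"] 1[OF x, of I] show ?thesis unfolding inv by (rule equalityI[rotated])
qed

lemma multiples_self: "I \<in> multiples I"
  unfolding multiples_def by (intro CollectI exI[of _ 1]) simp

lemma coset_eq_multiples: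
  assumes "I \<in> carrier t_invertible_group"
  shows "principal_ideals #>\<^bsub>t_invertible_group\<^esub> I = multiples I"
  unfolding r_coset_def principal_ideals_def multiples_def using principal_product[OF assms] by auto

lemma class_group_carrier: "carrier class_group = multiples ` carrier t_invertible_group"
  unfolding class_group_def FactGroup_def RCOSETS_def using coset_eq_multiples by auto

context torsionless_graded_domain
begin

lemma homogeneous_unit_ideal: "homogeneous_fractional D (fract_module.span {1})"
proof -
  have "fract_scale 1 ` fract_module.span {1} = to_fract ` (UNIV :: 'a set)"
    unfolding span_singleton fract_scale_def by (auto simp: image_image)
  moreover have "homogeneous_ideal D UNIV"
    unfolding homogeneous_ideal_def by (simp add: ring_module.subspace_UNIV)
  moreover have "fractional_ideal (fract_module.span {1 :: 'a fract})"
    by (rule fractional_ideal_span[of _ 1]) simp_all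
  ultimately show ?thesis
    unfolding homogeneous_fractional_def using S_1 by blast
qed

text \<open>
  The trivial ideal is a homogeneous principal ideal, so the class of \<open>I\<close> modulo these contains \<open>I\<close>, and its
  product with all principal ideals consists of all multiples of \<open>I\<close>.
\<close>

lemma HCl_to_Cl_coset:
  assumes I: "I \<in> carrier t_invertible_group"
  shows "HCl_to_Cl ({P \<in> principal_ideals. homogeneous_fractional D P} #>\<^bsub>homogeneous_t_invertible_group D\<^esub> I)
    = multiples I"
proof -
  let ?H = "{P \<in> principal_ideals. homogeneous_fractional D P}"
  let ?C = "?H #>\<^bsub>homogeneous_t_invertible_group D\<^esub> I"
  have C: "?C = (\<lambda>P. P \<otimes>\<^bsub>t_invertible_group\<^esub> I) ` ?H"
    unfolding r_coset_def homogeneous_t_invertible_group_def by auto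
  have "?C \<subseteq> multiples I"
  proof
    fix J assume "J \<in> ?C"
    then obtain P where P: "P \<in> principal_ideals" "J = P \<otimes>\<^bsub>t_invertible_group\<^esub> I" unfolding C by blast
    then show "J \<in> multiples I"
      using principal_product[OF I] unfolding principal_ideals_def multiples_def by blast
  qed
  then have sub: "J \<in> carrier t_invertible_group \<and> multiples J = multiples I" if "J \<in> ?C" for J
    using that t_invertible_scale[OF I] multiples_scale[of _ I] unfolding multiples_def[of I] by blast
  have "HCl_to_Cl ?C = (\<Union>J\<in>?C. principal_ideals #>\<^bsub>t_invertible_group\<^esub> J)"
    unfolding HCl_to_Cl_def set_mult_def r_coset_def by blast
  also have "\<dots> = (\<Union>J\<in>?C. multiples I)" using sub coset_eq_multiples by auto
  also have "\<dots> = multiples I"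
  proof -
    have "fract_module.span {1} \<in> ?H"
      using homogeneous_unit_ideal unfolding principal_ideals_def by auto
    then have "?C \<noteq> {}" unfolding C by blast
    then show ?thesis by blast
  qed
  finally show ?thesis .
qed

text \<open>
  Both sides of the equation are sets of cosets, and the coset of \<open>I\<close> consists of its multiples by
  nonzero elements of the quotient field.
\<close>

lemma class_groups_equal_iff:
  "carrier (class_group :: 'a fract set set monoid) = HCl_to_Cl ` carrier (homogeneous_class_group D) \<longleftrightarrow>
    (\<forall>I\<in>carrier t_invertible_group. \<exists>J\<in>carrier t_invertible_group. \<exists>x.
      homogeneous_fractional D J \<and> x \<noteq> 0 \<and> I = (*) x ` J)"
proof -
  let ?G = "carrier (t_invertible_group :: 'a fract set monoid)"
  have "HCl_to_Cl ` carrier (homogeneous_class_group D) = multiples ` {J \<in> ?G. homogeneous_fractional D J}"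
  proof -
    have "carrier (homogeneous_class_group D) = (\<lambda>I. {P \<in> principal_ideals. homogeneous_fractional D P}
        #>\<^bsub>homogeneous_t_invertible_group D\<^esub> I) ` {J \<in> ?G. homogeneous_fractional D J}"
      unfolding homogeneous_class_group_def FactGroup_def RCOSETS_def
      by (auto simp: homogeneous_t_invertible_group_def)
    then show ?thesis using HCl_to_Cl_coset by (auto simp: image_image)
  qed
  then have "carrier (class_group :: 'a fract set set monoid) = HCl_to_Cl ` carrier (homogeneous_class_group D) \<longleftrightarrow>
      multiples ` ?G = multiples ` {J \<in> ?G. homogeneous_fractional D J}"
    by (simp only: class_group_carrier)
  also have "\<dots> \<longleftrightarrow> (\<forall>I\<in>?G. \<exists>J\<in>?G. homogeneous_fractional D J \<and> multiples I = multiples J)"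
    by blast
  also have "\<dots> \<longleftrightarrow> (\<forall>I\<in>?G. \<exists>J\<in>?G. \<exists>x. homogeneous_fractional D J \<and> x \<noteq> 0 \<and> I = (*) x ` J)"
  proof -
    have "multiples I = multiples J \<longleftrightarrow> (\<exists>x. x \<noteq> 0 \<and> I = (*) x ` J)" for I J :: "'a fract set"
    proof
      assume "multiples I = multiples J"
      then have "I \<in> multiples J" using multiples_self[of I] by simp
      then show "\<exists>x. x \<noteq> 0 \<and> I = (*) x ` J" unfolding multiples_def by blast
    next
      assume "\<exists>x. x \<noteq> 0 \<and> I = (*) x ` J"
      then show "multiples I = multiples J" using multiples_scale by blast
    qed
    then show ?thesis by simp
  qed
  finally show ?thesis .
qed

end

section \<open>Almost normal domains have homogeneous ideal classes\<close>

context torsionless_graded_domain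
begin

lemma homogeneous_fractionalI:
  assumes I: "fractional_ideal I" and IT: "I \<subseteq> T" and s: "s \<in> S" "\<And>y. y \<in> I \<Longrightarrow> to_fract s * y \<in> R"
    and comp: "\<And>y \<alpha>. y \<in> I \<Longrightarrow> comp y \<alpha> \<in> I"
  shows "homogeneous_fractional D I"
proof -
  define J where "J = {a. to_fract a \<in> (*) (to_fract s) ` I}"
  have "fract_scale s ` I = to_fract ` J"
  proof (intro equalityI subsetI)
    fix x assume "x \<in> fract_scale s ` I"
    then obtain y where y: "x = to_fract s * y" "y \<in> I" unfolding fract_scale_def by blast
    obtain a where a: "to_fract s * y = to_fract a" using s(2)[OF y(2)] by blast
    then have "a \<in> J" using y(2) unfolding J_def mem_Collect_eq a[symmetric] by blast
    then show "x \<in> to_fract ` J" using y(1) a by blast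
  next
    fix x assume "x \<in> to_fract ` J"
    then show "x \<in> fract_scale s ` I" unfolding J_def fract_scale_def by blast
  qed
  moreover have "homogeneous_ideal D J"
    unfolding homogeneous_ideal_def
  proof (intro conjI ballI allI impI)
    have I': "0 \<in> I" "\<And>x y. x \<in> I \<Longrightarrow> y \<in> I \<Longrightarrow> x + y \<in> I"
      using I unfolding fractional_ideal_def subspace_iff by blast+
    show "ring_module.subspace J"
      unfolding ring_module.subspace_def J_def mem_Collect_eq
    proof (intro conjI ballI allI impI)
      show "to_fract 0 \<in> (*) (to_fract s) ` I" by (rule image_eqI[OF _ I'(1)]) simp
    next
      fix a b assume "a \<in> {a. to_fract a \<in> (*) (to_fract s) ` I}" "b \<in> {a. to_fract a \<in> (*) (to_fract s) ` I}"
      then obtain x y where xy: "to_fract a = to_fract s * x" "to_fract b = to_fract s * y" "x \<in> I" "y \<in> I" by blast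
      show "to_fract (a + b) \<in> (*) (to_fract s) ` I"
        by (rule image_eqI[OF _ I'(2)[OF xy(3,4)]]) (simp only: to_fract_add xy distrib_left)
    next
      fix r a assume "a \<in> {a. to_fract a \<in> (*) (to_fract s) ` I}"
      then obtain x where x: "to_fract a = to_fract s * x" "x \<in> I" by blast
      show "to_fract (r * a) \<in> (*) (to_fract s) ` I"
        by (rule image_eqI[OF _ fractional_ideal_mult[OF I rangeI[of _ r] x(2)]])
          (simp only: to_fract_mult x mult.left_commute)
    qed
    fix a f \<gamma> assume "a \<in> J" and f: "decomposes D a f"
    then obtain y where y: "to_fract a = to_fract s * y" "y \<in> I" unfolding J_def by blast
    obtain \<sigma> where \<sigma>: "to_fract s \<in> piece \<sigma>" by (rule S_piece[OF s(1)])
    have "to_fract (f \<gamma>) = comp (to_fract s * y) (to_quot_group \<gamma>)"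
      using comp_to_fract[OF f] y(1) by simp
    also have "\<dots> = to_fract s * comp y (to_quot_group \<gamma> - \<sigma>)"
      using y(2) IT by (intro comp_shift[OF \<sigma>]) blast
    finally show "f \<gamma> \<in> J" unfolding J_def using comp[OF y(2)] by blast
  qed
  ultimately show ?thesis unfolding homogeneous_fractional_def using I s(1) by blast
qed

text \<open>
  The greatest common divisor \<open>d\<close> in \<open>T\<close> of the generators \<open>B'\<close> of the inverse of \<open>I\<close> moves \<open>I\<close> into \<open>T\<close>:
  the ideal \<open>d I\<close> is the colon ideal of the elements \<open>b' / d\<close> of \<open>T\<close>, hence homogeneous.
\<close>

lemma t_invertible_homogeneous_multiple:
  assumes an: "almost_normal D" and inert: "inert (D 0)" and I: "I \<in> carrier t_invertible_group"
  shows "\<exists>J\<in>carrier t_invertible_group. \<exists>x. homogeneous_fractional D J \<and> x \<noteq> 0 \<and> I = (*) x ` J"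
proof -
  obtain B B' where pair: "inverse_pair B B'" and IB: "I = ideal_inverse B'"
    by (rule t_invertible_inverse_pair[OF I])
  have B: "finite B" "finite B'" "\<exists>b\<in>B'. b \<noteq> 0" using pair unfolding inverse_pair_def by blast+
  have "finite (B' - {0})" "B' - {0} \<noteq> {}" "0 \<notin> B' - {0}" using B by auto
  then obtain d where d: "d \<noteq> 0" and gcd': "\<And>h. (\<forall>b\<in>B' - {0}. b * h \<in> T) \<longleftrightarrow> d * h \<in> T"
    by (rule T_gcd) blast
  have gcd: "(\<forall>b\<in>B'. b * h \<in> T) \<longleftrightarrow> d * h \<in> T" for h
    unfolding gcd'[symmetric] using T_simps(2) by (metis DiffI Diff_iff mult_zero_left singletonD)
  define L where "L = (*) d ` I"
  define C where "C = (*) (inverse d) ` B'"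
  have L: "L = ideal_inverse C" unfolding L_def C_def IB by (rule inverse_pair_scale(2)[OF pair d])
  have LG: "L \<in> carrier t_invertible_group" unfolding L_def by (rule t_invertible_scale[OF I d])
  have "d * inverse d \<in> T" using d T_simps(1) by simp
  then have "b * inverse d \<in> T" if "b \<in> B'" for b using that gcd[of "inverse d"] by blast
  then have CT: "c \<in> T" if "c \<in> C" for c
    using that unfolding C_def by (auto simp: mult.commute)
  have LT: "y \<in> T" if y: "y \<in> L" for y
  proof -
    obtain x where x: "y = d * x" "x \<in> I" using y unfolding L_def by blast
    then have "x * b \<in> R" if "b \<in> B'" for b using that unfolding IB mem_ideal_inverse by blast
    then have "b * x \<in> T" if "b \<in> B'" for b using that R_subset_T by (subst mult.commute) blast
    then show ?thesis unfolding x(1) using gcd by blast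
  qed
  have BL: "(*) d ` B \<subseteq> L" unfolding L_def IB using inverse_pair_subset[OF pair] by blast
  then have "(*) d ` B \<subseteq> T" using LT by blast
  moreover have "finite ((*) d ` B)" using B by simp
  ultimately obtain s where s: "s \<in> S" "\<forall>b\<in>(*) d ` B. to_fract s * b \<in> R"
    using T_common_denominator by blast
  have pairL: "inverse_pair ((*) d ` B) C" unfolding C_def by (rule inverse_pair_scale(1)[OF pair d])
  have "to_fract s \<in> ideal_inverse ((*) d ` B)" using s(2) unfolding mem_ideal_inverse by blast
  then have sL: "to_fract s * y \<in> R" if "y \<in> L" for y
    using inverse_pair_mult[OF pairL, of y "to_fract s"] that unfolding L by (simp only: mult.commute)
  have comp: "comp y \<alpha> \<in> L" if "y \<in> L" for y \<alpha>
  proof -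
    have "y * c \<in> R" if "c \<in> C" for c using \<open>y \<in> L\<close> that unfolding L mem_ideal_inverse by blast
    then have "comp y \<alpha> * c \<in> R" if "c \<in> C" for c
      using that by (intro colon_homogeneous[OF an inert CT LT[OF \<open>y \<in> L\<close>]])
    then show ?thesis unfolding L mem_ideal_inverse by blast
  qed
  have "fractional_ideal L" using LG unfolding mem_t_invertible_group by blast
  then have "homogeneous_fractional D L"
    by (rule homogeneous_fractionalI[OF _ _ s(1) sL comp]) (use LT in blast)
  moreover have "I = (*) (inverse d) ` L"
  proof -
    have "inverse d * (d * x) = x" for x using d by simp
    then show ?thesis unfolding L_def by (simp only: image_image image_ident)
  qed
  moreover have "inverse d \<noteq> 0" using d by simp
  ultimately show ?thesis using LG by blast
qed

section \<open>Homogeneous ideal classes force almost normality\<close>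

text \<open>
  The lowest component of \<open>x e\<close> is the lowest component of \<open>x\<close>, which therefore lies in \<open>R\<close> and can be
  subtracted from \<open>x\<close>.
\<close>

lemma mem_R_of_multiple:
  assumes lt: "translation_order lt" and e: "e \<in> R" "comp e 0 = 1" "\<And>\<gamma>. \<gamma> \<in> supp e \<Longrightarrow> \<gamma> = 0 \<or> lt 0 \<gamma>"
    and "x \<in> T" "x * e \<in> R"
  shows "x \<in> R"
  using assms(5,6)
proof (induction "card (supp x)" arbitrary: x rule: less_induct)
  case less
  have eT: "e \<in> T" using e(1) R_subset_T by blast
  show ?case
  proof (cases "x = 0")
    case True
    then show ?thesis using field_subring_0[OF R_ring] by (simp only:)
  next
    case False
    obtain \<alpha> where low: "lowest lt x \<alpha>" by (rule lowest_exists[OF lt less.prems(1) False])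
    have "lowest lt e 0" unfolding lowest_def using e(2,3) by (auto simp: supp_def)
    then have "comp (x * e) (\<alpha> + 0) = comp x \<alpha> * comp e 0"
      by (rule comp_mult_lowest[OF lt less.prems(1) eT low])
    then have c: "comp x \<alpha> \<in> R" using R_comp[OF less.prems(2), of \<alpha>] e(2) by simp
    have cT: "comp x \<alpha> \<in> T" using c R_subset_T by blast
    have comp': "comp (x - comp x \<alpha>) = (\<lambda>\<beta>. if \<beta> = \<alpha> then 0 else comp x \<beta>)"
      using comp_diff[OF less.prems(1) cT] comp_homogeneous[OF comp_piece[OF less.prems(1), of \<alpha>]] by auto
    have "supp (x - comp x \<alpha>) \<subset> supp x"
      using low by (auto simp: lowest_def supp_def comp' split: if_splits)
    then have "card (supp (x - comp x \<alpha>)) < card (supp x)"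
      by (intro psubset_card_mono finite_supp less.prems)
    moreover have "(x - comp x \<alpha>) * e \<in> R"
      unfolding left_diff_distrib
      by (rule field_subring_diff[OF R_ring less.prems(2) field_subring_mult[OF R_ring c e(1)]])
    ultimately have "x - comp x \<alpha> \<in> R" by (rule less.hyps[OF _ T_diff[OF less.prems(1) cT]])
    then have "(x - comp x \<alpha>) + comp x \<alpha> \<in> R" using c by (rule field_subring_add[OF R_ring])
    then show ?thesis by simp
  qed
qed

text \<open>
  The ideal whose inverse is generated by \<open>g\<close> and a homogeneous denominator \<open>a\<close> is t-invertible by the previous
  lemma.  It is contained in \<open>T\<close> and contains \<open>a\<close>, so it can be a multiple of a homogeneous ideal only
  by a unit of \<open>T\<close>.  Such a unit is homogeneous, and the ideal contains the components of \<open>f\<close> with \<open>f\<close>.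
\<close>

lemma unimodular_product:
  assumes hom: "\<forall>I\<in>carrier t_invertible_group. \<exists>J\<in>carrier t_invertible_group. \<exists>x.
      homogeneous_fractional D J \<and> x \<noteq> 0 \<and> I = (*) x ` J"
    and lt: "translation_order lt" and f: "f \<in> T" and g: "g \<in> T"
    and e: "f * g \<in> R" "comp (f * g) 0 = 1" "\<And>\<gamma>. \<gamma> \<in> supp (f * g) \<Longrightarrow> \<gamma> = 0 \<or> lt 0 \<gamma>"
  shows "comp f \<alpha> * g \<in> R"
proof -
  have "f * g \<noteq> 0" using e(2) by (auto simp: comp_0)
  then have nz: "f \<noteq> 0" "g \<noteq> 0" by auto
  obtain s where s: "s \<in> S" "to_fract s * f \<in> R" "to_fract s * g \<in> R"
    using T_common_denominator[of "{f, g}"] f g by auto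
  define a where "a = to_fract s"
  have a: "a \<in> R" "a * f \<in> R" "a * g \<in> R" using s by (simp_all add: a_def)
  have aa: "a * a \<in> R" using field_subring_mult[OF R_ring a(1,1)] .
  obtain \<sigma> where \<sigma>: "a \<in> piece \<sigma>" "a \<noteq> 0" unfolding a_def by (rule S_piece[OF s(1)])
  have TI: "x \<in> T" if "x * a \<in> R" for x
    using that T_iff s(1) unfolding a_def by (metis mult.commute)
  have pair: "inverse_pair {f, a} {g, a}"
    unfolding inverse_pair_def
  proof (intro conjI allI impI)
    show "\<forall>b\<in>{f, a}. \<forall>b'\<in>{g, a}. b * b' \<in> R"
      using e(1) a aa by (auto simp only: ball_simps mult.commute)
    fix z assume *: "\<forall>b\<in>{f, a}. \<forall>b'\<in>{g, a}. z * (b * b') \<in> R"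
    then have "z * a * a \<in> R" by (simp only: ball_simps mult.assoc)
    then have "z * a \<in> T" by (rule TI)
    then have "z * a * inverse a \<in> T"
      using T_piece[OF piece_inverse[OF \<sigma>(1)]] by (rule T_simps(4))
    then have zT: "z \<in> T" using \<sigma>(2) by (simp add: mult.assoc)
    have zR: "z * (f * g) \<in> R" using * by blast
    show "z \<in> R" by (rule mem_R_of_multiple[OF lt e(1,2) _ zT zR]) (rule e(3))
  qed (use nz in auto)
  define I where "I = ideal_inverse {g, a}"
  have memI: "x \<in> I \<longleftrightarrow> x * g \<in> R \<and> x * a \<in> R" for x unfolding I_def mem_ideal_inverse by simp
  have "I \<in> carrier t_invertible_group" unfolding I_def by (rule t_invertible_ideal_inverse[OF pair])
  then obtain L h where "homogeneous_fractional D L" and h: "h \<noteq> 0" "I = (*) h ` L" using hom by blast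
  then obtain r J where r: "r \<in> S" and J: "homogeneous_ideal D J" and rL: "fract_scale r ` L = to_fract ` J"
    and L: "fractional_ideal L" unfolding homogeneous_fractional_def by blast
  obtain \<rho> where \<rho>: "to_fract r \<in> piece \<rho>" "to_fract r \<noteq> 0" by (rule S_piece[OF r])
  have LJ: "y \<in> L \<longleftrightarrow> (\<exists>j\<in>J. to_fract r * y = to_fract j)" for y
  proof
    assume "y \<in> L"
    then have "fract_scale r y \<in> to_fract ` J" using rL by blast
    then show "\<exists>j\<in>J. to_fract r * y = to_fract j" unfolding fract_scale_def by blast
  next
    assume "\<exists>j\<in>J. to_fract r * y = to_fract j"
    then have "fract_scale r y \<in> fract_scale r ` L" unfolding rL fract_scale_def by blast
    then obtain y' where "y' \<in> L" "to_fract r * y = to_fract r * y'" unfolding fract_scale_def by blast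
    then show "y \<in> L" using \<rho>(2) by simp
  qed
  have LT: "y \<in> T" if "y \<in> L" for y using that r unfolding LJ T_iff by blast
  have Lcomp: "comp y \<beta> \<in> L" if y: "y \<in> L" for y \<beta>
  proof -
    obtain j where j: "j \<in> J" "to_fract r * y = to_fract j" using y LJ by blast
    obtain k where k: "decomposes D j k" using D_decomposition by blast
    have c: "to_fract r * comp y \<beta> = comp (to_fract j) (\<beta> + \<rho>)"
      using comp_shift[OF \<rho>(1) LT[OF y], of "\<beta> + \<rho>"] j(2) by simp
    have kJ: "k \<gamma> \<in> J" for \<gamma> using J j(1) k unfolding homogeneous_ideal_def by blast
    show ?thesis
    proof (cases "\<beta> + \<rho> \<in> supp (to_fract j)")
      case True
      then obtain \<gamma> where "\<beta> + \<rho> = to_quot_group \<gamma>" using supp_to_fract[OF k] by blast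
      then have "to_fract r * comp y \<beta> = to_fract (k \<gamma>)" unfolding c using comp_to_fract[OF k] by simp
      then show ?thesis unfolding LJ using kJ by blast
    next
      case False
      then have "comp y \<beta> = 0" using c \<rho>(2) by (simp add: supp_def)
      moreover have "0 \<in> L" using L unfolding fractional_ideal_def subspace_iff by blast
      ultimately show ?thesis by simp
    qed
  qed
  have hT: "h \<in> T"
  proof -
    obtain y where y: "y \<in> L" "y \<noteq> 0" using fractional_ideal_nonzero[OF L] by blast
    then obtain \<beta> where \<beta>: "comp y \<beta> \<noteq> 0" using supp_empty_iff[OF LT[OF y(1)]] by (auto simp: supp_def)
    have "h * comp y \<beta> \<in> I" unfolding h(2) using Lcomp[OF y(1)] by blast
    then have "h * comp y \<beta> \<in> T" using memI TI by blast
    then have "h * comp y \<beta> * inverse (comp y \<beta>) \<in> T"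
      using T_piece[OF piece_inverse[OF comp_piece[OF LT[OF y(1)]]]] by (rule T_simps(4))
    then show ?thesis using \<beta> by (simp add: mult.assoc)
  qed
  have ihT: "inverse h \<in> T"
  proof -
    have "a \<in> I" unfolding memI using a aa by blast
    then obtain y where y: "y \<in> L" "a = h * y" unfolding h(2) by blast
    have "y * inverse a \<in> T" using LT[OF y(1)] T_piece[OF piece_inverse[OF \<sigma>(1)]] by (rule T_simps(4))
    moreover have "inverse h = y * inverse a" using \<sigma>(2) h(1) unfolding y(2) by (auto simp: field_simps)
    ultimately show ?thesis by simp
  qed
  obtain \<eta> where \<eta>: "h \<in> piece \<eta>" using unit_homogeneous[OF lt hT ihT h(1)] by blast
  have "f \<in> I" unfolding memI using e(1) a(2) by (simp add: mult.commute)
  then obtain y where y: "y \<in> L" "f = h * y" unfolding h(2) by blast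
  have "comp f \<alpha> = h * comp y (\<alpha> - \<eta>)" unfolding y(2) by (rule comp_shift[OF \<eta> LT[OF y(1)]])
  then have "comp f \<alpha> \<in> I" unfolding h(2) using Lcomp[OF y(1)] by blast
  then show ?thesis unfolding memI by blast
qed

text \<open>
  With an integral equation \<open>z ^ n + \<dots> + r 1 z + r 0 = 0\<close> with homogeneous coefficients, the polynomial
  is \<open>X - z\<close> times \<open>c 0 X ^ (n - 1) + \<dots> + c (n - 1)\<close>.  Evaluation at \<open>X = 1\<close> gives a product
  of the form required in the previous lemma.
\<close>

lemma almost_normal_if_homogeneous_classes:
  assumes hom: "\<forall>I\<in>carrier t_invertible_group. \<exists>J\<in>carrier t_invertible_group. \<exists>x.
      homogeneous_fractional D J \<and> x \<noteq> 0 \<and> I = (*) x ` J"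
  shows "almost_normal D"
  unfolding almost_normal_def
proof (intro allI impI ballI)
  fix \<alpha> z assume \<alpha>: "\<alpha> \<noteq> 0" and "z \<in> RS_piece D \<alpha>" and "integral_elem z"
  then have z: "z \<in> piece \<alpha>" unfolding piece_def by blast
  have "integral_over R z" unfolding integral_over_iff_integral_elem by fact
  then obtain p where p: "lead_coeff p = 1" "\<And>i. coeff p i \<in> R" "poly p z = 0"
    unfolding integral_over_def by blast
  define n where "n = degree p"
  define N where "N = (\<lambda>i::nat. \<Sum>j<i. \<alpha>)"
  have N_0: "N 0 = 0" and N_Suc: "N (Suc i) = N i + \<alpha>" for i by (simp_all add: N_def)
  have N_add: "N (i + j) = N i + N j" for i j unfolding N_def by (rule sum_const_add)
  have N_nz: "N i \<noteq> 0" if "i > 0" for i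
    using torsion_free_degrees \<alpha> that unfolding torsion_free_def N_def by blast
  obtain lt0 where lt0: "translation_order (lt0 :: 'g quot_group \<Rightarrow> _)" by (rule degree_order_exists)
  obtain lt where lt: "translation_order (lt :: 'g quot_group \<Rightarrow> _)" and pos: "lt 0 \<alpha>"
  proof (cases "lt0 0 \<alpha>")
    case True
    then show ?thesis using that lt0 by blast
  next
    case False
    then have "lt0 \<alpha> 0" using lt0 \<alpha> unfolding translation_order_def by metis
    then show ?thesis using that[OF translation_order_converse[OF lt0]] by blast
  qed
  have N_pos: "lt 0 (N (Suc i))" for i
  proof (induction i)
    case (Suc i)
    have "lt (0 + \<alpha>) (N (Suc i) + \<alpha>)" using lt Suc unfolding translation_order_def by blast
    then have "lt \<alpha> (N (Suc (Suc i)))" by (simp only: N_Suc[of "Suc i"] add_0_left)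
    then show ?case using lt pos by (simp add: translation_order_def)
  qed (simp add: N_Suc N_0 pos)
  have zp: "z ^ i \<in> piece (N i)" for i
  proof (induction i)
    case (Suc i)
    then show ?case using piece_mult[OF z Suc] by (simp add: N_Suc add.commute)
  qed (simp add: N_0 piece_1)
  have pT: "coeff p i \<in> T" for i using p(2) R_subset_T by blast
  define r where "r i = comp (coeff p i) (N n - N i)" for i
  have rR: "r i \<in> R" for i unfolding r_def by (rule R_comp[OF p(2)])
  have rp: "r i \<in> piece (N n - N i)" for i unfolding r_def by (rule comp_piece[OF pT])
  have rn: "r n = 1" using p(1) by (simp add: r_def n_def comp_1)
  have "0 = comp (poly p z) (N n)" by (simp add: p(3) comp_0)
  also have "\<dots> = (\<Sum>i\<le>n. comp (z ^ i * coeff p i) (N n))"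
    unfolding poly_altdef n_def[symmetric] mult.commute[of "coeff p _"]
    by (rule comp_sum[OF T_simps(4)[OF T_piece[OF zp] pT]])
  also have "\<dots> = (\<Sum>i\<le>n. z ^ i * r i)" unfolding comp_shift[OF zp pT] r_def ..
  finally have equation: "(\<Sum>i\<le>n. z ^ i * r i) = 0" by (rule sym)
  define c where "c = rec_nat 1 (\<lambda>j y. z * y + r (n - Suc j))"
  have c_0: "c 0 = 1" and c_Suc: "c (Suc j) = z * c j + r (n - Suc j)" for j by (simp_all add: c_def)
  have cp: "c j \<in> piece (N j)" if "j \<le> n" for j
    using that
  proof (induction j)
    case (Suc j)
    have "N n = N (n - Suc j) + N (Suc j)" using Suc.prems by (simp flip: N_add)
    then have "r (n - Suc j) \<in> piece (N (Suc j))" using rp[of "n - Suc j"] by simp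
    moreover have "z * c j \<in> piece (N (Suc j))"
      using piece_mult[OF z Suc.IH] Suc.prems by (simp add: N_Suc add.commute)
    ultimately show ?case unfolding c_Suc by (intro piece_add)
  qed (simp add: c_0 N_0 piece_1)
  have horner: "c j * z ^ (n - j) + (\<Sum>i<n - j. z ^ i * r i) = 0" if "j \<le> n" for j
    using that
  proof (induction j)
    case 0
    show ?case using equation rn by (simp add: c_0 lessThan_Suc_atMost[symmetric] add.commute)
  next
    case (Suc j)
    define m where "m = n - Suc j"
    have m: "n - j = Suc m" using Suc.prems by (simp add: m_def)
    have "c (Suc j) * z ^ m + (\<Sum>i<m. z ^ i * r i) = c j * z ^ Suc m + (\<Sum>i<Suc m. z ^ i * r i)"
      unfolding c_Suc m_def[symmetric] sum.lessThan_Suc power_Suc distrib_right by (simp only: ac_simps)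
    also have "\<dots> = 0" using Suc.IH Suc.prems unfolding m by simp
    finally show ?case unfolding m_def .
  qed
  have cn: "c n = 0" using horner[of n] by simp
  define f where "f = 1 - z"
  define g where "g = (\<Sum>j<n. c j)"
  have fT: "f \<in> T" unfolding f_def by (rule T_diff[OF T_simps(1) T_piece[OF z]])
  have cT: "c j \<in> T" if "j < n" for j using cp[of j] that T_piece by simp
  have gT: "g \<in> T" unfolding g_def by (rule T_simps(7)) (use cT in simp)
  have fg: "f * g = 1 + (\<Sum>j<n. r (n - Suc j))"
  proof -
    have "f * g = (\<Sum>j<n. (c j - c (Suc j)) + r (n - Suc j))"
      unfolding g_def sum_distrib_left f_def by (intro sum.cong refl) (simp add: c_Suc algebra_simps)
    also have "\<dots> = (\<Sum>j<n. c j - c (Suc j)) + (\<Sum>j<n. r (n - Suc j))" by (rule sum.distrib)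
    also have "(\<Sum>j<n. c j - c (Suc j)) = c 0 - c n" by (rule sum_lessThan_telescope')
    finally show ?thesis by (simp add: c_0 cn)
  qed
  have rp': "r (n - Suc j) \<in> piece (N (Suc j))" if "j < n" for j
  proof -
    have "N n = N (n - Suc j) + N (Suc j)" using that by (simp flip: N_add)
    then show ?thesis using rp[of "n - Suc j"] by simp
  qed
  have comp_fg: "comp (f * g) \<gamma> = (if \<gamma> = 0 then 1 else 0) + (\<Sum>j<n. if \<gamma> = N (Suc j) then r (n - Suc j) else 0)" for \<gamma>
  proof -
    have rT: "r (n - Suc j) \<in> T" for j using rR R_subset_T by blast
    have "comp (f * g) \<gamma> = comp 1 \<gamma> + (\<Sum>j<n. comp (r (n - Suc j)) \<gamma>)"
      unfolding fg comp_sum[OF rT, symmetric] by (rule comp_add[OF T_simps(1) T_simps(7)[OF rT]])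
    then show ?thesis using comp_homogeneous[OF rp'] by (simp add: comp_1)
  qed
  have "comp f 0 * g \<in> R"
  proof (rule unimodular_product[OF hom lt fT gT])
    show "f * g \<in> R" unfolding fg
      by (rule field_subring_add[OF R_ring field_subring_1[OF R_ring] field_subring_sum[OF R_ring rR]])
    have "N (Suc j) \<noteq> 0" for j by (rule N_nz) simp
    then show "comp (f * g) 0 = 1" unfolding comp_fg by (simp add: eq_commute[of 0])
    fix \<gamma> assume \<gamma>: "\<gamma> \<in> supp (f * g)"
    show "\<gamma> = 0 \<or> lt 0 \<gamma>"
    proof (rule ccontr)
      assume *: "\<not> (\<gamma> = 0 \<or> lt 0 \<gamma>)"
      then have "\<gamma> \<noteq> N (Suc j)" for j using N_pos by blast
      then have "comp (f * g) \<gamma> = 0" unfolding comp_fg using * by simp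
      then show False using \<gamma> by (simp add: supp_def)
    qed
  qed
  moreover have "comp f 0 = 1"
    unfolding f_def comp_diff[OF T_simps(1) T_piece[OF z]] using comp_homogeneous[OF z] \<alpha> by (simp add: comp_1)
  ultimately have gR: "g \<in> R" by simp
  have "n \<noteq> 0"
  proof
    assume "n = 0"
    then have "poly p z = 1" using p(1) by (simp add: poly_altdef n_def)
    with p(3) show False by simp
  qed
  have "c 1 \<in> R"
  proof (cases "n = 1")
    case True
    then show ?thesis using cn field_subring_0[OF R_ring] by simp
  next
    case False
    then have "1 < n" using \<open>n \<noteq> 0\<close> by simp
    have N1: "\<alpha> = N j \<longleftrightarrow> j = 1" for j
    proof (cases j)
      case (Suc i)
      then show ?thesis using N_nz[of i] by (auto simp: N_Suc N_0)
    qed (use \<alpha> in \<open>simp add: N_0\<close>)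
    have "comp g \<alpha> = (\<Sum>j<n. comp (c j) \<alpha>)" unfolding g_def by (rule comp_sum) (use cT in simp)
    also have "\<dots> = (\<Sum>j<n. if j = 1 then c j else 0)"
      using comp_homogeneous[OF cp] by (intro sum.cong refl) (simp add: N1)
    also have "\<dots> = c 1" using \<open>1 < n\<close> by simp
    finally show ?thesis using R_comp[OF gR, of \<alpha>] by simp
  qed
  moreover have "c 1 = z + r (n - 1)" using c_Suc[of 0] c_0 by simp
  ultimately have "z + r (n - 1) \<in> R" by simp
  then have "z + r (n - 1) - r (n - 1) \<in> R" by (rule field_subring_diff[OF R_ring _ rR])
  then show "z \<in> range to_fract" by simp
qed

end

theorem theorem1p1:
  fixes D :: "'g::comm_monoid_add \<Rightarrow> 'a::idom set"
  assumes "torsionless_grading_monoid TYPE('g)"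
    and "graded_domain D"
    and "inert (D 0)"
  shows "carrier (class_group :: 'a fract set set monoid)
           = HCl_to_Cl ` carrier (homogeneous_class_group D)
         \<longleftrightarrow> almost_normal D"
proof -
  interpret torsionless_graded_domain D by unfold_locales fact+
  show ?thesis
    unfolding class_groups_equal_iff
    using almost_normal_if_homogeneous_classes t_invertible_homogeneous_multiple[OF _ assms(3)] by blast
qed

end
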